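(* Let $N_1<N_2<\dots<N_d$ be pairwise relatively prime integers greater than one such that $N_d\le 2N_1$ and such that the list $N_i+N_j$, $1\le i<j\le d$, contains no repeated elements. Then the geodesics $\gamma_{i,j}$, $1\le i<j\le d$, are the $\binom{d}{2}$ shortest geodesics of the weighted projective space $X=X(N_1,\dots,N_d)$. Therefore, if $d$ is not a power of two, the set of weights $\{N_1,\dots,N_d\}$ is spectrally determined, i.e. it is determined by the spectrum of the Laplace operator on $X$.
   Context: Throughout, weights are pairwise relatively prime integers greater than one. For weights $N_1,\dots,N_d$, the weighted projective space is $X=X(N_1,\dots,N_d)=S^{2d-1}/S^1$, where $S^{2d-1}\subset\mathbb{C}^d=\mathbb{R}^{2d}$ is the round unit sphere and $S^1$ acts by $e^{it}\cdot(z_1,\dots,z_d)=(e^{iN_1t}z_1,\dots,e^{iN_dt}z_d)$; $X$ is a Riemannian orbifold with the quotient metric. Geodesics on $X$ are the images in $X$ of the horizontal great circles of $S^{2d-1}$, i.e. the great circles $V\cap S^{2d-1}$ ($V\subset\mathbb{R}^{2d}$ a real two-dimensional subspace) that are everywhere orthogonal to the $S^1$-orbits. The length (period) of the closed geodesic of $X$ coming from $V$ is $2\pi/m$, where $m$ is the order of the stabilizer of $V$ in $S^1$ for the induced action on two-dimensional subspaces of $\mathbb{R}^{2d}$. For $i<j$, $\gamma_{i,j}$ is the geodesic of $X$ lying in the totally geodesic weighted projective line coming from the sum of the $i$th and $j$th coordinate lines of $\mathbb{C}^d$, namely the common image in $X$ of the horizontal great circles $V_\lambda\cap S^{2d-1}$,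 where $V_\lambda=\{z\in\mathbb{C}^d : z_j=\lambda\overline{z_i},\ z_k=0 \text{ for } k\ne i,j\}$ and $|\lambda|^2=N_i/N_j$ (all these $\lambda$ give the same geodesic of $X$). It has length $2\pi/(N_i+N_j)$. The Laplace operator of $S^{2d-1}$ preserves the $S^1$-invariant smooth functions and, via $C^\infty(X)=C^\infty(S^{2d-1})^{S^1}$, defines the Laplace operator on $X$. *)

theory Defs
  imports "HOL-Analysis.Analysis" "HOL-Library.Function_Algebras"
begin

definition weights :: "('n::finite \<Rightarrow> nat) \<Rightarrow> bool" where
  "weights N \<longleftrightarrow> (\<forall>i. 1 < N i) \<and> pairwise (\<lambda>i j. coprime (N i) (N j)) UNIV"


section \<open>The circle action and the quotient\<close>

text \<open>The circle is the set \<open>sphere 0 1\<close> of complex numbers, \<open>\<complex>\<^sup>d\<close> is \<open>complex ^ 'n\<close> with \<open>d = CARD('n)\<close>,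
  and a point of the weighted projective space is an orbit of a point of the unit sphere. On
  \<open>complex ^ 'n\<close>, \<open>inner\<close>, \<open>subspace\<close> and \<open>dim\<close> are the real notions.\<close>

definition circle_act :: "('n::finite \<Rightarrow> nat) \<Rightarrow> complex \<Rightarrow> complex ^ 'n \<Rightarrow> complex ^ 'n" where
  "circle_act N u z = (\<chi> k. u ^ N k * z $ k)"

definition orbit :: "('n::finite \<Rightarrow> nat) \<Rightarrow> complex ^ 'n \<Rightarrow> (complex ^ 'n) set" where
  "orbit N z = (\<lambda>u. circle_act N u z) ` sphere 0 1"

definition orbit_velocity :: "('n::finite \<Rightarrow> nat) \<Rightarrow> complex ^ 'n \<Rightarrow> complex ^ 'n" where
  "orbit_velocity N z = vector_derivative (\<lambda>t. circle_act N (cis t) z) (at 0)"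


section \<open>Geodesics\<close>

text \<open>\<open>V\<close> spans a horizontal great circle: at each of its points \<open>z\<close>, the tangent vectors of the
  circle (those \<open>v \<in> V\<close> orthogonal to \<open>z\<close>) are orthogonal to the orbit of \<open>z\<close>.\<close>

definition horizontal_plane :: "('n::finite \<Rightarrow> nat) \<Rightarrow> (complex ^ 'n) set \<Rightarrow> bool" where
  "horizontal_plane N V \<longleftrightarrow> subspace V \<and> dim V = 2 \<and>
     (\<forall>z \<in> V \<inter> sphere 0 1. \<forall>v \<in> V. inner v z = 0 \<longrightarrow> inner v (orbit_velocity N z) = 0)"

definition circle_image :: "('n::finite \<Rightarrow> nat) \<Rightarrow> (complex ^ 'n) set \<Rightarrow> (complex ^ 'n) set set" where
  "circle_image N V = orbit N ` (V \<inter> sphere 0 1)"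

definition stabilizer :: "('n::finite \<Rightarrow> nat) \<Rightarrow> (complex ^ 'n) set \<Rightarrow> complex set" where
  "stabilizer N V = {u \<in> sphere 0 1. circle_act N u ` V = V}"

text \<open>\<open>g\<close> is a geodesic of the weighted projective space, and its length is \<open>l\<close>.\<close>

definition geodesic_of_length :: "('n::finite \<Rightarrow> nat) \<Rightarrow> (complex ^ 'n) set set \<Rightarrow> real \<Rightarrow> bool" where
  "geodesic_of_length N g l \<longleftrightarrow>
     (\<exists>V. horizontal_plane N V \<and> g = circle_image N V \<and> l = 2 * pi / real (card (stabilizer N V)))"

definition are_shortest_geodesics :: "('n::finite \<Rightarrow> nat) \<Rightarrow> (complex ^ 'n) set set set \<Rightarrow> bool" where
  "are_shortest_geodesics N \<Gamma> \<longleftrightarrow>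
     (\<forall>g \<in> \<Gamma>. \<exists>l. geodesic_of_length N g l) \<and>
     (\<forall>g l h l'. g \<in> \<Gamma> \<and> geodesic_of_length N g l \<and> h \<notin> \<Gamma> \<and> geodesic_of_length N h l' \<longrightarrow> l < l')"

definition gamma_plane :: "'n::finite \<Rightarrow> 'n \<Rightarrow> complex \<Rightarrow> (complex ^ 'n) set" where
  "gamma_plane i j c = {z. z $ j = c * cnj (z $ i) \<and> (\<forall>k. k \<noteq> i \<and> k \<noteq> j \<longrightarrow> z $ k = 0)}"

text \<open>Any \<open>c\<close> with \<open>|c|\<^sup>2 = N i / N j\<close> gives the same geodesic, see \<open>circle_image_gamma_plane\<close>.\<close>

definition gamma :: "('n::finite \<Rightarrow> nat) \<Rightarrow> 'n \<Rightarrow> 'n \<Rightarrow> (complex ^ 'n) set set" where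
  "gamma N i j = circle_image N (gamma_plane i j (complex_of_real (sqrt (real (N i) / real (N j)))))"


section \<open>The Laplace spectrum\<close>

primrec differentiable_times ::
    "nat \<Rightarrow> ('a::real_normed_vector \<Rightarrow> 'b::real_normed_vector) \<Rightarrow> 'a set \<Rightarrow> bool" where
  "differentiable_times 0 f S \<longleftrightarrow> continuous_on S f"
| "differentiable_times (Suc n) f S \<longleftrightarrow> (\<forall>x\<in>S. f differentiable (at x)) \<and>
     (\<forall>v. differentiable_times n (\<lambda>x. frechet_derivative f (at x) v) S)"

definition radial_ext :: "('a::real_normed_vector \<Rightarrow> 'b) \<Rightarrow> 'a \<Rightarrow> 'b" where
  "radial_ext f x = f (x /\<^sub>R norm x)"

text \<open>As \<open>x \<mapsto> x / |x|\<close> is a smooth retraction onto the unit sphere, a function on the sphere is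
  smooth iff its extension that is constant along rays is smooth off the origin. That extension has
  no radial derivatives, so on the sphere its Euclidean Laplacian is the Laplacian \<open>div grad\<close> of the
  round metric.\<close>

definition sphere_smooth :: "('a::euclidean_space \<Rightarrow> complex) \<Rightarrow> bool" where
  "sphere_smooth f \<longleftrightarrow> (\<forall>n. differentiable_times n (radial_ext f) (- {0}))"

definition sphere_laplacian :: "('a::euclidean_space \<Rightarrow> complex) \<Rightarrow> 'a \<Rightarrow> complex" where
  "sphere_laplacian f x =
     (\<Sum>b\<in>Basis. frechet_derivative (\<lambda>y. frechet_derivative (radial_ext f) (at y) b) (at x) b)"

text \<open>Smooth functions on the weighted projective space are invariant smooth functions on the sphere;
  they are made total by the value 0 off the sphere, so that distinct elements of an eigenspace are
  distinct functions on the sphere.\<close>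

definition smooth_invariant :: "('n::finite \<Rightarrow> nat) \<Rightarrow> (complex ^ 'n \<Rightarrow> complex) set" where
  "smooth_invariant N = {f. (\<forall>z. z \<notin> sphere 0 1 \<longrightarrow> f z = 0) \<and> sphere_smooth f \<and>
     (\<forall>u \<in> sphere 0 1. \<forall>z \<in> sphere 0 1. f (circle_act N u z) = f z)}"

definition laplace_eigenspace ::
    "('n::finite \<Rightarrow> nat) \<Rightarrow> complex \<Rightarrow> (complex ^ 'n \<Rightarrow> complex) set" where
  "laplace_eigenspace N \<mu> =
     {f \<in> smooth_invariant N. \<forall>z \<in> sphere 0 1. - sphere_laplacian f z = \<mu> * f z}"

lemma vector_space_complex_fun: "vector_space (\<lambda>(c::complex) (f :: 'a \<Rightarrow> complex) z. c * f z)"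
  by unfold_locales (auto simp: fun_eq_iff algebra_simps)

text \<open>The spectrum, as the function giving the multiplicity of each complex number as an eigenvalue
  of the Laplace operator (0 if it is not one). The complex dimension used here would also be 0 for
  an infinite-dimensional space, which does not occur because the space is compact.\<close>

definition laplace_spectrum :: "('n::finite \<Rightarrow> nat) \<Rightarrow> complex \<Rightarrow> nat" where
  "laplace_spectrum N \<mu> =
     vector_space.dim (\<lambda>(c::complex) (f :: complex ^ 'n \<Rightarrow> complex) z. c * f z) (laplace_eigenspace N \<mu>)"


section \<open>Well-definedness of \<open>gamma\<close>\<close>

lemma circle_act_mult: "circle_act N u (circle_act N v z) = circle_act N (u * v) z"
  by (simp add: circle_act_def vec_eq_iff power_mult_distrib mult.assoc)

lemma circle_act_1: "circle_act N 1 z = z"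
  by (simp add: circle_act_def)

lemma norm_circle_act:
  assumes "cmod u = 1"
  shows "norm (circle_act N u z) = norm z"
  using assms by (simp add: circle_act_def norm_vec_def norm_mult norm_power)

lemma orbit_circle_act:
  assumes u: "cmod u = 1"
  shows "orbit N (circle_act N u z) = orbit N z"
proof -
  have "v \<in> (\<lambda>w. w * u) ` sphere 0 1" if "cmod v = 1" for v
    using u that by (intro image_eqI[of _ _ "v / u"]) (auto simp: norm_divide)
  then have "(\<lambda>w. w * u) ` sphere 0 1 = sphere 0 1"
    using u by (auto simp: norm_mult)
  then show ?thesis
    unfolding orbit_def circle_act_mult
    using image_image[of "\<lambda>w. circle_act N w z" "\<lambda>w. w * u" "sphere 0 1"] by simp
qed

lemma circle_image_circle_act:
  assumes u: "cmod u = 1"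
  shows "circle_image N (circle_act N u ` V) = circle_image N V"
proof -
  have "circle_act N u ` V \<inter> sphere 0 1 = circle_act N u ` (V \<inter> sphere 0 1)"
    by (auto simp: norm_circle_act[OF u])
  then show ?thesis
    by (simp add: circle_image_def image_image orbit_circle_act[OF u])
qed

lemma circle_act_gamma_plane:
  assumes u: "cmod u = 1"
  shows "circle_act N u ` gamma_plane i j c = gamma_plane i j (u ^ (N i + N j) * c)"
proof -
  have sub: "circle_act N v ` gamma_plane i j b \<subseteq> gamma_plane i j (v ^ (N i + N j) * b)"
    if v: "cmod v = 1" for v b
  proof -
    have "v * cnj v = 1"
      using v by (simp add: complex_norm_square [symmetric])
    then have v1: "v ^ N i * cnj v ^ N i = 1"
      by (simp flip: power_mult_distrib)
    have "circle_act N v z \<in> gamma_plane i j (v ^ (N i + N j) * b)" if z: "z \<in> gamma_plane i j b" for z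
    proof -
      have "v ^ (N i + N j) * b * cnj (v ^ N i * z $ i) =
          (v ^ N i * cnj v ^ N i) * (v ^ N j * (b * cnj (z $ i)))"
        by (simp add: power_add mult_ac)
      then show ?thesis
        using z v1 by (auto simp: gamma_plane_def circle_act_def)
    qed
    then show ?thesis
      by blast
  qed
  let ?w = "inverse u"
  have u0: "u \<noteq> 0"
    using u by auto
  have "gamma_plane i j (u ^ (N i + N j) * c) =
      circle_act N u ` circle_act N ?w ` gamma_plane i j (u ^ (N i + N j) * c)"
    using u0 by (simp add: image_image circle_act_mult circle_act_1)
  also have "\<dots> \<subseteq> circle_act N u ` gamma_plane i j (?w ^ (N i + N j) * (u ^ (N i + N j) * c))"
    using u by (intro image_mono sub) (simp add: norm_inverse)
  also have "?w ^ (N i + N j) * (u ^ (N i + N j) * c) = c"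
    using u0 by (simp add: power_inverse)
  finally show ?thesis
    using sub[OF u, of c] by auto
qed

lemma circle_image_gamma_plane:
  assumes "weights N" and c: "(cmod c)\<^sup>2 = real (N i) / real (N j)"
  shows "circle_image N (gamma_plane i j c) = gamma N i j"
proof -
  define r where "r = sqrt (real (N i) / real (N j))"
  have pos: "N i > 0" "N j > 0"
    using assms(1) by (simp_all add: weights_def order.strict_trans[OF zero_less_one])
  have r: "cmod c = r"
    using real_sqrt_unique[OF c] by (simp add: r_def)
  define u where "u = cis (Arg c / real (N i + N j))"
  have "u ^ (N i + N j) = cis (Arg c)"
    using pos by (simp add: u_def Complex.DeMoivre del: of_nat_add)
  then have "u ^ (N i + N j) * r = c"
    using r rcis_cmod_Arg[of c] by (simp add: rcis_def mult.commute)
  then have "circle_image N (gamma_plane i j c) = circle_image N (circle_act N u ` gamma_plane i j r)"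
    using circle_act_gamma_plane[of u N i j r] by (simp add: u_def)
  then show ?thesis
    by (simp add: circle_image_circle_act u_def gamma_def r_def)
qed

end

theory Submission
  imports Defs "HOL-Computational_Algebra.Polynomial_FPS"
begin

text \<open>
  \<^emph>\<open>Geodesics.\<close> Write a horizontal plane as the set of all \<open>\<zeta> p + cnj \<zeta> q\<close>. If an element \<open>u\<close> of its
  stabilizer satisfies \<open>u\<^sup>2 \<noteq> 1\<close>, then \<open>u\<close> acts on the plane as a rotation by a non-real number, so for
  every \<open>k\<close> one of \<open>p k\<close>, \<open>q k\<close> vanishes. Either exactly one \<open>p i\<close> and one \<open>q j\<close> are nonzero, the plane
  is a \<open>gamma_plane\<close> and the stabilizer has order \<open>N i + N j\<close>; or the stabilizer consists of roots of
  unity of order \<open>N k - N l\<close> for some \<open>k, l\<close>, and the bound on the largest weight gives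
  \<open>N k - N l < N i + N j\<close> for all \<open>i \<noteq> j\<close>.

  \<^emph>\<open>Spectrum.\<close> Let \<open>c k\<close> be the number of invariant monomials of degree \<open>k\<close> in the \<open>z i\<close> and \<open>cnj (z i)\<close>.
  On polynomials restricted to the sphere the Laplacian is triangular with respect to the degree, and
  an eigenfunction orthogonal to all polynomials vanishes, so the multiplicity of \<open>k (k + 2 d - 2)\<close> is
  \<open>c k - c (k - 2)\<close>. The least positive eigenvalue \<open>4 d\<close> gives \<open>d\<close>, hence all \<open>c k\<close> are spectral
  invariants. By partial fractions in the torus variable, the rational function \<open>\<Sum>k. c k t ^ k\<close> is
  regular at the primitive \<open>m\<close>th roots of unity if \<open>m > 2\<close> divides no \<open>N i + N j\<close>, and it has a pole
  there if \<open>m = N i + N j\<close> divides no other pair sum. The pair sums of \<open>N\<close> are distinct and each is more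
  than half of every other one. So if \<open>M\<close> has the same spectrum, then the largest pair sum of \<open>M\<close>
  is at most that of \<open>N\<close>, and every pair sum of \<open>N\<close> is one of \<open>M\<close>; counting shows that the pair sums
  agree, and they determine the weights when \<open>d\<close> is not a power of two.
\<close>

section \<open>Generating functions of weighted exponents\<close>

text \<open>The pole comparison is asymmetric because nothing is assumed about the pair sums of
  \<open>M\<close>: they might repeat or divide one another, so only the largest one is sure to give
  a pole, whereas every pair sum of \<open>N\<close> does. The pole itself needs care: m = N i + N j
  makes two pairs resonant at once, z_i with the conjugate of z_j and z_j with the conjugate of z_i.
  Eliminating z_j against its own conjugate costs only the harmless factor 1 - X^2 and separates the
  two; conjugation makes their residues equal, so they cannot cancel. Rational functions are treated
  formally, as power series with a polynomial denominator. In the same spirit no surface measure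
  appears: integrals over the sphere are Lebesgue integrals of radially constant functions against a
  compactly supported radial weight, and the symmetry of the Laplacian comes from translation
  invariance of Lebesgue measure. The decomposition into harmonics is carried out for a family
  \<open>P\<close> of monomials: all monomials give completeness, the invariant ones give the
  multiplicities.\<close>

definition expts :: "('i::finite \<Rightarrow> int) \<Rightarrow> 'i set \<Rightarrow> int \<Rightarrow> nat \<Rightarrow> ('i \<Rightarrow> nat) set" where
  "expts w S e n = {u. (\<forall>k. k \<notin> S \<longrightarrow> u k = 0) \<and> (\<Sum>k\<in>UNIV. u k) = n \<and>
     e + (\<Sum>k\<in>UNIV. w k * int (u k)) = 0}"

text \<open>The offset \<open>e\<close> turns the elimination of one variable into a recursion:
  using one more factor of the variable i replaces \<open>e\<close> by \<open>e + w i\<close>.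
  Exponents are total functions that vanish off \<open>S\<close>, so that all supports share one
  type.\<close>

definition expts_gf :: "('i::finite \<Rightarrow> int) \<Rightarrow> 'i set \<Rightarrow> int \<Rightarrow> complex fps" where
  "expts_gf w S e = Abs_fps (\<lambda>n. of_nat (card (expts w S e n)))"

lemma finite_expts: "finite (expts w S e n)"
proof (rule finite_subset)
  show "expts w S e n \<subseteq> (UNIV \<rightarrow>\<^sub>E {..n})"
    by (auto simp: expts_def PiE_def intro: member_le_sum)
  show "finite ((UNIV :: 'a set) \<rightarrow>\<^sub>E {..n})"
    by (intro finite_PiE) auto
qed

lemma sum_fun_upd_Suc:
  fixes u :: "'i::finite \<Rightarrow> nat"
  shows "(\<Sum>k\<in>UNIV. (u(i := Suc (u i))) k) = Suc (\<Sum>k\<in>UNIV. u k)"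
    and "(\<Sum>k\<in>UNIV. w k * int ((u(i := Suc (u i))) k)) = w i + (\<Sum>k\<in>UNIV. w k * int (u k))"
proof -
  have f: "u k + (if k = i then 1 else 0) = (u(i := Suc (u i))) k" for k by simp
  have g: "w k * int (u k) + (if k = i then w k else 0) = w k * int ((u(i := Suc (u i))) k)" for k
    by (simp add: algebra_simps)
  show "(\<Sum>k\<in>UNIV. (u(i := Suc (u i))) k) = Suc (\<Sum>k\<in>UNIV. u k)"
    unfolding f[symmetric] sum.distrib by simp
  show "(\<Sum>k\<in>UNIV. w k * int ((u(i := Suc (u i))) k)) = w i + (\<Sum>k\<in>UNIV. w k * int (u k))"
    unfolding g[symmetric] sum.distrib by simp
qed

lemma expts_insert_0: "i \<notin> S \<Longrightarrow> expts w (insert i S) e 0 = expts w S e 0"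
  by (auto simp: expts_def)

text \<open>Either the new variable does not occur, or one factor of it can be removed, which lowers
  the degree and shifts the offset.\<close>

lemma expts_insert_Suc:
  assumes "i \<notin> S"
  shows "expts w (insert i S) e (Suc n) =
    expts w S e (Suc n) \<union> (\<lambda>u. u(i := Suc (u i))) ` expts w (insert i S) (e + w i) n"
    (is "?L = ?A \<union> ?f ` ?B")
proof
  have "?f u \<in> ?L" if u: "u \<in> ?B" for u
    using u unfolding expts_def mem_Collect_eq sum_fun_upd_Suc by auto
  moreover have "?A \<subseteq> ?L" by (auto simp: expts_def)
  ultimately show "?A \<union> ?f ` ?B \<subseteq> ?L" by blast
  show "?L \<subseteq> ?A \<union> ?f ` ?B"
  proof
    fix u assume u: "u \<in> ?L"
    show "u \<in> ?A \<union> ?f ` ?B"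
    proof (cases "u i")
      case 0
      then have "u \<in> ?A" using u by (auto simp: expts_def) (metis insert_iff)
      then show ?thesis ..
    next
      case (Suc v)
      define u' where "u' = u(i := v)"
      have uu: "u = ?f u'" using Suc by (auto simp: u'_def)
      have "u' \<in> ?B"
        using u sum_fun_upd_Suc(1)[of u' i] sum_fun_upd_Suc(2)[of w u' i]
        unfolding uu[symmetric] by (auto simp: expts_def u'_def algebra_simps)
      then show ?thesis using uu by blast
    qed
  qed
qed

lemma card_expts_insert_Suc:
  assumes "i \<notin> S"
  shows "card (expts w (insert i S) e (Suc n)) =
    card (expts w S e (Suc n)) + card (expts w (insert i S) (e + w i) n)"
proof -
  let ?f = "\<lambda>u::'a \<Rightarrow> nat. u(i := Suc (u i))"
  have "inj ?f"
  proof (rule injI)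
    fix x y assume h: "?f x = ?f y"
    show "x = y"
    proof
      fix k show "x k = y k" using fun_cong[OF h, of k] by (cases "k = i") auto
    qed
  qed
  moreover have "expts w S e (Suc n) \<inter> ?f ` expts w (insert i S) (e + w i) n = {}"
    using assms by (auto simp: expts_def)
  ultimately show ?thesis
    unfolding expts_insert_Suc[OF assms]
    by (subst card_Un_disjoint) (auto simp: finite_expts card_image inj_on_subset)
qed

lemma expts_gf_insert:
  assumes "i \<notin> S"
  shows "expts_gf w (insert i S) e = expts_gf w S e + fps_X * expts_gf w (insert i S) (e + w i)"
proof (rule fps_ext)
  fix n
  show "fps_nth (expts_gf w (insert i S) e) n = fps_nth (expts_gf w S e + fps_X * expts_gf w (insert i S) (e + w i)) n"
    by (cases n) (simp_all add: expts_gf_def expts_insert_0[OF assms] card_expts_insert_Suc[OF assms])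
qed

lemma expts_gf_insert_iterate:
  assumes "i \<notin> S"
  shows "expts_gf w (insert i S) e = (\<Sum>s<p. fps_X ^ s * expts_gf w S (e + int s * w i)) +
    fps_X ^ p * expts_gf w (insert i S) (e + int p * w i)"
proof (induction p)
  case (Suc p)
  have "expts_gf w (insert i S) (e + int p * w i) =
      expts_gf w S (e + int p * w i) + fps_X * expts_gf w (insert i S) (e + int (Suc p) * w i)"
    using expts_gf_insert[OF assms, of w "e + int p * w i"] by (simp add: algebra_simps)
  then show ?case using Suc by (simp add: algebra_simps)
qed simp

text \<open>MacMahon's elimination step: one of the two indices disappears at the cost of a denominator.\<close>

lemma expts_gf_elliott:
  assumes "i \<notin> S" "j \<notin> S" "i \<noteq> j" and pq: "int p * w i + int q * w j = 0"
  shows "(1 - fps_X ^ (p + q)) * expts_gf w (insert i (insert j S)) e =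
     (\<Sum>s<p. fps_X ^ s * expts_gf w (insert j S) (e + int s * w i)) +
     fps_X ^ p * (\<Sum>s<q. fps_X ^ s * expts_gf w (insert i S) (e + int p * w i + int s * w j))"
proof -
  let ?T = "insert i (insert j S)"
  have 1: "expts_gf w ?T e = (\<Sum>s<p. fps_X ^ s * expts_gf w (insert j S) (e + int s * w i)) +
    fps_X ^ p * expts_gf w ?T (e + int p * w i)"
    using assms by (intro expts_gf_insert_iterate) auto
  have "expts_gf w (insert j (insert i S)) (e + int p * w i) =
    (\<Sum>s<q. fps_X ^ s * expts_gf w (insert i S) (e + int p * w i + int s * w j)) +
    fps_X ^ q * expts_gf w (insert j (insert i S)) (e + int p * w i + int q * w j)"
    using assms by (intro expts_gf_insert_iterate) auto
  moreover have "e + int p * w i + int q * w j = e" using pq by simp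
  ultimately have 2: "expts_gf w ?T (e + int p * w i) =
    (\<Sum>s<q. fps_X ^ s * expts_gf w (insert i S) (e + int p * w i + int s * w j)) + fps_X ^ q * expts_gf w ?T e"
    by (simp add: insert_commute)
  show ?thesis using 1 unfolding 2 by (simp add: algebra_simps power_add)
qed

text \<open>Says formally that \<open>F\<close> is the expansion of a rational function without a
  pole at \<open>x\<close>, with value \<open>v\<close> there. The value is carried along because a
  residue will be read off as the value of a polynomial multiple of the series.\<close>

definition regular_value :: "complex \<Rightarrow> complex fps \<Rightarrow> complex \<Rightarrow> bool" where
  "regular_value x F v \<longleftrightarrow>
     (\<exists>P Q. poly Q x \<noteq> 0 \<and> fps_of_poly Q * F = fps_of_poly P \<and> v * poly Q x = poly P x)"

lemma regular_value_unique:
  assumes "regular_value x F v" "regular_value x F v'"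
  shows "v = v'"
proof -
  obtain P Q P' Q' where h: "poly Q x \<noteq> 0" "fps_of_poly Q * F = fps_of_poly P" "v * poly Q x = poly P x"
    "poly Q' x \<noteq> 0" "fps_of_poly Q' * F = fps_of_poly P'" "v' * poly Q' x = poly P' x"
    using assms by (auto simp: regular_value_def)
  have "fps_of_poly (P * Q') = fps_of_poly (P' * Q)"
    unfolding fps_of_poly_mult h(2,5)[symmetric] by (simp add: algebra_simps)
  then have "poly (P * Q') x = poly (P' * Q) x" by (simp only: fps_of_poly_eq_iff)
  then have "(v * poly Q x) * poly Q' x = (v' * poly Q' x) * poly Q x" by (simp only: h(3,6) poly_mult)
  then have "(v - v') * (poly Q x * poly Q' x) = 0" by (simp only: algebra_simps) simp
  then show ?thesis using h by simp
qed

lemma regular_value_poly: "regular_value x (fps_of_poly p) (poly p x)"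
  unfolding regular_value_def by (intro exI[of _ p] exI[of _ 1]) simp

lemma regular_value_X: "regular_value x fps_X x"
  using regular_value_poly[of x "[:0, 1:]"] by (simp add: fps_of_poly_pCons)

lemma regular_value_0: "regular_value x 0 0"
  using regular_value_poly[of x 0] by simp

lemma regular_value_1: "regular_value x 1 1"
  using regular_value_poly[of x 1] by simp

lemma regular_value_add:
  assumes "regular_value x F v" "regular_value x F' v'"
  shows "regular_value x (F + F') (v + v')"
proof -
  obtain P Q P' Q' where h: "poly Q x \<noteq> 0" "fps_of_poly Q * F = fps_of_poly P" "v * poly Q x = poly P x"
    "poly Q' x \<noteq> 0" "fps_of_poly Q' * F' = fps_of_poly P'" "v' * poly Q' x = poly P' x"
    using assms by (auto simp: regular_value_def)
  have 1: "fps_of_poly (Q * Q') * (F + F') = fps_of_poly (Q' * P + Q * P')"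
    by (simp add: fps_of_poly_mult fps_of_poly_add h(2,5)[symmetric] algebra_simps)
  have 2: "(v + v') * poly (Q * Q') x = poly (Q' * P + Q * P') x"
    by (simp add: h(3,6)[symmetric] algebra_simps)
  show ?thesis unfolding regular_value_def
    by (intro exI[of _ "Q' * P + Q * P'"] exI[of _ "Q * Q'"] conjI 1 2) (use h in simp)
qed

lemma regular_value_mult:
  assumes "regular_value x F v" "regular_value x F' v'"
  shows "regular_value x (F * F') (v * v')"
proof -
  obtain P Q P' Q' where h: "poly Q x \<noteq> 0" "fps_of_poly Q * F = fps_of_poly P" "v * poly Q x = poly P x"
    "poly Q' x \<noteq> 0" "fps_of_poly Q' * F' = fps_of_poly P'" "v' * poly Q' x = poly P' x"
    using assms by (auto simp: regular_value_def)
  have 1: "fps_of_poly (Q * Q') * (F * F') = fps_of_poly (P * P')"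
    by (simp add: fps_of_poly_mult h(2,5)[symmetric] algebra_simps)
  have 2: "(v * v') * poly (Q * Q') x = poly (P * P') x"
    by (simp add: h(3,6)[symmetric] algebra_simps)
  show ?thesis unfolding regular_value_def
    by (intro exI[of _ "P * P'"] exI[of _ "Q * Q'"] conjI 1 2) (use h in simp)
qed

lemma regular_value_power: "regular_value x F v \<Longrightarrow> regular_value x (F ^ n) (v ^ n)"
  by (induction n) (auto intro: regular_value_1 regular_value_mult)

lemma regular_value_sum:
  assumes "\<And>s. s \<in> A \<Longrightarrow> regular_value x (F s) (v s)"
  shows "regular_value x (\<Sum>s\<in>A. F s) (\<Sum>s\<in>A. v s)"
  using assms by (induction A rule: infinite_finite_induct)
    (auto intro: regular_value_0 regular_value_add)

lemma regular_value_one_minus_X_power: "regular_value x (1 - fps_X ^ m) (1 - x ^ m)"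
  using regular_value_poly[of x "1 - monom 1 m"]
  by (simp add: fps_of_poly_diff fps_of_poly_monom' poly_monom)

text \<open>The factor does not vanish at \<open>x\<close>, so it can be absorbed into the
  denominator \<open>Q\<close>. This is how the denominators produced by elimination are paid
  for.\<close>

lemma regular_value_divide:
  assumes "regular_value x ((1 - fps_X ^ m) * F) v" "x ^ m \<noteq> 1"
  shows "regular_value x F (v / (1 - x ^ m))"
proof -
  obtain P Q where h: "poly Q x \<noteq> 0" "fps_of_poly Q * ((1 - fps_X ^ m) * F) = fps_of_poly P"
    "v * poly Q x = poly P x"
    using assms by (auto simp: regular_value_def)
  have "fps_of_poly (Q * (1 - monom 1 m)) * F = fps_of_poly P"
    by (simp add: fps_of_poly_mult fps_of_poly_diff fps_of_poly_monom' h(2)[symmetric] mult.assoc)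
  moreover have "poly (Q * (1 - monom 1 m)) x = poly Q x * (1 - x ^ m)" by (simp add: poly_monom)
  ultimately show ?thesis unfolding regular_value_def
    using h assms(2) by (intro exI[of _ P] exI[of _ "Q * (1 - monom 1 m)"]) auto
qed

text \<open>All weights have the same sign \<open>s\<close> and modulus at least 1, so a total
  weight of modulus \<open>abs e\<close> leaves room for at most that many factors. The
  corresponding series is therefore a polynomial.\<close>

lemma expts_one_sign_empty:
  assumes "\<And>i. i \<in> S \<Longrightarrow> s * w i > 0" "abs s = 1" "n > nat (abs e)"
  shows "expts w S e n = {}"
proof (rule ccontr)
  assume "expts w S e n \<noteq> {}"
  then obtain u where u: "u \<in> expts w S e n" by blast
  have "int (u k) \<le> s * (w k * int (u k))" for k
  proof (cases "k \<in> S")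
    case True
    then have "1 \<le> s * w k" using assms(1) by force
    then have "1 * int (u k) \<le> (s * w k) * int (u k)" by (intro mult_right_mono) auto
    then show ?thesis by (simp add: mult.assoc)
  qed (use u in \<open>auto simp: expts_def\<close>)
  then have "(\<Sum>k\<in>UNIV. int (u k)) \<le> (\<Sum>k\<in>UNIV. s * (w k * int (u k)))" by (intro sum_mono) auto
  also have "\<dots> = s * (- e)"
  proof -
    have "(\<Sum>k\<in>UNIV. w k * int (u k)) = - e" using u by (simp add: expts_def)
    then show ?thesis by (simp flip: sum_distrib_left)
  qed
  also have "\<dots> \<le> abs e" using assms(2) by (auto simp: abs_if split: if_splits)
  finally show False using u assms(3) by (auto simp: expts_def simp flip: of_nat_sum)
qed

lemma fps_eventually_0_poly:
  fixes F :: "complex fps"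
  assumes "\<And>n. n > b \<Longrightarrow> fps_nth F n = 0"
  shows "\<exists>p. F = fps_of_poly p"
proof
  show "F = fps_of_poly (Abs_poly (fps_nth F))"
    using assms by (intro fps_ext) (simp add: coeff_Abs_poly[of b])
qed

text \<open>Each elimination of a pair of opposite signs removes a variable and divides by 1 - X^(p
  + q), which the second hypothesis keeps nonzero at \<open>x\<close>. When only one sign is left,
  the series is a polynomial.\<close>

lemma expts_gf_regular:
  assumes "\<And>i. i \<in> S \<Longrightarrow> w i \<noteq> 0"
    and "\<And>i j. i \<in> S \<Longrightarrow> j \<in> S \<Longrightarrow> w i > 0 \<Longrightarrow> w j < 0 \<Longrightarrow>
      \<exists>p q. int p * w i + int q * w j = 0 \<and> x ^ (p + q) \<noteq> 1"
  shows "\<exists>v. regular_value x (expts_gf w S e) v"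
  using assms
proof (induction "card S" arbitrary: S e rule: less_induct)
  case less
  show ?case
  proof (cases "\<exists>i j. i \<in> S \<and> j \<in> S \<and> w i > 0 \<and> w j < 0")
    case True
    then obtain i j where ij: "i \<in> S" "j \<in> S" "w i > 0" "w j < 0" by blast
    then obtain p q where pq: "int p * w i + int q * w j = 0" "x ^ (p + q) \<noteq> 1"
      using less.prems(2) by blast
    define R where "R = S - {i, j}"
    have neq: "i \<noteq> j" using ij by auto
    have S: "S = insert i (insert j R)" using ij by (auto simp: R_def)
    have R: "i \<notin> R" "j \<notin> R" by (auto simp: R_def)
    have less': "card (insert j R) < card S" "card (insert i R) < card S"
      using neq R by (auto simp: S)
    have sub: "insert j R \<subseteq> S" "insert i R \<subseteq> S" using S by blast+
    have "\<exists>v. regular_value x (expts_gf w (insert j R) e) v" for e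
      by (rule less.hyps[OF less'(1)]; intro less.prems subsetD[OF sub(1)])
    then obtain v1 where v1: "\<And>e. regular_value x (expts_gf w (insert j R) e) (v1 e)" by metis
    have "\<exists>v. regular_value x (expts_gf w (insert i R) e) v" for e
      by (rule less.hyps[OF less'(2)]; intro less.prems subsetD[OF sub(2)])
    then obtain v2 where v2: "\<And>e. regular_value x (expts_gf w (insert i R) e) (v2 e)" by metis
    have "\<exists>v. regular_value x ((1 - fps_X ^ (p + q)) * expts_gf w S e) v"
      unfolding S expts_gf_elliott[OF R neq pq(1)]
      by (rule exI, (rule regular_value_add regular_value_mult regular_value_power
          regular_value_sum regular_value_X v1 v2)+)
    then show ?thesis using regular_value_divide pq(2) by blast
  next
    case False
    then have "(\<forall>i\<in>S. 1 * w i > 0) \<or> (\<forall>i\<in>S. (-1) * w i > 0)"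
      using less.prems(1) by (force simp: neq_iff)
    then obtain s :: int where "\<forall>i\<in>S. s * w i > 0" "abs s = 1" by (metis abs_1 abs_minus)
    then have "expts w S e n = {}" if "n > nat (abs e)" for n
      using that by (intro expts_one_sign_empty) auto
    then have "\<exists>p. expts_gf w S e = fps_of_poly p"
      by (intro fps_eventually_0_poly[of "nat (abs e)"]) (simp add: expts_gf_def)
    then show ?thesis using regular_value_poly by metis
  qed
qed

section \<open>Resonant pairs and poles\<close>

text \<open>\<open>z\<close> will be the ratio of the residues per unit of offset. As b is
  invertible modulo a + b, a power of \<open>x\<close> solves z^b = x, and x^(a + b) = 1 then yields
  the other equation.\<close>

lemma root_of_unity_solution:
  fixes x :: complex
  assumes "coprime a b" "a > 0" "b > 0" "x ^ (a + b) = 1"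
  obtains z where "x * z ^ a = 1" "z ^ b = x"
proof -
  have "gcd b (a + b) = gcd a b" unfolding add.commute[of a b] by (simp add: gcd.commute[of a])
  then have "gcd b (a + b) = 1" using assms(1) by simp
  then obtain c d where "b * c = (a + b) * d + 1" using bezout_nat[of b "a + b"] assms(3) by auto
  then have cd: "c * b = d * (a + b) + 1" by (simp add: mult.commute)
  have "(x ^ c) ^ b = (x ^ (a + b)) ^ d * x"
    unfolding power_mult[symmetric] cd mult.commute[of "a + b"] by simp
  then have 1: "(x ^ c) ^ b = x" using assms(4) by simp
  have "(x * (x ^ c) ^ a) * x = x * ((x ^ c) ^ a * (x ^ c) ^ b)" using 1 by simp
  also have "\<dots> = x * (x ^ (a + b)) ^ c"
    by (simp flip: power_mult power_add add: algebra_simps)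
  also have "\<dots> = 1 * x" using assms(4) by simp
  finally have "x * (x ^ c) ^ a * x = 1 * x" .
  moreover have "x \<noteq> 0" using assms by (auto simp: power_0_left)
  ultimately have "x * (x ^ c) ^ a = 1" by (metis mult_right_cancel)
  then show thesis using 1 that by blast
qed

text \<open>Integer combinations of the coprime steps \<open>a\<close> and \<open>b\<close> reach
  every offset, so two geometric recurrences with a common ratio determine \<open>V\<close> from its
  value at 0.\<close>

lemma power_int_quasiperiodic:
  fixes V :: "int \<Rightarrow> complex"
  assumes z: "z \<noteq> 0" and "coprime a b"
    and Va: "\<And>e. V (e + int a) = z ^ a * V e" and Vb: "\<And>e. V (e + int b) = z ^ b * V e"
  shows "V e = z powi e * V 0"
proof -
  have nat_mult: "V (e + int (k * c)) = z ^ (k * c) * V e"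
    if "\<And>e. V (e + int c) = z ^ c * V e" for k c e
  proof (induction k arbitrary: e)
    case (Suc k)
    have "V (e + int (Suc k * c)) = V ((e + int c) + int (k * c))" by (simp add: algebra_simps)
    also have "\<dots> = z ^ (k * c) * (z ^ c * V e)" using Suc that by simp
    finally show ?case by (simp add: power_add algebra_simps)
  qed simp
  have int_mult: "V (e + y * int c) = z powi (y * int c) * V e"
    if c: "\<And>e. V (e + int c) = z ^ c * V e" for y c e
  proof (cases "y \<ge> 0")
    case True
    then show ?thesis using nat_mult[OF c, of e "nat y"] by (simp add: power_int_def nat_mult_distrib)
  next
    case False
    define k where "k = nat (- y)"
    have y: "y = - int k" using False by (simp add: k_def)
    have "V e = z ^ (k * c) * V (e + y * int c)"
      using nat_mult[OF c, of "e + y * int c" k] by (simp add: y)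
    moreover have "z powi (y * int c) * z ^ (k * c) = 1"
      using z by (simp add: y power_int_minus flip: of_nat_mult)
    ultimately have "z powi (y * int c) * V e = 1 * V (e + y * int c)" by (simp only: mult.assoc[symmetric])
    then show ?thesis by simp
  qed
  obtain r s where "r * int a + s * int b = 1"
    using bezout_int[of "int a" "int b"] assms(2) by (auto simp: coprime_iff_gcd_eq_1)
  then have "e * (r * int a + s * int b) = e" by simp
  then have e: "e = e * r * int a + e * s * int b" by (simp add: algebra_simps)
  have "V e = V (e * r * int a + e * s * int b)" using e by simp
  also have "\<dots> = z powi (e * s * int b) * (z powi (e * r * int a) * V 0)"
    using int_mult[OF Vb, of "e * r * int a" "e * s"] int_mult[OF Va, of 0 "e * r"] by simp
  also have "\<dots> = z powi (e * r * int a + e * s * int b) * V 0"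
    using z by (simp add: power_int_add)
  finally show ?thesis using e by simp
qed

lemma expts_gf_singleton_0:
  assumes "w j \<noteq> 0"
  shows "expts_gf w {j} 0 = 1"
proof (rule fps_ext)
  fix n
  have s: "(\<Sum>k\<in>UNIV. u k) = u j" "(\<Sum>k\<in>UNIV. w k * int (u k)) = w j * int (u j)"
    if "\<forall>k. k \<notin> {j} \<longrightarrow> u k = 0" for u :: "'a \<Rightarrow> nat"
    using that by (simp_all add: sum.mono_neutral_right[of UNIV "{j}"])
  have "expts w {j} 0 n = (if n = 0 then {\<lambda>_. 0} else {})"
  proof (cases "n = 0")
    case True then show ?thesis by (auto simp: expts_def)
  next
    case False
    have False if "u \<in> expts w {j} 0 n" for u
    proof -
      have u: "\<forall>k. k \<notin> {j} \<longrightarrow> u k = 0" using that by (simp add: expts_def)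
      show False using that s[OF u] False assms by (auto simp: expts_def)
    qed
    then show ?thesis using False by auto
  qed
  then show "fps_nth (expts_gf w {j} 0) n = fps_nth 1 n" by (simp add: expts_gf_def)
qed

lemma expts_gf_singleton_empty:
  assumes "\<And>n. e + w j * int n \<noteq> 0"
  shows "expts_gf w {j} e = 0"
proof (rule fps_ext)
  fix n
  have False if "u \<in> expts w {j} e n" for u
  proof -
    have u: "\<forall>k. k \<notin> {j} \<longrightarrow> u k = 0" using that by (simp add: expts_def)
    have "(\<Sum>k\<in>UNIV. w k * int (u k)) = w j * int (u j)"
      using u by (simp add: sum.mono_neutral_right[of UNIV "{j}"])
    then show False using that assms[of "u j"] by (simp add: expts_def)
  qed
  then have "expts w {j} e n = {}" by blast
  then show "fps_nth (expts_gf w {j} e) n = fps_nth 0 n" by (simp add: expts_gf_def)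
qed

text \<open>The solutions of a u_i = b u_j are the multiples of (b, a), one in each degree divisible
  by a + b. This is the base case for the nonvanishing of residues.\<close>

lemma expts_gf_pair:
  assumes "i \<noteq> j" "w i = int a" "w j = - int b" "coprime a b" "a > 0" "b > 0"
  shows "(1 - fps_X ^ (a + b)) * expts_gf w {i, j} 0 = 1"
proof -
  have pq: "int b * w i + int a * w j = 0" using assms by simp
  have e: "(1 - fps_X ^ (b + a)) * expts_gf w {i, j} 0 =
     (\<Sum>s<b. fps_X ^ s * expts_gf w {j} (0 + int s * w i)) +
     fps_X ^ b * (\<Sum>s<a. fps_X ^ s * expts_gf w {i} (0 + int b * w i + int s * w j))"
    using expts_gf_elliott[OF _ _ assms(1) pq, of "{}" 0] by simp
  have 1: "expts_gf w {j} (0 + int s * w i) = (if s = 0 then 1 else 0)" if "s < b" for s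
  proof (cases "s = 0")
    case True then show ?thesis using expts_gf_singleton_0[of w j] assms by simp
  next
    case False
    have "expts_gf w {j} (0 + int s * w i) = 0"
    proof (rule expts_gf_singleton_empty, rule notI)
      fix n assume "0 + int s * w i + w j * int n = 0"
      then have "int (s * a) = int (b * n)" using assms by simp
      then have "b dvd s * a" by (metis dvd_triv_left of_nat_eq_iff)
      then have "b dvd s" using assms(4) by (metis coprime_commute coprime_dvd_mult_left_iff)
      then show False using that False by (auto dest: dvd_imp_le)
    qed
    then show ?thesis using False by simp
  qed
  have 2: "expts_gf w {i} (0 + int b * w i + int s * w j) = 0" if "s < a" for s
  proof (rule expts_gf_singleton_empty)
    fix n
    have "int s * int b < int b * int a" using that assms(6) by (simp add: mult.commute)
    moreover have "0 \<le> int a * int n" by simp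
    moreover have "0 + int b * w i + int s * w j + w i * int n = int b * int a - int s * int b + int a * int n"
      unfolding assms(2,3) by simp
    ultimately show "0 + int b * w i + int s * w j + w i * int n \<noteq> 0" by linarith
  qed
  have "(\<Sum>s<b. fps_X ^ s * expts_gf w {j} (0 + int s * w i)) =
      (\<Sum>s<b. if s = 0 then 1 else (0 :: complex fps))"
    by (intro sum.cong refl) (auto simp: 1 simp del: add_0)
  also have "\<dots> = 1" using assms(6) by simp
  finally have s1: "(\<Sum>s<b. fps_X ^ s * expts_gf w {j} (0 + int s * w i)) = 1" .
  have s2: "(\<Sum>s<a. fps_X ^ s * expts_gf w {i} (0 + int b * w i + int s * w j)) = 0"
    using 2 by (intro sum.neutral) auto
  show ?thesis using e unfolding s1 s2 by (simp add: add.commute)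
qed

text \<open>\<open>D\<close> stands for a factor that clears a simple pole; the three values are
  then residues up to a common constant, and they inherit the recurrence of the series.\<close>

lemma regular_value_insert:
  assumes "i \<notin> S"
    and "regular_value x (D * expts_gf w (insert i S) e) v" "regular_value x (D * expts_gf w S e) v0"
    and "regular_value x (D * expts_gf w (insert i S) (e + w i)) v1"
  shows "v = v0 + x * v1"
proof -
  have "D * expts_gf w (insert i S) e = D * expts_gf w S e + fps_X * (D * expts_gf w (insert i S) (e + w i))"
    by (simp add: expts_gf_insert[OF assms(1), of w e] algebra_simps)
  then have "regular_value x (D * expts_gf w (insert i S) e) (v0 + x * v1)"
    using assms regular_value_add regular_value_mult regular_value_X by metis
  then show ?thesis using assms(2) regular_value_unique by blast
qed

text \<open>Away from the single resonant pair everything is regular, so the residues of the generating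
  functions inherit the recurrence of \<open>expts_gf_insert\<close> and are therefore geometric in \<open>e\<close>.\<close>

lemma expts_gf_simple_pole:
  assumes ij: "i \<in> S" "j \<in> S" "w i = int a" "w j = - int b" "coprime a b" "a > 0" "b > 0"
    and z: "x * z ^ a = 1" "z ^ b = x"
    and nz: "\<And>k. k \<in> S \<Longrightarrow> w k \<noteq> 0"
    and good: "\<And>k l. k \<in> S \<Longrightarrow> l \<in> S \<Longrightarrow> w k > 0 \<Longrightarrow> w l < 0 \<Longrightarrow> (k, l) \<noteq> (i, j) \<Longrightarrow>
      \<exists>p q. int p * w k + int q * w l = 0 \<and> x ^ (p + q) \<noteq> 1"
  shows "\<exists>C. C \<noteq> 0 \<and> (\<forall>e. regular_value x ((1 - fps_X ^ (a + b)) * expts_gf w S e) (z powi e * C))"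
proof -
  let ?D = "1 - fps_X ^ (a + b) :: complex fps"
  have zx: "z \<noteq> 0" using z(1) ij(6) by (auto simp: power_0_left)
  have "z ^ (a + b) = 1" using z by (simp add: power_add mult.commute)
  then have xm: "x ^ (a + b) = 1"
    unfolding z(2)[symmetric] power_mult[symmetric] mult.commute[of b] by (simp add: power_mult)
  have neq: "i \<noteq> j" using ij by auto
  have D0: "regular_value x ?D 0" using regular_value_one_minus_X_power[of x "a + b"] xm by simp
  \<comment> \<open>Without a complete resonant pair the series is regular at \<open>x\<close>, and
    the factor \<open>?D\<close> vanishes there.\<close>
  have reg: "regular_value x (?D * expts_gf w R e) 0" if R: "R \<subseteq> S" "\<not> (i \<in> R \<and> j \<in> R)" for R e
  proof -
    have "\<exists>v. regular_value x (expts_gf w R e) v"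
      using R by (intro expts_gf_regular nz good) auto
    then obtain v where "regular_value x (expts_gf w R e) v" by blast
    from regular_value_mult[OF D0 this] show ?thesis by simp
  qed
  \<comment> \<open>Eliminating the resonant pair first costs exactly the denominator
    \<open>?D\<close>; all later eliminations are harmless.\<close>
  have pole: "\<exists>V. \<forall>e. regular_value x (?D * expts_gf w R e) (z powi e * V)"
    if R: "R \<subseteq> S" "i \<in> R" "j \<in> R" for R
  proof -
    define Q where "Q = R - {i, j}"
    have Q: "R = insert i (insert j Q)" "i \<notin> Q" "j \<notin> Q" using R by (auto simp: Q_def)
    have pq: "int b * w i + int a * w j = 0" using ij by simp
    have sub: "insert i Q \<subseteq> S" "insert j Q \<subseteq> S" using R by (auto simp: Q_def)
    have "\<exists>v. regular_value x (expts_gf w (insert j Q) e) v" for e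
      using sub Q neq by (intro expts_gf_regular nz good) auto
    then obtain v1 where v1: "\<And>e. regular_value x (expts_gf w (insert j Q) e) (v1 e)" by metis
    have "\<exists>v. regular_value x (expts_gf w (insert i Q) e) v" for e
      using sub Q neq by (intro expts_gf_regular nz good) auto
    then obtain v2 where v2: "\<And>e. regular_value x (expts_gf w (insert i Q) e) (v2 e)" by metis
    have "\<exists>v. regular_value x (?D * expts_gf w R e) v" for e
      unfolding Q(1) add.commute[of a b] expts_gf_elliott[OF Q(2,3) neq pq]
      by (rule exI, (rule regular_value_add regular_value_mult regular_value_power
          regular_value_sum regular_value_X v1 v2)+)
    then obtain V where V: "\<And>e. regular_value x (?D * expts_gf w R e) (V e)" by metis
    have Ri: "R = insert i (R - {i})" "R = insert j (R - {j})" using R by auto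
    \<comment> \<open>Deleting \<open>i\<close> breaks the resonant pair, so the inhomogeneous term
      has value 0 and the recurrence becomes homogeneous. Deleting \<open>j\<close> below does the
      same.\<close>
    have Vi: "V e = x * V (e + w i)" for e
    proof -
      have "V e = 0 + x * V (e + w i)"
        by (rule regular_value_insert[of i "R - {i}" x ?D w e, folded Ri(1)])
          (use R in \<open>auto intro!: V reg\<close>)
      then show ?thesis by simp
    qed
    have Vj: "V e = x * V (e + w j)" for e
    proof -
      have "V e = 0 + x * V (e + w j)"
        by (rule regular_value_insert[of j "R - {j}" x ?D w e, folded Ri(2)])
          (use R in \<open>auto intro!: V reg\<close>)
      then show ?thesis by simp
    qed
    have Ve: "V e = z powi e * V 0" for e
    proof (rule power_int_quasiperiodic[OF zx ij(5)])
      fix e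
      have "z ^ a * V e = z ^ a * x * V (e + int a)" using Vi[of e] ij by simp
      then show "V (e + int a) = z ^ a * V e" using z(1) by (simp add: mult.commute)
      show "V (e + int b) = z ^ b * V e" using Vj[of "e + int b"] ij z(2) by simp
    qed
    have "regular_value x (?D * expts_gf w R e) (z powi e * V 0)" for e
      using V[of e] Ve[of e] by simp
    then show ?thesis by blast
  qed
  \<comment> \<open>The geometric form does not exclude residue 0. For this the remaining indices
    are added one at a time to the pair, where the residue is known explicitly.\<close>
  have ind: "\<exists>C. C \<noteq> 0 \<and> (\<forall>e. regular_value x (?D * expts_gf w (insert i (insert j T)) e) (z powi e * C))"
    if "T \<subseteq> S - {i, j}" for T
    using finite_subset[OF that finite] that
  proof (induction T rule: finite_induct)
    case empty
    obtain V where V: "\<And>e. regular_value x (?D * expts_gf w {i, j} e) (z powi e * V)"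
      using pole[of "{i, j}"] ij by auto
    have "?D * expts_gf w {i, j} 0 = 1" by (rule expts_gf_pair) (use neq ij in auto)
    then have "regular_value x 1 V" using V[of 0] by simp
    then have "V = 1" by (rule regular_value_unique[OF _ regular_value_1])
    then show ?case using V by (intro exI[of _ V]) auto
  next
    case (insert k T)
    let ?T = "insert i (insert j T)"
    have k: "k \<notin> ?T" using insert by auto
    have kT: "insert i (insert j (insert k T)) = insert k ?T" by auto
    obtain C where C: "C \<noteq> 0" "\<And>e. regular_value x (?D * expts_gf w ?T e) (z powi e * C)"
      using insert by auto
    have "\<exists>V. \<forall>e. regular_value x (?D * expts_gf w (insert k ?T) e) (z powi e * V)"
      by (rule pole) (use insert.prems ij in auto)
    then obtain V where V: "\<And>e. regular_value x (?D * expts_gf w (insert k ?T) e) (z powi e * V)" by blast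
    \<comment> \<open>If the new residue were 0, this relation would force the old one to be
      0.\<close>
    have "z powi 0 * V = z powi 0 * C + x * (z powi (0 + w k) * V)"
      by (rule regular_value_insert[OF k V C(2) V])
    then have "V \<noteq> 0" using C(1) by (cases "V = 0") simp_all
    then show ?case unfolding kT using V by blast
  qed
  have "insert i (insert j (S - {i, j})) = S" using ij by auto
  then show ?thesis using ind[OF order_refl] by simp
qed

section \<open>Circle weights of the coordinates and their conjugates\<close>

lemma weights_pos: "weights N \<Longrightarrow> N k > 0"
  by (simp add: weights_def order.strict_trans[OF zero_less_one])

lemma weights_inj:
  assumes "weights N" shows "inj N"
proof (rule injI, rule ccontr)
  fix i j assume eq: "N i = N j" and "i \<noteq> j"
  have "coprime (N i) (N j)" using assms \<open>i \<noteq> j\<close> unfolding weights_def pairwise_def by blast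
  then have "N j = 1" unfolding eq by simp
  moreover have "N j > 1" using assms by (simp add: weights_def)
  ultimately show False by simp
qed

text \<open>The index (i, True) stands for z_i and (i, False) for its conjugate, on which the circle
  acts with the opposite exponent. Total weight 0 is then invariance of a monomial.\<close>

definition coordinate_weight :: "('n::finite \<Rightarrow> nat) \<Rightarrow> 'n \<times> bool \<Rightarrow> int" where
  "coordinate_weight N k = (if snd k then int (N (fst k)) else - int (N (fst k)))"

text \<open>Models complex conjugation of monomials. It negates the total weight, so it maps
  solutions to solutions because the offset is 0.\<close>

lemma expts_reflect:
  assumes t: "\<And>k. t (t k) = k" and w: "\<And>k. w (t k) = - w k"
  shows "card (expts w (t ` S) 0 n) = card (expts w S 0 n)"
proof -
  have "bij t" using t by (metis bijI')
  have s1: "(\<Sum>k\<in>UNIV. u (t k)) = (\<Sum>k\<in>UNIV. u k)" for u :: "'a \<Rightarrow> nat"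
    using sum.reindex_bij_betw[OF \<open>bij t\<close>, of u] .
  have s2: "(\<Sum>k\<in>UNIV. w k * int (u (t k))) = - (\<Sum>k\<in>UNIV. w k * int (u k))" for u :: "'a \<Rightarrow> nat"
  proof -
    have "(\<Sum>k\<in>UNIV. w k * int (u (t k))) = (\<Sum>k\<in>UNIV. - (w (t k) * int (u (t k))))"
      by (simp add: w)
    also have "\<dots> = (\<Sum>k\<in>UNIV. - (w k * int (u k)))"
      using sum.reindex_bij_betw[OF \<open>bij t\<close>, of "\<lambda>k. - (w k * int (u k))"] .
    finally show ?thesis by (simp add: sum_negf)
  qed
  have mem: "u \<circ> t \<in> expts w (t ` S) 0 n" if "u \<in> expts w S 0 n" for u S
  proof -
    have "t k \<notin> S" if "k \<notin> t ` S" for k using that t by (metis image_eqI)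
    then show ?thesis using that s1[of u] s2[of u] by (auto simp: expts_def)
  qed
  have tt: "t ` t ` S = S" using t by (simp add: image_image)
  have "bij_betw (\<lambda>u. u \<circ> t) (expts w S 0 n) (expts w (t ` S) 0 n)"
    using mem[of _ S] mem[of _ "t ` S"] t unfolding tt
    by (intro bij_betw_byWitness[where f' = "\<lambda>u. u \<circ> t"]) (auto simp: o_def)
  then show ?thesis by (metis bij_betw_same_card)
qed

text \<open>A coordinate against its own conjugate is eliminated with exponents 1 and 1, and x^2 is
  not 1 because m > 2. Different indices are eliminated with the two weights crosswise, so the
  denominator exponent is their pair sum.\<close>

lemma coordinate_weight_good_pair:
  assumes "snd k" "\<not> snd l" "fst k = fst l \<or> \<not> m dvd N (fst k) + N (fst l)"
    and x: "\<And>n. x ^ n = 1 \<longleftrightarrow> m dvd n" and "m > 2"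
  shows "\<exists>p q. int p * coordinate_weight N k + int q * coordinate_weight N l = 0 \<and> (x::complex) ^ (p + q) \<noteq> 1"
proof (cases "fst k = fst l")
  case True
  have "\<not> m dvd 1 + 1" using \<open>m > 2\<close> by (auto dest: dvd_imp_le)
  then have "x ^ (1 + 1) \<noteq> 1" using x by blast
  then show ?thesis using True assms(1,2)
    by (intro exI[of _ 1]) (simp add: coordinate_weight_def)
next
  case False
  then have "x ^ (N (fst l) + N (fst k)) \<noteq> 1" using assms(3) x by (simp add: add.commute)
  then show ?thesis using assms(1,2)
    by (intro exI[of _ "N (fst l)"] exI[of _ "N (fst k)"]) (simp add: coordinate_weight_def)
qed

lemma invariant_gf_regular:
  assumes "weights N" and x: "\<And>n. x ^ n = 1 \<longleftrightarrow> m dvd n" and "m > 2"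
    and "\<And>i j. i \<noteq> j \<Longrightarrow> \<not> m dvd N i + N j"
  shows "\<exists>v. regular_value x (expts_gf (coordinate_weight N) UNIV 0) v"
proof (rule expts_gf_regular)
  fix k l :: "'a \<times> bool"
  have "N (fst k) > 1" using assms(1) by (simp add: weights_def)
  then show "coordinate_weight N k \<noteq> 0" by (auto simp: coordinate_weight_def)
  assume "coordinate_weight N k > 0" "coordinate_weight N l < 0"
  then have "snd k" "\<not> snd l" by (auto simp: coordinate_weight_def split: if_splits)
  then show "\<exists>p q. int p * coordinate_weight N k + int q * coordinate_weight N l = 0 \<and> x ^ (p + q) \<noteq> 1"
    by (rule coordinate_weight_good_pair) (use assms in auto)
qed

text \<open>If the series were regular, multiplying it by 1 - X^m would give the value 0 at
  \<open>x\<close>; elimination gives the sum of two equal nonzero residues instead.\<close>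

lemma invariant_gf_singular:
  assumes N: "weights N" and x: "\<And>n. x ^ n = 1 \<longleftrightarrow> m dvd n" and "i \<noteq> j" and m: "m = N i + N j"
    and only: "\<And>k l. k \<noteq> l \<Longrightarrow> m dvd N k + N l \<Longrightarrow> {k, l} = {i, j}"
  shows "\<not> regular_value x (expts_gf (coordinate_weight N) UNIV 0) v"
proof
  assume reg: "regular_value x (expts_gf (coordinate_weight N) UNIV 0) v"
  let ?w = "coordinate_weight N"
  have pos: "N k > 1" for k using N by (simp add: weights_def)
  have m2: "m > 2" using pos[of i] pos[of j] m by simp
  have cop: "coprime (N i) (N j)" "coprime (N j) (N i)"
    using N \<open>i \<noteq> j\<close> by (auto simp: weights_def pairwise_def)
  have nz: "?w k \<noteq> 0" for k using pos[of "fst k"] by (auto simp: coordinate_weight_def)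
  have xm: "x ^ m = 1" using x by simp
  \<comment> \<open>These are z_j and its conjugate. Dropping either of them leaves a set with a
    single resonant pair.\<close>
  define \<alpha> \<beta> where "\<alpha> = (j, True)" and "\<beta> = (j, False)"
  define R where "R = UNIV - {\<alpha>, \<beta>}"
  have R: "\<alpha> \<notin> R" "\<beta> \<notin> R" "\<alpha> \<noteq> \<beta>" "insert \<alpha> (insert \<beta> R) = UNIV"
    by (auto simp: R_def \<alpha>_def \<beta>_def)
  let ?D = "1 - fps_X ^ m :: complex fps"
  have D0: "regular_value x ?D 0" using regular_value_one_minus_X_power[of x m] xm by simp
  have good: "\<exists>p q. int p * ?w k + int q * ?w l = 0 \<and> x ^ (p + q) \<noteq> 1"
    if "?w k > 0" "?w l < 0" "(k, l) \<noteq> ((i, True), (j, False))" "(k, l) \<noteq> ((j, True), (i, False))" for k l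
  proof -
    have kl: "snd k" "\<not> snd l" using that by (auto simp: coordinate_weight_def split: if_splits)
    have "fst k = fst l \<or> \<not> m dvd N (fst k) + N (fst l)"
    proof (rule ccontr)
      assume "\<not> ?thesis"
      then have "{fst k, fst l} = {i, j}" using only by blast
      then have "(fst k = i \<and> fst l = j) \<or> (fst k = j \<and> fst l = i)" by (auto simp: doubleton_eq_iff)
      then show False using that kl by (cases k; cases l) auto
    qed
    then show ?thesis by (rule coordinate_weight_good_pair[OF kl]) (use x m2 in auto)
  qed
  obtain z where z: "x * z ^ N i = 1" "z ^ N j = x"
    using root_of_unity_solution[OF cop(1), of x] pos[of i] pos[of j] xm m by auto
  have "\<exists>C. C \<noteq> 0 \<and> (\<forall>e. regular_value x ((1 - fps_X ^ (N i + N j)) * expts_gf ?w (insert \<beta> R) e) (z powi e * C))"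
  proof (rule expts_gf_simple_pole[of "(i, True)" _ \<beta>])
    show "\<exists>p q. int p * ?w k + int q * ?w l = 0 \<and> x ^ (p + q) \<noteq> 1"
      if "k \<in> insert \<beta> R" "l \<in> insert \<beta> R" "?w k > 0" "?w l < 0" "(k, l) \<noteq> ((i, True), \<beta>)" for k l
      using that by (intro good) (auto simp: \<alpha>_def \<beta>_def R_def)
  qed (use \<open>i \<noteq> j\<close> pos[of i] pos[of j] nz cop z in \<open>auto simp: coordinate_weight_def \<alpha>_def \<beta>_def R_def\<close>)
  then obtain C where C: "C \<noteq> 0" "\<And>e. regular_value x (?D * expts_gf ?w (insert \<beta> R) e) (z powi e * C)"
    unfolding m by blast
  obtain y where y: "x * y ^ N j = 1" "y ^ N i = x"
    using root_of_unity_solution[OF cop(2), of x] pos[of i] pos[of j] xm m by (auto simp: add.commute)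
  have "\<exists>C. C \<noteq> 0 \<and> (\<forall>e. regular_value x ((1 - fps_X ^ (N j + N i)) * expts_gf ?w (insert \<alpha> R) e) (y powi e * C))"
  proof (rule expts_gf_simple_pole[of \<alpha> _ "(i, False)"])
    show "\<exists>p q. int p * ?w k + int q * ?w l = 0 \<and> x ^ (p + q) \<noteq> 1"
      if "k \<in> insert \<alpha> R" "l \<in> insert \<alpha> R" "?w k > 0" "?w l < 0" "(k, l) \<noteq> (\<alpha>, (i, False))" for k l
      using that by (intro good) (auto simp: \<alpha>_def \<beta>_def R_def)
  qed (use \<open>i \<noteq> j\<close> pos[of i] pos[of j] nz cop y in \<open>auto simp: coordinate_weight_def \<alpha>_def \<beta>_def R_def\<close>)
  then obtain C' where C': "C' \<noteq> 0" "\<And>e. regular_value x (?D * expts_gf ?w (insert \<alpha> R) e) (y powi e * C')"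
    unfolding m add.commute[of "N j"] by blast
  \<comment> \<open>Conjugation exchanges the two sets, so the residues at offset 0 agree.\<close>
  have "expts_gf ?w (insert \<alpha> R) 0 = expts_gf ?w (insert \<beta> R) 0"
  proof -
    define t :: "'a \<times> bool \<Rightarrow> 'a \<times> bool" where "t = (\<lambda>k. (fst k, \<not> snd k))"
    have tt: "t (t k) = k" for k by (simp add: t_def)
    have "t ` insert \<alpha> R = insert \<beta> R"
    proof
      show sub: "t ` insert \<alpha> R \<subseteq> insert \<beta> R" by (auto simp: t_def \<alpha>_def \<beta>_def R_def)
      show "insert \<beta> R \<subseteq> t ` insert \<alpha> R"
      proof
        fix k assume "k \<in> insert \<beta> R"
        then have "t k \<in> insert \<alpha> R" by (cases k) (auto simp: t_def \<alpha>_def \<beta>_def R_def)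
        then show "k \<in> t ` insert \<alpha> R" using tt by (metis image_eqI)
      qed
    qed
    moreover have "card (expts ?w (t ` insert \<alpha> R) 0 n) = card (expts ?w (insert \<alpha> R) 0 n)" for n
      by (intro expts_reflect) (auto simp: t_def coordinate_weight_def)
    ultimately show ?thesis by (simp add: expts_gf_def)
  qed
  then have "C = C'"
    using C(2)[of 0] C'(2)[of 0] regular_value_unique[of x "?D * expts_gf ?w (insert \<beta> R) 0" C C'] by simp
  have "(1 - fps_X ^ (1 + 1)) * expts_gf ?w (insert \<alpha> (insert \<beta> R)) 0 =
     (\<Sum>s<1. fps_X ^ s * expts_gf ?w (insert \<beta> R) (0 + int s * ?w \<alpha>)) +
     fps_X ^ 1 * (\<Sum>s<1. fps_X ^ s * expts_gf ?w (insert \<alpha> R) (0 + int 1 * ?w \<alpha> + int s * ?w \<beta>))"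
    by (rule expts_gf_elliott[OF R(1-3)]) (simp add: coordinate_weight_def \<alpha>_def \<beta>_def)
  then have split: "(1 - fps_X ^ 2) * expts_gf ?w UNIV 0 = expts_gf ?w (insert \<beta> R) 0 + fps_X * expts_gf ?w (insert \<alpha> R) (?w \<alpha>)"
    by (simp add: R(4) numeral_2_eq_2)
  have eq: "?D * ((1 - fps_X ^ 2) * expts_gf ?w UNIV 0) =
      ?D * expts_gf ?w (insert \<beta> R) 0 + fps_X * (?D * expts_gf ?w (insert \<alpha> R) (?w \<alpha>))"
    unfolding split by (simp add: distrib_left mult.left_commute)
  have "regular_value x (?D * ((1 - fps_X ^ 2) * expts_gf ?w UNIV 0)) (z powi 0 * C + x * (y powi (?w \<alpha>) * C'))"
    unfolding eq by (intro regular_value_add regular_value_mult regular_value_X C C')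
  \<comment> \<open>The second term sits at offset N j, and the ratio \<open>y\<close> satisfies
    \<open>x * y ^ N j = 1\<close>, so the shift cancels the factor \<open>x\<close>.\<close>
  moreover have "x * (y powi (?w \<alpha>) * C') = C'"
    using y(1) by (simp add: coordinate_weight_def \<alpha>_def flip: mult.assoc)
  ultimately have "regular_value x (?D * ((1 - fps_X ^ 2) * expts_gf ?w UNIV 0)) (C + C')" by simp
  moreover have "regular_value x (?D * ((1 - fps_X ^ 2) * expts_gf ?w UNIV 0)) (0 * ((1 - x ^ 2) * v))"
    by (intro regular_value_mult D0 regular_value_one_minus_X_power reg)
  ultimately have "C + C' = 0" using regular_value_unique by fastforce
  then show False using \<open>C = C'\<close> C(1) by simp
qed

lemma primitive_root_of_unity:
  assumes "m > 0"
  obtains x :: complex where "\<And>n. x ^ n = 1 \<longleftrightarrow> m dvd n"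
proof
  fix n
  have "exp (2 * of_real pi * \<i> / of_nat m) ^ n = exp (2 * of_real pi * \<i> * of_nat n / of_nat m)"
    by (simp add: exp_of_nat_mult[symmetric] mult_ac)
  then show "exp (2 * of_real pi * \<i> / of_nat m) ^ n = 1 \<longleftrightarrow> m dvd n"
    using complex_root_unity_eq_1[of m n] assms by simp
qed

lemma pcompose_power: "pcompose (p ^ n) q = pcompose p q ^ n"
  by (induction n) (simp_all add: pcompose_mult one_pCons pcompose_pCons)

section \<open>Pair sums\<close>

text \<open>Encodes the multiset of weights: the coefficient at X^n is the number of indices of
  weight n.\<close>

definition power_sum_poly :: "('n::finite \<Rightarrow> nat) \<Rightarrow> real poly" where
  "power_sum_poly N = (\<Sum>i\<in>UNIV. monom 1 (N i))"

lemma coeff_power_sum_poly: "coeff (power_sum_poly N) n = real (card {i. N i = n})"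
  by (simp add: power_sum_poly_def coeff_sum sum.If_cases)

text \<open>The square runs over all ordered pairs of indices; the diagonal ones contribute X^(2 N
  i), which is the polynomial taken at X^2.\<close>

lemma power_sum_poly_square:
  "power_sum_poly N ^ 2 - pcompose (power_sum_poly N) (monom 1 2) =
     (\<Sum>(i, j)\<in>{(i, j). i \<noteq> j}. monom 1 (N i + N j))"
proof -
  have comp: "pcompose (monom 1 n) (monom 1 2) = (monom 1 (n + n) :: real poly)" for n
    by (simp add: monom_altdef[of _ n] pcompose_power pcompose_pCons monom_power mult_2)
  have "power_sum_poly N ^ 2 = (\<Sum>(i, j)\<in>UNIV \<times> UNIV. monom 1 (N i + N j))"
    by (simp add: power_sum_poly_def power2_eq_square sum_product sum.cartesian_product mult_monom)
  also have "UNIV \<times> UNIV = {(i, j). i \<noteq> j} \<union> (\<lambda>i::'a. (i, i)) ` UNIV" by auto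
  also have "(\<Sum>(i, j)\<in>\<dots>. monom 1 (N i + N j)) = (\<Sum>(i, j)\<in>{(i, j). i \<noteq> j}. monom 1 (N i + N j)) +
      (\<Sum>(i, j)\<in>(\<lambda>i::'a. (i, i)) ` UNIV. monom 1 (N i + N j) :: real poly)"
    by (subst sum.union_disjoint) auto
  also have "(\<Sum>(i, j)\<in>(\<lambda>i::'a. (i, i)) ` UNIV. monom 1 (N i + N j) :: real poly) =
      pcompose (power_sum_poly N) (monom 1 2)"
    by (subst sum.reindex) (auto simp: inj_on_def power_sum_poly_def pcompose_sum comp)
  finally show ?thesis by simp
qed

text \<open>The argument of Selfridge and Straus: compare the orders of vanishing at 1.\<close>

lemma pair_sums_determine_range:
  fixes N :: "'n::finite \<Rightarrow> nat" and M :: "'m::finite \<Rightarrow> nat"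
  assumes card: "CARD('m) = CARD('n)" and not_pow: "\<nexists>k. CARD('n) = 2 ^ k"
    and sums: "(\<Sum>(i, j)\<in>{(i, j). i \<noteq> j}. monom (1::real) (M i + M j)) =
      (\<Sum>(i, j)\<in>{(i, j). i \<noteq> j}. monom 1 (N i + N j))"
  shows "range M = range N"
proof -
  define A B where "A = power_sum_poly M" and "B = power_sum_poly N"
  define s where "s = (monom 1 2 :: real poly)"
  have "A = B"
  proof (rule ccontr)
    assume "A \<noteq> B"
    define C where "C = A - B"
    have C0: "C \<noteq> 0" using \<open>A \<noteq> B\<close> by (simp add: C_def)
    have A1: "poly A 1 = real CARD('n)" "poly B 1 = real CARD('n)"
      using card by (simp_all add: A_def B_def power_sum_poly_def poly_sum poly_monom)
    define k where "k = order 1 C"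
    \<comment> \<open>Both polynomials take the value d at 1, so their difference vanishes
      there.\<close>
    have k: "k \<noteq> 0" using C0 A1 order_root[of C 1] by (auto simp: C_def k_def)
    obtain p where p: "C = [:- 1, 1:] ^ k * p" "\<not> [:- 1, 1:] dvd p"
      using order_decomp[OF C0, of 1] by (auto simp: k_def)
    have p1: "poly p 1 \<noteq> 0" using p(2) by (simp add: poly_eq_0_iff_dvd)
    have "A ^ 2 - pcompose A s = B ^ 2 - pcompose B s"
      using sums by (simp add: A_def B_def s_def power_sum_poly_square)
    then have "(A + B) * C = pcompose C s"
      by (simp add: C_def pcompose_diff algebra_simps power2_eq_square)
    also have "\<dots> = pcompose [:- 1, 1:] s ^ k * pcompose p s"
      by (simp add: p(1) pcompose_mult pcompose_power)
    \<comment> \<open>Since X^2 - 1 is X - 1 times X + 1, the substitution keeps the order of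
      vanishing at 1 and contributes the factor (X + 1)^k. After cancelling the zero, evaluation at
      1 gives 2 d = 2^k.\<close>
    also have "pcompose [:- 1, 1:] s = [:- 1, 1:] * [:1, 1:]"
      by (simp add: s_def pcompose_pCons monom_altdef power2_eq_square)
    finally have "[:- 1, 1:] ^ k * ((A + B) * p) = [:- 1, 1:] ^ k * ([:1, 1:] ^ k * pcompose p s)"
      by (simp only: p(1) power_mult_distrib mult_ac)
    then have "(A + B) * p = [:1, 1:] ^ k * pcompose p s" by simp
    then have "poly ((A + B) * p) 1 = poly ([:1, 1:] ^ k * pcompose p s) 1" by simp
    then have "2 * real CARD('n) * poly p 1 = 2 ^ k * poly p 1"
      using A1 by (simp add: poly_pcompose s_def poly_monom)
    then have "2 * real CARD('n) = 2 ^ k" using p1 by simp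
    then have "real (2 * CARD('n)) = real (2 ^ k)" by simp
    then have "2 * CARD('n) = 2 ^ k" by (simp only: of_nat_eq_iff)
    then have "CARD('n) = 2 ^ (k - 1)" using k by (cases k) auto
    then show False using not_pow by blast
  qed
  then have c: "card {i. M i = n} = card {i. N i = n}" for n
    using coeff_power_sum_poly[of M n] coeff_power_sum_poly[of N n] by (simp add: A_def B_def)
  have rM: "n \<in> range M \<longleftrightarrow> card {i. M i = n} \<noteq> 0" for n by auto
  have rN: "n \<in> range N \<longleftrightarrow> card {i. N i = n} \<noteq> 0" for n by auto
  show ?thesis
    by (rule set_eqI) (simp only: rM rN c)
qed

text \<open>A sum that occurs belongs to one unordered pair, hence to two ordered ones; this is the
  factor 2. The right-hand side depends only on the set of sums.\<close>

lemma pair_sums_fibers: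
  fixes N :: "'n::finite \<Rightarrow> nat"
  assumes inj: "inj_on (sum N) {A. card A = 2}"
  shows "(\<Sum>(i, j)\<in>{(i, j). i \<noteq> j}. monom (1::real) (N i + N j)) =
    (\<Sum>n\<in>sum N ` {A. card A = 2}. smult 2 (monom 1 n))"
proof -
  let ?P = "{(i::'n, j). i \<noteq> j}"
  let ?f = "\<lambda>(i, j). N i + N j"
  have s: "sum N {i, j} = N i + N j" if "i \<noteq> j" for i j using that by simp
  have "(\<Sum>(i, j)\<in>?P. monom (1::real) (N i + N j)) = (\<Sum>x\<in>?P. monom 1 (?f x))"
    by (simp add: case_prod_unfold)
  also have "\<dots> = (\<Sum>n\<in>?f ` ?P. \<Sum>x\<in>{x \<in> ?P. ?f x = n}. monom 1 (?f x))"
    by (rule sum.image_gen) (rule finite)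
  also have "?f ` ?P = sum N ` {A. card A = 2}"
  proof (intro equalityI subsetI)
    fix n assume "n \<in> ?f ` ?P"
    then obtain i j where ij: "i \<noteq> j" "n = N i + N j" by auto
    then have "n = sum N {i, j}" "{i, j} \<in> {A. card A = 2}" using s by auto
    then show "n \<in> sum N ` {A. card A = 2}" by blast
  next
    fix n assume "n \<in> sum N ` {A. card A = 2}"
    then obtain A where A: "card A = 2" "n = sum N A" by auto
    then obtain i j where ij: "i \<noteq> j" "A = {i, j}" by (auto simp: card_2_iff)
    then have "(i, j) \<in> ?P" "n = ?f (i, j)" using A by auto
    then show "n \<in> ?f ` ?P" by blast
  qed
  also have "(\<Sum>n\<in>sum N ` {A. card A = 2}. \<Sum>x\<in>{x \<in> ?P. ?f x = n}. monom (1::real) (?f x)) =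
    (\<Sum>n\<in>sum N ` {A. card A = 2}. smult 2 (monom 1 n))"
  proof (rule sum.cong[OF refl])
    fix n assume "n \<in> sum N ` {A. card A = 2}"
    then obtain i j where ij: "i \<noteq> j" "n = sum N {i, j}" by (auto simp: card_2_iff)
    have "{x \<in> ?P. ?f x = n} = {(i, j), (j, i)}"
    proof (intro equalityI subsetI)
      fix x assume "x \<in> {x \<in> ?P. ?f x = n}"
      then obtain k l where kl: "x = (k, l)" "k \<noteq> l" "sum N {k, l} = sum N {i, j}" using ij by auto
      have "{k, l} = {i, j}"
        by (rule inj_onD[OF inj kl(3)]) (use kl(2) ij in auto)
      then show "x \<in> {(i, j), (j, i)}" using kl by (auto simp: doubleton_eq_iff)
    next
      fix x assume "x \<in> {(i, j), (j, i)}"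
      then show "x \<in> {x \<in> ?P. ?f x = n}" using ij by auto
    qed
    then have c: "card {x \<in> ?P. ?f x = n} = 2" using ij(1) by simp
    have "(\<Sum>x\<in>{x \<in> ?P. ?f x = n}. monom (1::real) (?f x)) = (\<Sum>x\<in>{x \<in> ?P. ?f x = n}. monom 1 n)"
      by (rule sum.cong) auto
    with c show "(\<Sum>x\<in>{x \<in> ?P. ?f x = n}. monom (1::real) (?f x)) = smult 2 (monom 1 n)"
      by (simp add: smult_monom of_nat_poly)
  qed
  finally show ?thesis .
qed

lemma invariant_gf_determines_range:
  fixes N :: "'n::finite \<Rightarrow> nat" and M :: "'m::finite \<Rightarrow> nat"
  assumes M: "weights M" and N: "weights N" and card: "CARD('m) = CARD('n)"
    and not_pow: "\<nexists>k. CARD('n) = 2 ^ k"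
    and bound: "\<And>i j. N j \<le> 2 * N i"
    and inj: "inj_on (sum N) {A. card A = 2}"
    and gf: "expts_gf (coordinate_weight M) UNIV 0 = expts_gf (coordinate_weight N) UNIV 0"
  shows "range M = range N"
proof -
  let ?TM = "{A :: 'm set. card A = 2}" and ?TN = "{A :: 'n set. card A = 2}"
  have posM: "M k > 1" for k using M by (simp add: weights_def)
  have posN: "N k > 1" for k using N by (simp add: weights_def)
  have d2: "CARD('n) \<ge> 2"
  proof -
    have "CARD('n) \<noteq> 0" by simp
    moreover have "CARD('n) \<noteq> 1" using not_pow by (metis power_0)
    ultimately show ?thesis by linarith
  qed
  have pairs: "sum f A = f i + f j" if "i \<noteq> j" "A = {i, j}" for f :: "'b \<Rightarrow> nat" and A i j
    using that by simp
  \<comment> \<open>A failure would force N k = 2 N i and N l = 2 N j, two even weights, against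
    coprimality. So a pair sum of \<open>N\<close> that is a multiple of another equals it.\<close>
  have small: "N k + N l < 2 * (N i + N j)" if "i \<noteq> j" "k \<noteq> l" for i j k l
  proof (rule ccontr)
    assume "\<not> ?thesis"
    then have "N k \<ge> 2 * N i" "N l \<ge> 2 * N j" using bound[of k i] bound[of l j] by simp_all
    then have "N k = 2 * N i" "N l = 2 * N j" using bound[of k i] bound[of l j] by simp_all
    moreover have "coprime (N k) (N l)" using N \<open>k \<noteq> l\<close> by (auto simp: weights_def pairwise_def)
    ultimately show False by simp
  qed
  have dvd_small: "a = b" if "b dvd a" "a < 2 * b" "a > 0" for a b :: nat
  proof -
    obtain c where c: "a = b * c" using \<open>b dvd a\<close> by (elim dvdE)
    then have "c < 2" "c > 0" using that by (auto simp: mult.commute)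
    then have "c = 1" by simp
    then show ?thesis using c by simp
  qed
  have singN: "\<not> regular_value x (expts_gf (coordinate_weight N) UNIV 0) v"
    if "i \<noteq> j" "\<And>n. x ^ n = 1 \<longleftrightarrow> N i + N j dvd n" for x v i j
  proof (rule invariant_gf_singular[OF N that(2) that(1) refl])
    fix k l assume kl: "k \<noteq> l" "N i + N j dvd N k + N l"
    have "N k + N l = N i + N j"
      by (rule dvd_small[OF kl(2) small[OF that(1) kl(1)]]) (use posN[of k] in simp)
    then have "sum N {k, l} = sum N {i, j}" using kl that by simp
    then show "{k, l} = {i, j}" by (rule inj_onD[OF inj]) (use kl that in auto)
  qed
  have "?TM \<noteq> {}"
  proof -
    obtain A :: "'m set" where "card A = 2"
      using obtain_subset_with_card_n[of 2 "UNIV :: 'm set"] d2 card by auto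
    then show ?thesis by auto
  qed
  then have "Max (sum M ` ?TM) \<in> sum M ` ?TM" by (intro Max_in) auto
  then obtain A0 where A0': "Max (sum M ` ?TM) = sum M A0" "A0 \<in> ?TM" by (rule imageE)
  have A0: "sum M A \<le> sum M A0" if "A \<in> ?TM" for A
    unfolding A0'(1)[symmetric] using that by (intro Max_ge) auto
  from A0'(2) obtain i0 j0 where ij0: "i0 \<noteq> j0" "A0 = {i0, j0}" by (auto simp: card_2_iff)
  define m where "m = M i0 + M j0"
  have max: "M k + M l \<le> m" if "k \<noteq> l" for k l
    using A0[of "{k, l}"] that ij0 by (simp add: m_def)
  \<comment> \<open>The largest sum belongs to a single pair: given two pairs with this sum,
    exchanging partners yields sums that are again at most \<open>m\<close>, which forces the pairs
    to agree.\<close>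
  have singM: "\<not> regular_value x (expts_gf (coordinate_weight M) UNIV 0) v"
    if "\<And>n. x ^ n = 1 \<longleftrightarrow> m dvd n" for x v
  proof (rule invariant_gf_singular[OF M that ij0(1) m_def])
    fix k l assume kl: "k \<noteq> l" "m dvd M k + M l"
    then have s: "M k + M l = M i0 + M j0" using max[OF kl(1)] posM[of k] by (auto simp: m_def dest: dvd_imp_le)
    have eq: "k = k'" if "M k = M k'" for k k' using weights_inj[OF M] that by (auto dest: injD)
    show "{k, l} = {i0, j0}"
    proof (cases "i0 = l \<or> k = j0")
      case True
      then show ?thesis using s eq[of k j0] eq[of l i0] by auto
    next
      case False
      have "M i0 + M l \<le> M k + M l" "M k + M j0 \<le> M i0 + M j0"
        using max[of i0 l] max[of k j0] False s by (auto simp: m_def)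
      then have "M k = M i0" by simp
      then show ?thesis using s eq[of k i0] eq[of l j0] by auto
    qed
  qed
  have m2: "m > 2" using posM[of i0] posM[of j0] by (simp add: m_def)
  obtain x :: complex where x: "\<And>n. x ^ n = 1 \<longleftrightarrow> m dvd n" using primitive_root_of_unity[of m] m2 by auto
  \<comment> \<open>The common series has a pole at a primitive m-th root of unity, so m divides a
    pair sum of \<open>N\<close>, and that sum bounds all pair sums of \<open>M\<close>.\<close>
  have "\<exists>i j. i \<noteq> j \<and> m dvd N i + N j"
    using invariant_gf_regular[OF N x m2] singM[OF x] gf by auto
  then obtain i1 j1 where ij1: "i1 \<noteq> j1" "m dvd N i1 + N j1" by blast
  have m_le: "m \<le> N i1 + N j1" using ij1 posN[of i1] by (intro dvd_imp_le) auto
  have sub: "sum N ` ?TN \<subseteq> sum M ` ?TM"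
  proof
    fix n assume "n \<in> sum N ` ?TN"
    then obtain i j where ij: "i \<noteq> j" "n = N i + N j" by (auto simp: card_2_iff)
    have n2: "n > 2" using posN[of i] posN[of j] ij by simp
    obtain x :: complex where x: "\<And>k. x ^ k = 1 \<longleftrightarrow> n dvd k" using primitive_root_of_unity[of n] n2 by auto
    have "\<exists>k l. k \<noteq> l \<and> n dvd M k + M l"
      using invariant_gf_regular[OF M x n2] singN[OF ij(1) x[unfolded ij(2)]] gf by auto
    then obtain k l where kl: "k \<noteq> l" "n dvd M k + M l" by blast
    \<comment> \<open>Through \<open>m\<close> this sum is bounded by some pair sum of
      \<open>N\<close>, hence is less than 2 n; being a positive multiple of n, it is n.\<close>
    have "M k + M l < 2 * n" using le_less_trans[OF order_trans[OF max[OF kl(1)] m_le] small[OF ij(1) ij1(1)]] ij(2) by simp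
    then have "M k + M l = n" using kl(2) dvd_small posM[of k] by simp
    then have "n = sum M {k, l}" "{k, l} \<in> ?TM" using kl by auto
    then show "n \<in> sum M ` ?TM" by blast
  qed
  have ct: "card ?TM = CARD('m) choose 2" "card ?TN = CARD('n) choose 2"
    using n_subsets[of "UNIV :: 'm set" 2] n_subsets[of "UNIV :: 'n set" 2] by auto
  have cN: "card (sum N ` ?TN) = CARD('n) choose 2" using card_image[OF inj] ct by simp
  have cM: "card (sum M ` ?TM) \<le> card ?TM" by (rule card_image_le) (rule finite)
  \<comment> \<open>\<open>N\<close> has as many distinct sums as pairs, all of them are sums of
    \<open>M\<close>, and \<open>M\<close> has equally many pairs; so no sum of \<open>M\<close>
    repeats.\<close>
  have "card (sum M ` ?TM) = card ?TM"
    using card_mono[OF _ sub] cN cM ct card by simp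
  then have injM: "inj_on (sum M) ?TM" by (intro eq_card_imp_inj_on) auto
  have "sum N ` ?TN = sum M ` ?TM"
    by (rule card_subset_eq[OF _ sub]) (use cN ct card \<open>card (sum M ` ?TM) = card ?TM\<close> in auto)
  then show ?thesis
    by (intro pair_sums_determine_range[OF card not_pow])
      (simp add: pair_sums_fibers[OF inj] pair_sums_fibers[OF injM])
qed

section \<open>Horizontal planes and their stabilizers\<close>

lemma orbit_velocity_nth: "orbit_velocity N z $ k = \<i> * of_nat (N k) * z $ k"
proof -
  have 1: "((\<lambda>t. cis t ^ N k * z $ k) has_vector_derivative \<i> * of_nat (N k) * z $ k) (at 0)" for k
  proof -
    have "((\<lambda>w. exp (\<i> * of_nat (N k) * w) * z $ k) has_field_derivative \<i> * of_nat (N k) * z $ k)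
        (at (of_real 0))"
      by (auto intro!: derivative_eq_intros)
    then have "((\<lambda>t. exp (\<i> * of_nat (N k) * of_real t) * z $ k) has_vector_derivative \<i> * of_nat (N k) * z $ k) (at 0)"
      by (rule has_vector_derivative_real_field)
    moreover have "exp (\<i> * of_nat (N k) * of_real t) = cis t ^ N k" for t
      by (simp add: cis_conv_exp mult_ac flip: exp_of_nat_mult)
    ultimately show ?thesis by simp
  qed
  have lin: "bounded_linear (axis i :: complex \<Rightarrow> complex ^ 'a)" for i
    by (intro linear_conv_bounded_linear[THEN iffD1] linearI) (auto simp: axis_def vec_eq_iff)
  have e: "(\<chi> k. f k) = (\<Sum>i\<in>UNIV. axis i (f i))" for f :: "'a \<Rightarrow> complex"
    by (simp add: vec_eq_iff axis_def if_distrib cong: if_cong)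
  have "((\<lambda>t. circle_act N (cis t) z) has_vector_derivative (\<chi> k. \<i> * of_nat (N k) * z $ k)) (at 0)"
    unfolding circle_act_def e
    by (intro has_vector_derivative_sum bounded_linear.has_vector_derivative[OF lin] 1)
  then show ?thesis
    unfolding orbit_velocity_def by (simp add: vector_derivative_at)
qed

lemma inner_orbit_velocity:
  "inner v (orbit_velocity N z) = (\<Sum>k\<in>UNIV. real (N k) * Im (v $ k * cnj (z $ k)))"
  unfolding inner_vec_def
  by (intro sum.cong refl) (simp add: orbit_velocity_nth inner_complex_def algebra_simps)

text \<open>If \<open>v, w\<close> is an orthonormal basis of a real plane, \<open>p = (v - \<i> w) / 2\<close> and \<open>q = (v + \<i> w) / 2\<close>, then
  \<open>plane_point p q (x + \<i> y) = x v + y w\<close>.\<close>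

definition plane_point :: "('n::finite \<Rightarrow> complex) \<Rightarrow> ('n \<Rightarrow> complex) \<Rightarrow> complex \<Rightarrow> complex ^ 'n" where
  "plane_point p q \<zeta> = (\<chi> k. \<zeta> * p k + cnj \<zeta> * q k)"

lemma norm_plane_point:
  "(norm (plane_point p q \<zeta>))\<^sup>2 = (cmod \<zeta>)\<^sup>2 * (\<Sum>k\<in>UNIV. (cmod (p k))\<^sup>2 + (cmod (q k))\<^sup>2) +
     2 * Re (\<zeta>\<^sup>2 * (\<Sum>k\<in>UNIV. p k * cnj (q k)))"
proof -
  have 1: "(cmod (\<zeta> * p k + cnj \<zeta> * q k))\<^sup>2 =
      (cmod \<zeta>)\<^sup>2 * ((cmod (p k))\<^sup>2 + (cmod (q k))\<^sup>2) + 2 * Re (\<zeta>\<^sup>2 * (p k * cnj (q k)))" for k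
    unfolding cmod_power2 by (simp add: power2_eq_square algebra_simps)
  have "(norm (plane_point p q \<zeta>))\<^sup>2 = (\<Sum>k\<in>UNIV. (cmod (\<zeta> * p k + cnj \<zeta> * q k))\<^sup>2)"
    by (simp add: norm_vec_def plane_point_def L2_set_def sum_nonneg)
  also have "\<dots> = (\<Sum>k\<in>UNIV. (cmod \<zeta>)\<^sup>2 * ((cmod (p k))\<^sup>2 + (cmod (q k))\<^sup>2)) +
      (\<Sum>k\<in>UNIV. 2 * Re (\<zeta>\<^sup>2 * (p k * cnj (q k))))"
    by (simp only: 1 sum.distrib)
  finally show ?thesis
    by (simp only: sum_distrib_left[symmetric] Re_sum[symmetric])
qed

text \<open>An orthonormal basis v, w of the plane makes \<open>plane_point p q\<close> an isometry
  of the complex plane onto \<open>V\<close>, which is what the first two sums express. The last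
  equation is orthogonality of v to the orbit velocity at w, because Im (v_k cnj w_k) = |q_k|^2 -
  |p_k|^2.\<close>

lemma horizontal_plane_plane_point:
  assumes "horizontal_plane N V"
  obtains p q where "V = range (plane_point p q)"
    "(\<Sum>k\<in>UNIV. (cmod (p k))\<^sup>2 + (cmod (q k))\<^sup>2) = 1" "(\<Sum>k\<in>UNIV. p k * cnj (q k)) = 0"
    "(\<Sum>k\<in>UNIV. real (N k) * (cmod (p k))\<^sup>2) = (\<Sum>k\<in>UNIV. real (N k) * (cmod (q k))\<^sup>2)"
proof -
  have V: "subspace V" "dim V = 2" and
    hor: "\<And>z v. z \<in> V \<Longrightarrow> norm z = 1 \<Longrightarrow> v \<in> V \<Longrightarrow> inner v z = 0 \<Longrightarrow> inner v (orbit_velocity N z) = 0"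
    using assms by (auto simp: horizontal_plane_def)
  obtain B where B: "B \<subseteq> V" "pairwise orthogonal B" "\<And>x. x \<in> B \<Longrightarrow> norm x = 1"
    "independent B" "card B = dim V" "span B = V"
    using orthonormal_basis_subspace[OF V(1)] by metis
  obtain v w where vw: "B = {v, w}" "v \<noteq> w" using B(5) V(2) by (auto simp: card_2_iff)
  have n: "norm v = 1" "norm w = 1" "inner v w = 0" "v \<in> V" "w \<in> V"
    using B vw by (auto simp: pairwise_def orthogonal_def)
  have nn: "inner v v = 1" "inner w w = 1" using n by (simp_all add: dot_square_norm)
  define p q where "p = (\<lambda>k. (v $ k - \<i> * w $ k) / 2)" and "q = (\<lambda>k. (v $ k + \<i> * w $ k) / 2)"
  have dp: "plane_point p q (Complex x y) = x *\<^sub>R v + y *\<^sub>R w" for x y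
    by (simp add: vec_eq_iff plane_point_def p_def q_def complex_eq_iff field_simps)
  have Veq: "V = range (plane_point p q)"
  proof
    show "V \<subseteq> range (plane_point p q)"
    proof
      fix z assume "z \<in> V"
      then have "z \<in> span {v, w}" using B(6) vw by simp
      then obtain x y where "z = x *\<^sub>R v + y *\<^sub>R w" by (auto simp: span_insert span_singleton algebra_simps)
      then show "z \<in> range (plane_point p q)" using dp[of x y] by (metis rangeI)
    qed
    show "range (plane_point p q) \<subseteq> V"
    proof clarify
      fix \<zeta> show "plane_point p q \<zeta> \<in> V"
        using dp[of "Re \<zeta>" "Im \<zeta>"] V(1) n by (simp add: subspace_add subspace_scale)
    qed
  qed
  define a b where "a = (\<Sum>k\<in>UNIV. (cmod (p k))\<^sup>2 + (cmod (q k))\<^sup>2)" and "b = (\<Sum>k\<in>UNIV. p k * cnj (q k))"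
  have iso: "(norm (plane_point p q \<zeta>))\<^sup>2 = (cmod \<zeta>)\<^sup>2" for \<zeta>
  proof -
    have "(norm (plane_point p q \<zeta>))\<^sup>2 = (norm (Re \<zeta> *\<^sub>R v + Im \<zeta> *\<^sub>R w))\<^sup>2"
      using dp[of "Re \<zeta>" "Im \<zeta>"] by simp
    also have "\<dots> = (Re \<zeta>)\<^sup>2 + (Im \<zeta>)\<^sup>2"
      using n(3) nn unfolding power2_norm_eq_inner
      by (simp add: inner_add_left inner_add_right inner_commute[of w v] power2_eq_square)
    finally show ?thesis by (simp add: cmod_power2)
  qed
  have ab: "(cmod \<zeta>)\<^sup>2 * a + 2 * Re (\<zeta>\<^sup>2 * b) = (cmod \<zeta>)\<^sup>2" for \<zeta>
    using norm_plane_point[of p q \<zeta>] iso[of \<zeta>] by (simp add: a_def b_def)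
  \<comment> \<open>The parameters 1 and \<i> separate \<open>a\<close> from \<open>Re b\<close>;
    the parameter 1 + \<i> below isolates \<open>Im b\<close>.\<close>
  have "a + 2 * Re b = 1" "a - 2 * Re b = 1" using ab[of 1] ab[of \<i>] by simp_all
  then have a1: "a = 1" "Re b = 0" by simp_all
  have "(cmod (Complex 1 1))\<^sup>2 = 2" by (simp add: cmod_power2)
  then have "Im b = 0" using ab[of "Complex 1 1"] a1 by (simp add: power2_eq_square)
  then have b0: "b = 0" using a1 by (simp add: complex_eq_iff)
  have perp: "inner v (orbit_velocity N w) = 0" using hor n by blast
  have im: "Im (v $ k * cnj (w $ k)) = (cmod (q k))\<^sup>2 - (cmod (p k))\<^sup>2" for k
    unfolding cmod_power2 p_def q_def by (simp add: power2_eq_square field_simps)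
  have "(\<Sum>k\<in>UNIV. real (N k) * (cmod (p k))\<^sup>2) = (\<Sum>k\<in>UNIV. real (N k) * (cmod (q k))\<^sup>2)"
    using perp unfolding inner_orbit_velocity im right_diff_distrib sum_subtractf by simp
  then show thesis using that Veq a1(1) b0 by (simp add: a_def b_def)
qed

text \<open>A real-linear isometry of the plane is a rotation or a reflection: in the expanded
  square the part varying with the phase is Re (\<zeta>^2 c cnj d), so c cnj d = 0.\<close>

lemma isometry_complex_cases:
  fixes c d :: complex
  assumes "\<And>\<zeta>. cmod (c * \<zeta> + d * cnj \<zeta>) = cmod \<zeta>"
  shows "(cmod c = 1 \<and> d = 0) \<or> (c = 0 \<and> cmod d = 1)"
proof -
  have sq: "(cmod (c * \<zeta> + d * cnj \<zeta>))\<^sup>2 =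
      ((cmod c)\<^sup>2 + (cmod d)\<^sup>2) * (cmod \<zeta>)\<^sup>2 + 2 * Re (\<zeta>\<^sup>2 * (c * cnj d))" for \<zeta>
    unfolding cmod_power2 by (simp add: power2_eq_square algebra_simps)
  have e: "((cmod c)\<^sup>2 + (cmod d)\<^sup>2) * (cmod \<zeta>)\<^sup>2 + 2 * Re (\<zeta>\<^sup>2 * (c * cnj d)) = (cmod \<zeta>)\<^sup>2" for \<zeta>
    using sq[of \<zeta>] assms[of \<zeta>] by simp
  define a b where "a = (cmod c)\<^sup>2 + (cmod d)\<^sup>2" and "b = c * cnj d"
  have e': "a * (cmod \<zeta>)\<^sup>2 + 2 * Re (\<zeta>\<^sup>2 * b) = (cmod \<zeta>)\<^sup>2" for \<zeta>
    using e[of \<zeta>] by (simp only: a_def b_def)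
  have "a + 2 * Re b = 1" "a - 2 * Re b = 1" using e'[of 1] e'[of \<i>] by simp_all
  then have a1: "a = 1" "Re b = 0" by simp_all
  have "(cmod (Complex 1 1))\<^sup>2 = 2" by (simp add: cmod_power2)
  then have "Im b = 0" using e'[of "Complex 1 1"] a1 by (simp add: power2_eq_square)
  then have "b = 0" using a1 by (simp add: complex_eq_iff)
  then have "c = 0 \<or> d = 0" by (simp add: b_def)
  moreover have "cmod x \<noteq> - 1" for x using norm_ge_zero[of x] by linarith
  ultimately show ?thesis using a1(1) by (auto simp: a_def power2_eq_1_iff)
qed

text \<open>In the parameter \<zeta> a stabilizing element acts by \<zeta> -> c \<zeta> + d cnj
  \<zeta>, which is an isometry. Comparing the coefficients of \<zeta> and cnj \<zeta> in each
  coordinate gives the equations, with d = 0 for rotations and c = 0 for reflections.\<close>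

lemma stabilizer_cases:
  assumes V: "V = range (plane_point p q)" and
    n: "(\<Sum>k\<in>UNIV. (cmod (p k))\<^sup>2 + (cmod (q k))\<^sup>2) = 1" "(\<Sum>k\<in>UNIV. p k * cnj (q k)) = 0"
    and u: "u \<in> stabilizer N V"
  shows "(\<exists>c. cmod c = 1 \<and> (\<forall>k. u ^ N k * p k = c * p k \<and> u ^ N k * q k = cnj c * q k)) \<or>
    (\<exists>d. cmod d = 1 \<and> (\<forall>k. u ^ N k * p k = cnj d * q k \<and> u ^ N k * q k = d * p k))"
proof -
  have u1: "cmod u = 1" "circle_act N u ` V = V" using u by (auto simp: stabilizer_def)
  have nrm: "norm (plane_point p q \<zeta>) = cmod \<zeta>" for \<zeta>
    using norm_plane_point[of p q \<zeta>] n by simp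
  have "circle_act N u (plane_point p q 1) \<in> range (plane_point p q)"
    "circle_act N u (plane_point p q \<i>) \<in> range (plane_point p q)" using u1(2) unfolding V by blast+
  then obtain g h where gh: "circle_act N u (plane_point p q 1) = plane_point p q g"
    "circle_act N u (plane_point p q \<i>) = plane_point p q h" by blast
  \<comment> \<open>These are the coefficients of the real-linear map with value \<open>g\<close> at
    1 and value \<open>h\<close> at \<i>.\<close>
  define c d where "c = (g - \<i> * h) / 2" and "d = (g + \<i> * h) / 2"
  have gh_cd: "g = c + d" "h = \<i> * (c - d)" by (auto simp: c_def d_def field_simps)
  have 1: "u ^ N k * p k + u ^ N k * q k = g * p k + cnj g * q k"
    "\<i> * (u ^ N k * p k) - \<i> * (u ^ N k * q k) = h * p k + cnj h * q k" for k
    using arg_cong[OF gh(1), of "\<lambda>z. z $ k"] arg_cong[OF gh(2), of "\<lambda>z. z $ k"]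
    by (simp_all add: circle_act_def plane_point_def algebra_simps)
  have 2: "u ^ N k * p k - u ^ N k * q k = (c - d) * p k - cnj (c - d) * q k" for k
  proof -
    have "\<i> * (u ^ N k * p k - u ^ N k * q k) = \<i> * ((c - d) * p k - cnj (c - d) * q k)"
      using 1(2)[of k] unfolding gh_cd by (simp add: algebra_simps)
    then show ?thesis by simp
  qed
  have 3: "2 * (u ^ N k * p k) = 2 * (c * p k + cnj d * q k)" for k
  proof -
    have "2 * (u ^ N k * p k) = (u ^ N k * p k + u ^ N k * q k) + (u ^ N k * p k - u ^ N k * q k)" by simp
    also have "\<dots> = 2 * (c * p k + cnj d * q k)" unfolding 1(1) 2 gh_cd(1) by (simp add: algebra_simps)
    finally show ?thesis .
  qed
  have 4: "2 * (u ^ N k * q k) = 2 * (d * p k + cnj c * q k)" for k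
  proof -
    have "2 * (u ^ N k * q k) = (u ^ N k * p k + u ^ N k * q k) - (u ^ N k * p k - u ^ N k * q k)" by simp
    also have "\<dots> = 2 * (d * p k + cnj c * q k)" unfolding 1(1) 2 gh_cd(1) by (simp add: algebra_simps)
    finally show ?thesis .
  qed
  have pq: "u ^ N k * p k = c * p k + cnj d * q k" "u ^ N k * q k = d * p k + cnj c * q k" for k
  proof -
    have two: "2 * a = 2 * b \<Longrightarrow> a = b" for a b :: complex by simp
    show "u ^ N k * p k = c * p k + cnj d * q k" "u ^ N k * q k = d * p k + cnj c * q k"
      using two[OF 3[of k]] two[OF 4[of k]] .
  qed
  have "cmod (c * \<zeta> + d * cnj \<zeta>) = cmod \<zeta>" for \<zeta>
  proof -
    have "circle_act N u (plane_point p q \<zeta>) = plane_point p q (c * \<zeta> + d * cnj \<zeta>)"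
    proof (rule vec_eq_iff[THEN iffD2], rule allI)
      fix k
      have "circle_act N u (plane_point p q \<zeta>) $ k = \<zeta> * (u ^ N k * p k) + cnj \<zeta> * (u ^ N k * q k)"
        by (simp add: circle_act_def plane_point_def algebra_simps)
      then show "circle_act N u (plane_point p q \<zeta>) $ k = plane_point p q (c * \<zeta> + d * cnj \<zeta>) $ k"
        unfolding pq by (simp add: plane_point_def algebra_simps)
    qed
    then show ?thesis using norm_circle_act[OF u1(1), of N "plane_point p q \<zeta>"] by (simp add: nrm)
  qed
  from isometry_complex_cases[OF this] show ?thesis using pq by auto
qed

lemma coprime_powers_eq_1:
  fixes y :: complex
  assumes "y ^ a = 1" "y ^ b = 1" "coprime a b"
  shows "y = 1"
proof (cases "a = 0")
  case True then show ?thesis using assms by simp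
next
  case False
  then obtain r s where rs: "a * r = b * s + 1" using bezout_nat[of a b] assms(3) by auto
  have "(y ^ a) ^ r = (y ^ b) ^ s * y" unfolding power_mult[symmetric] rs by simp
  then show ?thesis using assms by simp
qed

text \<open>A plane with a stabilizer larger than \<open>{1, -1}\<close> is an eigenplane of some diagonal matrix, which
  forces this shape.\<close>

lemma large_stabilizer_disjoint_support:
  assumes N: "weights N" and V: "V = range (plane_point p q)" and
    n: "(\<Sum>k\<in>UNIV. (cmod (p k))\<^sup>2 + (cmod (q k))\<^sup>2) = 1" "(\<Sum>k\<in>UNIV. p k * cnj (q k)) = 0"
    and h: "(\<Sum>k\<in>UNIV. real (N k) * (cmod (p k))\<^sup>2) = (\<Sum>k\<in>UNIV. real (N k) * (cmod (q k))\<^sup>2)"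
    and u: "u \<in> stabilizer N V" "u\<^sup>2 \<noteq> 1"
  shows "p k = 0 \<or> q k = 0"
proof -
  have pos: "N k > 0" for k by (rule weights_pos[OF N])
  define K where "K = {k. p k \<noteq> 0 \<or> q k \<noteq> 0}"
  \<comment> \<open>On a single active coordinate orthogonality would make p or q vanish, while
    horizontality gives them equal modulus.\<close>
  have "\<exists>k l. k \<in> K \<and> l \<in> K \<and> k \<noteq> l"
  proof (rule ccontr)
    assume *: "\<not> ?thesis"
    have "K \<noteq> {}"
    proof
      assume "K = {}"
      then have "p k = 0" "q k = 0" for k by (auto simp: K_def)
      then show False using n(1) by simp
    qed
    then obtain k where k: "k \<in> K" by blast
    have z: "p l = 0" "q l = 0" if "l \<noteq> k" for l using * k that by (auto simp: K_def)
    have "(\<Sum>l\<in>UNIV. p l * cnj (q l)) = p k * cnj (q k)"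
      using z by (subst sum.mono_neutral_right[of UNIV "{k}"]) auto
    then have 1: "p k = 0 \<or> q k = 0" using n(2) by simp
    have "(\<Sum>l\<in>UNIV. real (N l) * (cmod (p l))\<^sup>2) = real (N k) * (cmod (p k))\<^sup>2"
      "(\<Sum>l\<in>UNIV. real (N l) * (cmod (q l))\<^sup>2) = real (N k) * (cmod (q k))\<^sup>2"
      using z by (subst sum.mono_neutral_right[of UNIV "{k}"]; auto)+
    then have "cmod (p k) = cmod (q k)" using h pos[of k] by simp
    then have "p k = 0" "q k = 0" using 1 by auto
    then show False using k by (simp add: K_def)
  qed
  then obtain i j where ij: "i \<in> K" "j \<in> K" "i \<noteq> j" by blast
  have cop: "coprime (N i) (N j)" using N ij by (auto simp: weights_def pairwise_def)
  \<comment> \<open>Coprime weights turn triviality of u^2 on two coordinates into u^2 = 1. Both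
    contradictions below run through this.\<close>
  have sq1: "u\<^sup>2 = 1" if "\<And>k. k \<in> K \<Longrightarrow> (u\<^sup>2) ^ N k = 1"
    using coprime_powers_eq_1[OF that[OF ij(1)] that[OF ij(2)] cop] .
  from stabilizer_cases[OF V n u(1)] show ?thesis
  proof
    assume "\<exists>c. cmod c = 1 \<and> (\<forall>k. u ^ N k * p k = c * p k \<and> u ^ N k * q k = cnj c * q k)"
    then obtain c where c: "cmod c = 1" "\<And>k. u ^ N k * p k = c * p k" "\<And>k. u ^ N k * q k = cnj c * q k"
      by blast
    have cc: "c * cnj c = 1" using c(1) by (simp add: complex_norm_square[symmetric])
    show ?thesis
    proof (rule ccontr)
      assume "\<not> ?thesis"
      \<comment> \<open>A coordinate with both entries nonzero makes the rotation number real, so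
        its square is 1 and u^2 acts trivially on all active coordinates.\<close>
      then have "u ^ N k = c" "u ^ N k = cnj c" using c(2,3)[of k] by auto
      then have c_real: "c = cnj c" by simp
      then have c2: "c ^ 2 = 1" using cc by (simp add: power2_eq_square)
      have "(u\<^sup>2) ^ N l = 1" if "l \<in> K" for l
      proof -
        have "u ^ N l = c" using c(2,3)[of l] that c_real by (auto simp: K_def)
        then show ?thesis using c2 by (simp add: power_mult[symmetric] mult.commute) (simp add: power_mult)
      qed
      then show False using sq1 u(2) by blast
    qed
  next
    assume "\<exists>d. cmod d = 1 \<and> (\<forall>k. u ^ N k * p k = cnj d * q k \<and> u ^ N k * q k = d * p k)"
    then obtain d where d: "cmod d = 1" "\<And>k. u ^ N k * p k = cnj d * q k" "\<And>k. u ^ N k * q k = d * p k"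
      by blast
    have dd: "cnj d * d = 1" using d(1) by (simp add: complex_norm_square[symmetric] mult.commute)
    \<comment> \<open>A reflection squares to the identity.\<close>
    have "(u\<^sup>2) ^ N l = 1" if "l \<in> K" for l
    proof -
      have e: "(u\<^sup>2) ^ N l = u ^ N l * u ^ N l" by (simp add: power2_eq_square power_mult_distrib)
      have "(u\<^sup>2) ^ N l * p l = u ^ N l * (u ^ N l * p l)" by (simp add: e)
      also have "\<dots> = cnj d * (u ^ N l * q l)" unfolding d(2) by (simp add: mult_ac)
      also have "\<dots> = (cnj d * d) * p l" unfolding d(3) by (simp add: mult_ac)
      finally have 1: "(u\<^sup>2) ^ N l * p l = 1 * p l" unfolding dd .
      have "(u\<^sup>2) ^ N l * q l = u ^ N l * (u ^ N l * q l)" by (simp add: e)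
      also have "\<dots> = d * (u ^ N l * p l)" unfolding d(3) by (simp add: mult_ac)
      also have "\<dots> = (cnj d * d) * q l" unfolding d(2) by (simp add: mult_ac)
      finally have 2: "(u\<^sup>2) ^ N l * q l = 1 * q l" unfolding dd .
      show ?thesis using 1 2 that by (auto simp: K_def)
    qed
    then show ?thesis using sq1 u(2) by blast
  qed
qed

text \<open>Equal weighted norms prevent p or q from vanishing alone, and normalization prevents
  both from vanishing.\<close>

lemma disjoint_support_witnesses:
  assumes N: "weights N" and
    n: "(\<Sum>k\<in>UNIV. (cmod (p k))\<^sup>2 + (cmod (q k))\<^sup>2) = 1"
    and h: "(\<Sum>k\<in>UNIV. real (N k) * (cmod (p k))\<^sup>2) = (\<Sum>k\<in>UNIV. real (N k) * (cmod (q k))\<^sup>2)"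
    and dis: "\<And>k. p k = 0 \<or> q k = 0"
  obtains i j where "i \<noteq> j" "p i \<noteq> 0" "q j \<noteq> 0" "q i = 0" "p j = 0"
proof -
  have pos: "N k > 0" for k by (rule weights_pos[OF N])
  have s0: "(\<Sum>k\<in>UNIV. real (N k) * (cmod (f k))\<^sup>2) = 0 \<longleftrightarrow> (\<forall>k. f k = 0)" for f :: "'a \<Rightarrow> complex"
    by (subst sum_nonneg_eq_0_iff) (auto simp: neq0_conv[THEN iffD2, OF pos])
  have "\<not> ((\<forall>k. p k = 0) \<and> (\<forall>k. q k = 0))"
  proof
    assume "(\<forall>k. p k = 0) \<and> (\<forall>k. q k = 0)"
    then have "(\<Sum>k\<in>UNIV. (cmod (p k))\<^sup>2 + (cmod (q k))\<^sup>2) = 0" by simp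
    with n show False by simp
  qed
  then have "\<not> (\<forall>k. p k = 0)" "\<not> (\<forall>k. q k = 0)" using s0[of p] s0[of q] h by auto
  then obtain i j where "p i \<noteq> 0" "q j \<noteq> 0" by blast
  moreover have "q i = 0" "p j = 0" "i \<noteq> j" using calculation dis by auto
  ultimately show thesis using that by blast
qed

text \<open>A reflection would carry the nonzero entry p_i to a multiple of q_i = 0, so only
  rotations remain. They act by one number on the support of p and by its conjugate on the support
  of q.\<close>

lemma disjoint_support_stabilizer:
  assumes V: "V = range (plane_point p q)" and
    n: "(\<Sum>k\<in>UNIV. (cmod (p k))\<^sup>2 + (cmod (q k))\<^sup>2) = 1" "(\<Sum>k\<in>UNIV. p k * cnj (q k)) = 0"
    and dis: "\<And>k. p k = 0 \<or> q k = 0" and i: "p i \<noteq> 0" and u: "u \<in> stabilizer N V"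
  obtains c where "\<And>k. p k \<noteq> 0 \<Longrightarrow> u ^ N k = c" "\<And>k. q k \<noteq> 0 \<Longrightarrow> u ^ N k = cnj c"
proof -
  have u0: "u \<noteq> 0" using u by (auto simp: stabilizer_def)
  from stabilizer_cases[OF V n u] show thesis
  proof
    assume "\<exists>c. cmod c = 1 \<and> (\<forall>k. u ^ N k * p k = c * p k \<and> u ^ N k * q k = cnj c * q k)"
    then obtain c where "\<forall>k. u ^ N k * p k = c * p k \<and> u ^ N k * q k = cnj c * q k" by blast
    then show thesis by (intro that[of c]) auto
  next
    assume "\<exists>d. cmod d = 1 \<and> (\<forall>k. u ^ N k * p k = cnj d * q k \<and> u ^ N k * q k = d * p k)"
    then obtain d where "u ^ N i * p i = cnj d * q i" by blast
    then show thesis using i dis[of i] u0 by auto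
  qed
qed

text \<open>The points have z_i = \<zeta> p_i and z_j = cnj \<zeta> q_j; eliminating \<zeta> gives
  the slope, and horizontality fixes its modulus.\<close>

lemma disjoint_support_gamma_plane:
  assumes V: "V = range (plane_point p q)"
    and h: "(\<Sum>k\<in>UNIV. real (N k) * (cmod (p k))\<^sup>2) = (\<Sum>k\<in>UNIV. real (N k) * (cmod (q k))\<^sup>2)"
    and ij: "i \<noteq> j" "p i \<noteq> 0" "q j \<noteq> 0" "q i = 0" "p j = 0"
    and z: "\<And>k. k \<noteq> i \<Longrightarrow> k \<noteq> j \<Longrightarrow> p k = 0 \<and> q k = 0" and "N j > 0"
  obtains c where "V = gamma_plane i j c" "(cmod c)\<^sup>2 = real (N i) / real (N j)"
proof
  let ?c = "q j / cnj (p i)"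
  have "(\<Sum>l\<in>UNIV. real (N l) * (cmod (p l))\<^sup>2) = real (N i) * (cmod (p i))\<^sup>2"
    "(\<Sum>l\<in>UNIV. real (N l) * (cmod (q l))\<^sup>2) = real (N j) * (cmod (q j))\<^sup>2"
    using z ij by (subst sum.mono_neutral_right[of UNIV "{i}"] sum.mono_neutral_right[of UNIV "{j}"]; force)+
  then have "real (N i) * (cmod (p i))\<^sup>2 = real (N j) * (cmod (q j))\<^sup>2" using h by simp
  then show "(cmod ?c)\<^sup>2 = real (N i) / real (N j)"
    using ij \<open>N j > 0\<close> by (simp add: norm_divide power_divide field_simps)
  show "V = gamma_plane i j ?c"
  proof (intro equalityI subsetI)
    fix y assume "y \<in> V"
    then obtain \<zeta> where "y = plane_point p q \<zeta>" using V by blast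
    then show "y \<in> gamma_plane i j ?c" using ij z by (auto simp: gamma_plane_def plane_point_def)
  next
    fix y assume y: "y \<in> gamma_plane i j ?c"
    have "y = plane_point p q (y $ i / p i)"
      unfolding vec_eq_iff
    proof
      fix k
      show "y $ k = plane_point p q (y $ i / p i) $ k"
        using y ij z[of k] by (cases "k = i"; cases "k = j") (auto simp: gamma_plane_def plane_point_def)
    qed
    then show "y \<in> V" unfolding V by (rule range_eqI)
  qed
qed

lemma card_roots_unity_subset:
  assumes "A \<subseteq> {u::complex. u ^ n = 1}" "n > 0"
  shows "finite A" "card A \<le> n"
proof -
  have f: "finite {u::complex. u ^ n = 1}" using assms(2) by (intro finite_roots_unity) simp
  show "finite A" using finite_subset[OF assms(1) f] .
  show "card A \<le> n" using card_mono[OF f assms(1)] card_roots_unity_eq[OF assms(2)] by simp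
qed

lemma horizontal_plane_stabilizer_cases:
  assumes N: "weights N" and hor: "horizontal_plane N V"
  shows "(\<exists>i j c. i \<noteq> j \<and> V = gamma_plane i j c \<and> (cmod c)\<^sup>2 = real (N i) / real (N j)) \<or>
    finite (stabilizer N V) \<and> (card (stabilizer N V) \<le> 2 \<or>
      (\<exists>k l. N l < N k \<and> card (stabilizer N V) \<le> N k - N l))"
proof -
  obtain p q where V: "V = range (plane_point p q)" and
    n: "(\<Sum>k\<in>UNIV. (cmod (p k))\<^sup>2 + (cmod (q k))\<^sup>2) = 1" "(\<Sum>k\<in>UNIV. p k * cnj (q k)) = 0" and
    h: "(\<Sum>k\<in>UNIV. real (N k) * (cmod (p k))\<^sup>2) = (\<Sum>k\<in>UNIV. real (N k) * (cmod (q k))\<^sup>2)"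
    by (rule horizontal_plane_plane_point[OF hor])
  have pos: "N k > 0" for k by (rule weights_pos[OF N])
  show ?thesis
  proof (cases "\<exists>u\<in>stabilizer N V. u\<^sup>2 \<noteq> 1")
    case False
    then have "stabilizer N V \<subseteq> {u. u ^ 2 = 1}" by auto
    from card_roots_unity_subset[OF this] show ?thesis by simp
  next
    case True
    then have dis: "p k = 0 \<or> q k = 0" for k
      using large_stabilizer_disjoint_support[OF N V n h] by blast
    obtain i j where ij: "i \<noteq> j" "p i \<noteq> 0" "q j \<noteq> 0" "q i = 0" "p j = 0"
      by (rule disjoint_support_witnesses[OF N n(1) h dis])
    have neq: "N k \<noteq> N l" if "k \<noteq> l" for k l
      using weights_inj[OF N] that by (auto dest: injD)
    have diff: ?thesis if kl: "k \<noteq> l" "\<And>u. u \<in> stabilizer N V \<Longrightarrow> u ^ N k = u ^ N l" for k l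
    proof -
      have main: ?thesis if kl: "N l < N k" "\<And>u. u \<in> stabilizer N V \<Longrightarrow> u ^ N k = u ^ N l" for k l
      proof -
        have "u ^ (N k - N l) = 1" if u: "u \<in> stabilizer N V" for u
        proof -
          have "u \<noteq> 0" using u by (auto simp: stabilizer_def)
          moreover have "u ^ N l * u ^ (N k - N l) = u ^ N l * 1"
            using kl(1) kl(2)[OF u] by (simp flip: power_add)
          ultimately show ?thesis by simp
        qed
        then have "stabilizer N V \<subseteq> {u. u ^ (N k - N l) = 1}" by blast
        from card_roots_unity_subset[OF this] show ?thesis using kl(1) by auto
      qed
      show ?thesis using main[of l k] main[of k l] kl neq[OF kl(1)] by (metis linorder_neqE_nat)
    qed
    show ?thesis
    proof (cases "\<forall>k. k \<noteq> i \<longrightarrow> k \<noteq> j \<longrightarrow> p k = 0 \<and> q k = 0")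
      case True
      then show ?thesis
        using disjoint_support_gamma_plane[OF V h ij _ pos[of j]] ij(1) by metis
    next
      case False
      then obtain k where k: "k \<noteq> i" "k \<noteq> j" "p k \<noteq> 0 \<or> q k \<noteq> 0" by blast
      \<comment> \<open>A third active index lies in the support of p together with
        \<open>i\<close>, or in that of q together with \<open>j\<close>, so \<open>u\<close> acts
        on both coordinates by the same number.\<close>
      have "u ^ N k = u ^ N (if p k \<noteq> 0 then i else j)" if "u \<in> stabilizer N V" for u
      proof -
        obtain c where "\<And>k. p k \<noteq> 0 \<Longrightarrow> u ^ N k = c" "\<And>k. q k \<noteq> 0 \<Longrightarrow> u ^ N k = cnj c"
          using disjoint_support_stabilizer[OF V n dis ij(2) \<open>u \<in> _\<close>] by metis
        then show ?thesis using k ij by auto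
      qed
      then show ?thesis using k by (intro diff[of k "if p k \<noteq> 0 then i else j"]) auto
    qed
  qed
qed

section \<open>The planes of the geodesics gamma\<close>

lemma stabilizer_gamma_plane:
  assumes "i \<noteq> j" "c \<noteq> 0" "N i + N j > 0"
  shows "card (stabilizer N (gamma_plane i j c)) = N i + N j"
proof -
  have inj: "b = b'" if "gamma_plane i j b = gamma_plane i j b'" for b b'
  proof -
    have "(\<chi> k. if k = i then 1 else if k = j then b else 0) \<in> gamma_plane i j b"
      using assms(1) by (auto simp: gamma_plane_def)
    then have "(\<chi> k. if k = i then 1 else if k = j then b else 0) \<in> gamma_plane i j b'"
      using that by simp
    then show ?thesis using assms(1) by (auto simp: gamma_plane_def)
  qed
  \<comment> \<open>The action multiplies the slope by u^(N i + N j), and the slope determines the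
    plane.\<close>
  have "stabilizer N (gamma_plane i j c) = {u. u ^ (N i + N j) = 1}"
  proof (intro equalityI subsetI)
    fix u assume "u \<in> stabilizer N (gamma_plane i j c)"
    then have "gamma_plane i j (u ^ (N i + N j) * c) = gamma_plane i j c"
      using circle_act_gamma_plane[of u N i j c] by (auto simp: stabilizer_def)
    then have "u ^ (N i + N j) * c = c" by (rule inj)
    then show "u \<in> {u. u ^ (N i + N j) = 1}" using assms(2) by simp
  next
    fix u assume u: "u \<in> {u :: complex. u ^ (N i + N j) = 1}"
    then have "cmod u = 1" using assms(3) power_eq_1_iff[of u "N i + N j"] by auto
    then show "u \<in> stabilizer N (gamma_plane i j c)"
      using circle_act_gamma_plane[of u N i j c] u by (simp add: stabilizer_def)
  qed
  then show ?thesis using card_roots_unity_eq[OF assms(3)] by simp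
qed

lemma horizontal_gamma_plane:
  assumes "i \<noteq> j" "N j > 0" and c: "(cmod c)\<^sup>2 = real (N i) / real (N j)"
  shows "horizontal_plane N (gamma_plane i j c)"
proof -
  define F where "F = (\<lambda>\<zeta>::complex. \<chi> k. if k = i then \<zeta> else if k = j then c * cnj \<zeta> else 0)"
  have F: "range F = gamma_plane i j c"
  proof (intro equalityI subsetI)
    fix z assume z: "z \<in> gamma_plane i j c"
    have "z = F (z $ i)" using z \<open>i \<noteq> j\<close> by (auto simp: vec_eq_iff F_def gamma_plane_def)
    then show "z \<in> range F" by (rule range_eqI)
  qed (use \<open>i \<noteq> j\<close> in \<open>auto simp: F_def gamma_plane_def\<close>)
  have lin: "linear F"
    by (intro linearI) (auto simp: F_def vec_eq_iff algebra_simps)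
  have "inj F"
  proof (rule injI)
    fix x y assume "F x = F y"
    then have "F x $ i = F y $ i" by simp
    then show "x = y" by (simp add: F_def)
  qed
  then have "dim (gamma_plane i j c) = dim (UNIV :: complex set)"
    unfolding F[symmetric] using lin by (intro dim_image_eq) (auto intro: inj_on_subset)
  then have "dim (gamma_plane i j c) = 2" by simp
  moreover have "subspace (gamma_plane i j c)"
    unfolding F[symmetric] using lin by (intro linear_subspace_image) auto
  moreover have "inner v (orbit_velocity N z) = 0"
    if "v \<in> gamma_plane i j c" "z \<in> gamma_plane i j c" for v z
  proof -
    have zero: "z $ k = 0" if "k \<notin> {i, j}" for k
      using that \<open>z \<in> gamma_plane i j c\<close> by (simp add: gamma_plane_def)
    have vz: "v $ j = c * cnj (v $ i)" "z $ j = c * cnj (z $ i)" using that by (simp_all add: gamma_plane_def)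
    have "v $ j * cnj (z $ j) = of_real ((cmod c)\<^sup>2) * cnj (v $ i * cnj (z $ i))"
      unfolding vz complex_norm_square by (simp add: mult_ac)
    then have vj: "Im (v $ j * cnj (z $ j)) = - ((cmod c)\<^sup>2 * Im (v $ i * cnj (z $ i)))" by (simp add: algebra_simps)
    have "inner v (orbit_velocity N z) = (\<Sum>k\<in>{i, j}. real (N k) * Im (v $ k * cnj (z $ k)))"
      unfolding inner_orbit_velocity using zero by (intro sum.mono_neutral_right) auto
    also have "\<dots> = real (N i) * Im (v $ i * cnj (z $ i)) + real (N j) * Im (v $ j * cnj (z $ j))"
      using \<open>i \<noteq> j\<close> by (subst sum.insert) simp_all
    also have "\<dots> = 0"
    proof -
      have "real (N i) * X + real (N j) * - (real (N i) / real (N j) * X) = 0" for X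
        using \<open>N j > 0\<close> by simp
      then show ?thesis unfolding vj c .
    qed
    finally show ?thesis .
  qed
  ultimately show ?thesis unfolding horizontal_plane_def by auto
qed

lemma self_in_orbit: "z \<in> orbit N z"
  unfolding orbit_def by (rule image_eqI[of _ _ 1]) (simp_all add: circle_act_1)

text \<open>The action changes coordinates only by phases, so the moduli of the coordinates can be
  recovered from the image in the quotient.\<close>

lemma circle_image_subset_norms:
  assumes "circle_image N V = circle_image N W" "z \<in> V" "norm z = 1"
  obtains w where "w \<in> W" "norm w = 1" "\<And>k. cmod (z $ k) = cmod (w $ k)"
proof -
  have "orbit N z \<in> circle_image N W"
    unfolding assms(1)[symmetric] unfolding circle_image_def using assms(2,3) by auto
  then obtain w where w: "w \<in> W" "norm w = 1" "orbit N z = orbit N w" by (auto simp: circle_image_def)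
  then have "z \<in> orbit N w" using self_in_orbit[of z N] by simp
  then obtain u where "cmod u = 1" "z = circle_act N u w" by (auto simp: orbit_def)
  then have "cmod (z $ k) = cmod (w $ k)" for k by (simp add: circle_act_def norm_mult norm_power)
  then show thesis using that w by blast
qed

lemma gamma_plane_swap:
  assumes "c \<noteq> 0" "i \<noteq> j"
  shows "gamma_plane i j c = gamma_plane j i (inverse (cnj c))"
proof -
  have "a = c * cnj b \<longleftrightarrow> b = inverse (cnj c) * cnj a" for a b
    using \<open>c \<noteq> 0\<close> by (auto simp flip: mult.assoc)
  then show ?thesis unfolding gamma_plane_def by blast
qed

lemma gamma_swap:
  assumes N: "weights N" and "i \<noteq> j"
  shows "gamma N i j = gamma N j i"
proof -
  have pos: "N k > 0" for k by (rule weights_pos[OF N])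
  let ?c = "complex_of_real (sqrt (real (N i) / real (N j)))"
  have c0: "?c \<noteq> 0" using pos[of i] pos[of j] by simp
  have "gamma N i j = circle_image N (gamma_plane j i (inverse (cnj ?c)))"
    unfolding gamma_def using gamma_plane_swap[OF c0 \<open>i \<noteq> j\<close>] by simp
  also have "\<dots> = gamma N j i"
    by (rule circle_image_gamma_plane[OF N]) (simp add: norm_inverse power_inverse)
  finally show ?thesis .
qed

text \<open>A length is attached to every plane that represents the geodesic, so all these planes
  must be controlled, not only the defining one. Moduli suffice: on the unit circle of
  \<open>V\<close> the values |z_j|^2 and |z_i|^2 have a constant ratio, which kills their parts
  oscillating with \<zeta>^2.\<close>

lemma gamma_plane_of_circle_image:
  assumes N: "weights N" and hor: "horizontal_plane N V" and "i \<noteq> j"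
    and V: "circle_image N V = gamma N i j"
  obtains k l c where "{k, l} = {i, j}" "k \<noteq> l" "V = gamma_plane k l c" "c \<noteq> 0"
proof -
  obtain p q where Vpq: "V = range (plane_point p q)" and
    n: "(\<Sum>k\<in>UNIV. (cmod (p k))\<^sup>2 + (cmod (q k))\<^sup>2) = 1" "(\<Sum>k\<in>UNIV. p k * cnj (q k)) = 0" and
    h: "(\<Sum>k\<in>UNIV. real (N k) * (cmod (p k))\<^sup>2) = (\<Sum>k\<in>UNIV. real (N k) * (cmod (q k))\<^sup>2)"
    by (rule horizontal_plane_plane_point[OF hor])
  have pos: "N k > 0" for k by (rule weights_pos[OF N])
  define r where "r = real (N i) / real (N j)"
  have r: "r > 0" using pos by (simp add: r_def)
  have pt: "(\<forall>k. k \<noteq> i \<longrightarrow> k \<noteq> j \<longrightarrow> \<zeta> * p k + cnj \<zeta> * q k = 0) \<and>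
      (cmod (\<zeta> * p j + cnj \<zeta> * q j))\<^sup>2 = r * (cmod (\<zeta> * p i + cnj \<zeta> * q i))\<^sup>2"
    if \<zeta>: "cmod \<zeta> = 1" for \<zeta>
  proof -
    have "(norm (plane_point p q \<zeta>))\<^sup>2 = 1\<^sup>2" using norm_plane_point[of p q \<zeta>] n \<zeta> by simp
    then have "norm (plane_point p q \<zeta>) = 1" by (simp only: power2_eq_iff_nonneg norm_ge_zero zero_le_one)
    moreover have "plane_point p q \<zeta> \<in> V" using Vpq by blast
    ultimately obtain w where w: "w \<in> gamma_plane i j (complex_of_real (sqrt r))"
      "\<And>k. cmod (plane_point p q \<zeta> $ k) = cmod (w $ k)"
      using circle_image_subset_norms[OF V[unfolded gamma_def]] unfolding r_def by metis
    have "w $ k = 0" if "k \<noteq> i" "k \<noteq> j" for k using w(1) that by (simp add: gamma_plane_def)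
    then have 1: "plane_point p q \<zeta> $ k = 0" if "k \<noteq> i" "k \<noteq> j" for k using w(2)[of k] that by simp
    have "cmod (w $ j) = sqrt r * cmod (w $ i)" using w(1) r by (simp add: gamma_plane_def norm_mult)
    then have 2: "(cmod (plane_point p q \<zeta> $ j))\<^sup>2 = r * (cmod (plane_point p q \<zeta> $ i))\<^sup>2"
      unfolding w(2) using r by (simp add: power_mult_distrib)
    show ?thesis using 1 2 by (simp add: plane_point_def)
  qed
  have z: "p k = 0 \<and> q k = 0" if "k \<noteq> i" "k \<noteq> j" for k
  proof -
    have "p k + q k = 0" "\<i> * p k - \<i> * q k = 0" using pt[of 1] pt[of \<i>] that by simp_all
    then have "p k = q k" by simp
    then show ?thesis using \<open>p k + q k = 0\<close> by simp
  qed
  have sq: "(cmod (\<zeta> * p k + cnj \<zeta> * q k))\<^sup>2 =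
      (cmod (p k))\<^sup>2 + (cmod (q k))\<^sup>2 + 2 * Re (\<zeta>\<^sup>2 * (p k * cnj (q k)))" if "cmod \<zeta> = 1" for \<zeta> k
  proof -
    have "(cmod (\<zeta> * p k + cnj \<zeta> * q k))\<^sup>2 =
      (cmod \<zeta>)\<^sup>2 * ((cmod (p k))\<^sup>2 + (cmod (q k))\<^sup>2) + 2 * Re (\<zeta>\<^sup>2 * (p k * cnj (q k)))"
      unfolding cmod_power2 by (simp add: power2_eq_square algebra_simps)
    then show ?thesis using that by simp
  qed
  define a b where "a = p i * cnj (q i)" and "b = p j * cnj (q j)"
  have "(\<Sum>k\<in>UNIV. p k * cnj (q k)) = (\<Sum>k\<in>{i, j}. p k * cnj (q k))"
    using z by (intro sum.mono_neutral_right) auto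
  also have "\<dots> = a + b" using \<open>i \<noteq> j\<close> by (simp add: a_def b_def)
  finally have ab: "b = - a" using n(2) by (simp add: eq_neg_iff_add_eq_0 add.commute)
  define s t where "s = (cmod (p i))\<^sup>2 + (cmod (q i))\<^sup>2" and "t = (cmod (p j))\<^sup>2 + (cmod (q j))\<^sup>2"
  have key: "t - 2 * Re (\<zeta>\<^sup>2 * a) = r * (s + 2 * Re (\<zeta>\<^sup>2 * a))" if "cmod \<zeta> = 1" for \<zeta>
  proof -
    have "t + 2 * Re (\<zeta>\<^sup>2 * b) = r * (s + 2 * Re (\<zeta>\<^sup>2 * a))"
      using conjunct2[OF pt[OF that]] unfolding sq[OF that] by (simp only: a_def b_def s_def t_def)
    then show ?thesis by (simp add: ab)
  qed
  \<comment> \<open>The test parameters here and below have \<zeta>^2 = 1, -1, \<i>, -\<i>; opposite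
    values are subtracted.\<close>
  have "t - 2 * Re a = r * (s + 2 * Re a)" "t + 2 * Re a = r * (s - 2 * Re a)"
    using key[of 1] key[of \<i>] by simp_all
  then have "(1 + r) * (4 * Re a) = 0" by (simp add: algebra_simps)
  then have Rea: "Re a = 0" using r by simp
  have c4: "(cis (pi / 4))\<^sup>2 = \<i>" "(cis (- pi / 4))\<^sup>2 = - \<i>"
    unfolding power2_eq_square cis_mult by (simp_all add: complex_eq_iff)
  have "t + 2 * Im a = r * (s - 2 * Im a)" "t - 2 * Im a = r * (s + 2 * Im a)"
    using key[of "cis (pi / 4)"] key[of "cis (- pi / 4)"] unfolding c4 by simp_all
  then have "(1 + r) * (4 * Im a) = 0" by (simp add: algebra_simps)
  then have "Im a = 0" using r by simp
  then have a0: "a = 0" "b = 0" using Rea ab by (simp_all add: complex_eq_iff)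
  have dis: "p k = 0 \<or> q k = 0" for k
    using a0 z[of k] by (cases "k = i"; cases "k = j") (auto simp: a_def b_def)
  obtain k l where kl: "k \<noteq> l" "p k \<noteq> 0" "q l \<noteq> 0" "q k = 0" "p l = 0"
    by (rule disjoint_support_witnesses[OF N n(1) h dis])
  have kl': "{k, l} = {i, j}" using kl z[of k] z[of l] by auto
  have "p m = 0 \<and> q m = 0" if "m \<noteq> k" "m \<noteq> l" for m using z[of m] kl' that by auto
  then obtain c where c: "V = gamma_plane k l c" "(cmod c)\<^sup>2 = real (N k) / real (N l)"
    using disjoint_support_gamma_plane[OF Vpq h kl _ pos[of l]] by metis
  have "c \<noteq> 0" using c(2) pos[of k] pos[of l] by auto
  then show thesis using that kl' kl(1) c(1) by blast
qed

text \<open>A point of the first circle at which both coordinates are nonzero has the same moduli as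
  a point of the second, which reveals the pair of indices.\<close>

lemma gamma_eq_imp:
  assumes N: "weights N" and "i \<noteq> j" "k \<noteq> l" and eq: "gamma N i j = gamma N k l"
  shows "{i, j} = {k, l}"
proof -
  have pos: "N k > 0" for k by (rule weights_pos[OF N])
  let ?c = "complex_of_real (sqrt (real (N i) / real (N j)))"
  define z :: "complex ^ 'a" where "z = (\<chi> m. if m = i then 1 else if m = j then ?c else 0)"
  define y where "y = z /\<^sub>R norm z"
  have zi: "z $ i = 1" "z $ j \<noteq> 0" using pos \<open>i \<noteq> j\<close> by (auto simp: z_def)
  then have "z \<noteq> 0" by auto
  then have y1: "norm y = 1" "y $ i \<noteq> 0" "y $ j \<noteq> 0" using zi by (auto simp: y_def)
  have yk: "y $ k = of_real (inverse (norm z)) * z $ k" for k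
    by (simp add: y_def) (simp add: scaleR_conv_of_real)
  have "y \<in> gamma_plane i j ?c" using \<open>i \<noteq> j\<close> by (auto simp: gamma_plane_def yk) (auto simp: z_def)
  then obtain w where w: "w \<in> gamma_plane k l (complex_of_real (sqrt (real (N k) / real (N l))))"
    "\<And>m. cmod (y $ m) = cmod (w $ m)"
    using circle_image_subset_norms[OF eq[unfolded gamma_def] _ y1(1)] by metis
  have "w $ i \<noteq> 0" "w $ j \<noteq> 0" using w(2)[of i] w(2)[of j] y1 by auto
  then have "i \<in> {k, l}" "j \<in> {k, l}" using w(1) by (auto simp: gamma_plane_def)
  then show ?thesis using \<open>i \<noteq> j\<close> by auto
qed

lemma card_less_pairs: "card {(i::'n::{finite,linorder}, j). i < j} = CARD('n) choose 2"
proof -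
  have "bij_betw (\<lambda>(i, j). {i, j}) {(i::'n, j). i < j} {A. card A = 2}"
  proof (intro bij_betwI')
    fix x y :: "'n \<times> 'n"
    assume "x \<in> {(i, j). i < j}" "y \<in> {(i, j). i < j}"
    then show "((case x of (i, j) \<Rightarrow> {i, j}) = (case y of (i, j) \<Rightarrow> {i, j})) = (x = y)"
      by (auto simp: doubleton_eq_iff)
  next
    fix x :: "'n \<times> 'n"
    assume "x \<in> {(i, j). i < j}"
    then show "(case x of (i, j) \<Rightarrow> {i, j}) \<in> {A. card A = 2}" by auto
  next
    fix A :: "'n set" assume "A \<in> {A. card A = 2}"
    then obtain i j where ij: "A = {i, j}" "i \<noteq> j" by (auto simp: card_2_iff)
    have "(min i j, max i j) \<in> {(i, j). i < j}" using ij by (auto simp: min_def max_def)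
    moreover have "A = (case (min i j, max i j) of (i, j) \<Rightarrow> {i, j})" using ij by (auto simp: min_def max_def)
    ultimately show "\<exists>x\<in>{(i, j). i < j}. A = (case x of (i, j) \<Rightarrow> {i, j})" by blast
  qed
  then show ?thesis
    using n_subsets[of "UNIV :: 'n set" 2] by (simp add: bij_betw_same_card)
qed

lemma card_gamma:
  fixes N :: "'n::{finite,linorder} \<Rightarrow> nat"
  assumes N: "weights N"
  shows "card {gamma N i j | i j. i < j} = CARD('n) choose 2"
proof -
  have "{gamma N i j | i j. i < j} = (\<lambda>(i, j). gamma N i j) ` {(i, j). i < j}" by auto
  moreover have "inj_on (\<lambda>(i, j). gamma N i j) {(i, j). i < j}"
  proof (rule inj_onI, clarify)
    fix i j k l :: 'n assume ij: "i < j" "k < l" "gamma N i j = gamma N k l"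
    then have "{i, j} = {k, l}" by (intro gamma_eq_imp[OF N]) auto
    then show "i = k \<and> j = l" using ij by (auto simp: doubleton_eq_iff)
  qed
  ultimately show ?thesis using card_less_pairs by (simp add: card_image)
qed

theorem gamma_are_shortest_geodesics:
  fixes N :: "'n::{finite,linorder} \<Rightarrow> nat"
  assumes N: "weights N" and bound: "\<And>i j. N j \<le> 2 * N i"
  shows "are_shortest_geodesics N {gamma N i j | i j. i < j}"
proof -
  let ?G = "{gamma N i j | i j. i < j}"
  have N1: "N k > 1" for k using N by (simp add: weights_def)
  have pos: "N k > 0" for k using N1[of k] by simp
  have in_G: "gamma N i j \<in> ?G" if "i \<noteq> j" for i j
    using gamma_swap[OF N that] that by (cases "i < j") (auto simp: not_less_iff_gr_or_eq)
  have ex: "\<exists>l. geodesic_of_length N (gamma N i j) l" if "i < j" for i j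
    unfolding geodesic_of_length_def gamma_def
    using horizontal_gamma_plane[of i j N "complex_of_real (sqrt (real (N i) / real (N j)))"] that pos
    by auto
  have lt: "l < l'"
    if g: "g \<in> ?G" "geodesic_of_length N g l" and h: "h \<notin> ?G" "geodesic_of_length N h l'" for g l h l'
  proof -
    obtain i j where "i < j" and gij: "g = gamma N i j" using g(1) unfolding mem_Collect_eq by (elim exE conjE)
    then have ij: "i \<noteq> j" "g = gamma N i j" by simp_all
    obtain V where V: "horizontal_plane N V" "circle_image N V = gamma N i j"
      "l = 2 * pi / real (card (stabilizer N V))" using g(2) ij by (auto simp: geodesic_of_length_def)
    obtain a b c where abc: "{a, b} = {i, j}" "a \<noteq> b" "V = gamma_plane a b c" "c \<noteq> 0"
      by (rule gamma_plane_of_circle_image[OF N V(1) ij(1) V(2)])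
    have l: "l = 2 * pi / real (N a + N b)"
      using stabilizer_gamma_plane[OF abc(2,4), of N] pos[of a] V(3) abc(3) by simp
    obtain W where W: "horizontal_plane N W" "h = circle_image N W"
      "l' = 2 * pi / real (card (stabilizer N W))" using h(2) by (auto simp: geodesic_of_length_def)
    have "\<not> (\<exists>i j c. i \<noteq> j \<and> W = gamma_plane i j c \<and> (cmod c)\<^sup>2 = real (N i) / real (N j))"
    proof
      assume "\<exists>i j c. i \<noteq> j \<and> W = gamma_plane i j c \<and> (cmod c)\<^sup>2 = real (N i) / real (N j)"
      then obtain i j c where "i \<noteq> j" and e: "W = gamma_plane i j c" "(cmod c)\<^sup>2 = real (N i) / real (N j)"
        by blast
      have "h = gamma N i j" unfolding W(2) e(1) by (rule circle_image_gamma_plane[OF N e(2)])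
      then have "h \<in> ?G" using in_G[OF \<open>i \<noteq> j\<close>] by simp
      then show False using h(1) by contradiction
    qed
    then have fin: "finite (stabilizer N W)" and c: "card (stabilizer N W) \<le> 2 \<or>
      (\<exists>k l. N l < N k \<and> card (stabilizer N W) \<le> N k - N l)"
      using horizontal_plane_stabilizer_cases[OF N W(1)] by blast+
    have lt: "card (stabilizer N W) < N a + N b"
      using c
    proof
      assume "card (stabilizer N W) \<le> 2"
      then show ?thesis using N1[of a] N1[of b] by simp
    next
      assume "\<exists>k l. N l < N k \<and> card (stabilizer N W) \<le> N k - N l"
      then obtain k l where "N l < N k" "card (stabilizer N W) \<le> N k - N l" by blast
      \<comment> \<open>Averaging the two bounds gives N k at most N a + N b, and subtracting the
        positive N l makes the inequality strict.\<close>
      moreover have "N k \<le> 2 * N a" "N k \<le> 2 * N b" "N l > 0" using bound pos by auto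
      ultimately show ?thesis by simp
    qed
    \<comment> \<open>Cardinality 0 would turn the length into 0 by the convention for division; the
      finite stabilizer contains 1.\<close>
    have "1 \<in> stabilizer N W" by (simp add: stabilizer_def circle_act_1)
    then have "card (stabilizer N W) > 0" using fin card_gt_0_iff by blast
    then show "l < l'" unfolding l W(3) using lt pos[of a] by (intro divide_strict_left_mono) auto
  qed
  show ?thesis unfolding are_shortest_geodesics_def
  proof (intro conjI ballI allI impI)
    fix g assume "g \<in> ?G"
    then obtain i j where "g = gamma N i j" "i < j" unfolding mem_Collect_eq by (elim exE conjE)
    then show "\<exists>l. geodesic_of_length N g l" using ex by simp
  qed (elim conjE, rule lt)
qed

section \<open>Integration over the sphere\<close>

lemma integrable_continuous_compact_support:
  fixes h :: "'a::euclidean_space \<Rightarrow> 'b::{banach, second_countable_topology}"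
  assumes "continuous_on UNIV h" "\<And>x. norm x > R \<Longrightarrow> h x = 0"
  shows "integrable lborel h"
proof -
  have "integrable lborel (\<lambda>x. indicator (cball 0 R) x *\<^sub>R h x)"
    using assms(1) by (intro borel_integrable_compact) (auto intro: continuous_on_subset)
  moreover have "(\<lambda>x. indicator (cball 0 R) x *\<^sub>R h x) = h"
    using assms(2) by (auto simp: fun_eq_iff indicator_def not_le)
  ultimately show ?thesis by simp
qed

lemma lborel_integral_translate:
  fixes h :: "'a::euclidean_space \<Rightarrow> 'b::{banach, second_countable_topology}"
  assumes "continuous_on UNIV h"
  shows "integral\<^sup>L lborel (\<lambda>x. h (x + b)) = integral\<^sup>L lborel h"
proof -
  have [measurable]: "h \<in> borel_measurable borel"
    using assms by (rule borel_measurable_continuous_onI)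
  have "integral\<^sup>L lborel h = integral\<^sup>L (distr lborel borel ((+) b)) h"
    by (simp add: lborel_distr_plus)
  also have "\<dots> = integral\<^sup>L lborel (\<lambda>x. h (b + x))"
    by (subst integral_distr) auto
  finally show ?thesis by (simp add: add.commute)
qed

text \<open>Differentiate the translation-invariant integral of \<open>h (x + t b)\<close> at \<open>t = 0\<close>.\<close>

lemma integral_directional_derivative_eq_0:
  fixes h :: "'a::euclidean_space \<Rightarrow> complex"
  assumes der: "\<And>x. (h has_derivative h' x) (at x)" and E: "\<And>x. h' x b = E x"
    and cont: "continuous_on UNIV E" and supp: "\<And>x. norm x > R \<Longrightarrow> h x = 0"
  shows "integral\<^sup>L lborel E = 0"
proof -
  have conth: "continuous_on UNIV h"
    using der has_derivative_continuous continuous_at_imp_continuous_on by blast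
  have E0: "E x = 0" if "norm x > R" for x
  proof -
    have op: "open {x::'a. norm x > R}" by (intro open_Collect_less continuous_intros)
    have "(h has_derivative (\<lambda>_. 0)) (at x)"
      by (rule has_derivative_transform_within_open[of "\<lambda>_. 0", OF _ op]) (use that supp in auto)
    then have "h' x = (\<lambda>_. 0)" using der has_derivative_unique by blast
    then show ?thesis using E[of x] by simp
  qed
  have "bounded (E ` cball 0 R)"
    by (intro compact_imp_bounded compact_continuous_image continuous_on_subset[OF cont]) auto
  then obtain B where B: "B > 0" "\<And>x. x \<in> cball 0 R \<Longrightarrow> norm (E x) \<le> B"
    unfolding bounded_pos by auto
  have EB: "norm (E x) \<le> B" for x using B E0[of x] by (cases "norm x \<le> R") auto
  have path: "((\<lambda>s. h (x + s *\<^sub>R b)) has_derivative (\<lambda>d. d *\<^sub>R E (x + s *\<^sub>R b))) (at s)" for x s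
  proof -
    have 1: "((\<lambda>s. x + s *\<^sub>R b) has_derivative (\<lambda>d. d *\<^sub>R b)) (at s)"
      by (auto intro!: derivative_eq_intros)
    have "((\<lambda>s. h (x + s *\<^sub>R b)) has_derivative (\<lambda>d. h' (x + s *\<^sub>R b) (d *\<^sub>R b))) (at s)"
      by (rule has_derivative_compose[OF 1 der])
    moreover have "h' (x + s *\<^sub>R b) (d *\<^sub>R b) = d *\<^sub>R E (x + s *\<^sub>R b)" for d
      using linear_cmul[OF has_derivative_linear[OF der]] E by simp
    ultimately show ?thesis by simp
  qed
  have lip: "norm (h (x + t *\<^sub>R b) - h x) \<le> B * \<bar>t\<bar>" for x t
  proof -
    have "norm ((\<lambda>s. h (x + s *\<^sub>R b)) t - (\<lambda>s. h (x + s *\<^sub>R b)) 0) \<le> B * norm (t - 0)"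
    proof (rule differentiable_bound[of UNIV])
      fix s :: real
      show "((\<lambda>s. h (x + s *\<^sub>R b)) has_derivative (\<lambda>d. d *\<^sub>R E (x + s *\<^sub>R b))) (at s within UNIV)"
        using path by simp
      show "onorm (\<lambda>d. d *\<^sub>R E (x + s *\<^sub>R b)) \<le> B"
        using mult_left_mono[OF EB[of "x + s *\<^sub>R b"] abs_ge_zero] by (intro onorm_le) (simp add: mult.commute[of B])
    qed auto
    then show ?thesis by simp
  qed
  define t where "t = (\<lambda>n::nat. 1 / real (Suc n))"
  have t: "t n > 0" "t n \<le> 1" for n by (auto simp: t_def)
  have t0: "t \<longlonglongrightarrow> 0" unfolding t_def by (rule LIMSEQ_Suc[OF lim_1_over_n])
  define q where "q = (\<lambda>n x. (h (x + t n *\<^sub>R b) - h x) /\<^sub>R t n)"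
  have qlim: "(\<lambda>n. q n x) \<longlonglongrightarrow> E x" for x
  proof -
    have "((\<lambda>y. norm ((h (x + y *\<^sub>R b) - h (x + 0 *\<^sub>R b)) - (y - 0) *\<^sub>R E (x + 0 *\<^sub>R b)) / norm (y - 0)) \<longlongrightarrow> 0) (at 0)"
      using path[of x 0] unfolding has_derivative_iff_norm by blast
    then have "((\<lambda>y. norm ((h (x + y *\<^sub>R b) - h (x + 0 *\<^sub>R b)) - (y - 0) *\<^sub>R E (x + 0 *\<^sub>R b)) / norm (y - 0)) \<circ> t) \<longlonglongrightarrow> 0"
      unfolding tendsto_at_iff_sequentially using t t0 by (auto simp: less_imp_neq[symmetric])
    moreover have "norm (q n x - E x) = norm ((h (x + t n *\<^sub>R b) - h x) - t n *\<^sub>R E x) / t n" for n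
    proof -
      have "q n x - E x = ((h (x + t n *\<^sub>R b) - h x) - t n *\<^sub>R E x) /\<^sub>R t n"
        using t(1)[of n] by (simp add: q_def scaleR_diff_right)
      then show ?thesis using t(1)[of n] by (simp add: divide_inverse mult.commute)
    qed
    ultimately have "(\<lambda>n. norm (q n x - E x)) \<longlonglongrightarrow> 0"
      using t(1) by (simp add: o_def abs_of_pos)
    then show ?thesis by (simp add: tendsto_norm_zero_iff LIM_zero_iff)
  qed
  have inth: "integrable lborel h" by (rule integrable_continuous_compact_support[OF conth supp])
  have contt: "continuous_on UNIV (\<lambda>x. h (x + c))" for c
    by (rule continuous_on_compose2[OF conth]) (auto intro!: continuous_intros)
  have intt: "integrable lborel (\<lambda>x. h (x + c))" for c
  proof (rule integrable_continuous_compact_support[OF contt, of "R + norm c"])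
    fix x :: 'a assume "norm x > R + norm c"
    then have "norm (x + c) > R" using norm_triangle_ineq4[of "x + c" c] by simp
    then show "h (x + c) = 0" by (rule supp)
  qed
  have q0: "integral\<^sup>L lborel (q n) = 0" for n
    unfolding q_def using inth intt[of "t n *\<^sub>R b"] lborel_integral_translate[OF conth, of "t n *\<^sub>R b"]
    by simp
  have "(\<lambda>n. integral\<^sup>L lborel (q n)) \<longlonglongrightarrow> integral\<^sup>L lborel E"
  \<comment> \<open>The Lipschitz bound dominates the difference quotients; since the increments are
    at most 1, their supports stay within radius R + norm b.\<close>
  proof (rule integral_dominated_convergence[where w = "\<lambda>x. indicator (cball 0 (R + norm b)) x * B"])
    show "E \<in> borel_measurable lborel"
      using borel_measurable_continuous_onI[OF cont] by simp
    show "q n \<in> borel_measurable lborel" for n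
      unfolding q_def using borel_measurable_continuous_onI[OF contt] borel_measurable_continuous_onI[OF conth]
      by simp
    show "integrable lborel (\<lambda>x::'a. indicator (cball 0 (R + norm b)) x * B)"
      using borel_integrable_compact[of "cball (0::'a) (R + norm b)" "\<lambda>_. B"] by simp
    show "AE x in lborel. (\<lambda>n. q n x) \<longlonglongrightarrow> E x" using qlim by simp
    show "AE x in lborel. norm (q n x) \<le> indicator (cball 0 (R + norm b)) x * B" for n
    proof (rule AE_I2)
      fix x :: 'a
      show "norm (q n x) \<le> indicator (cball 0 (R + norm b)) x * B"
      proof (cases "norm x \<le> R + norm b")
        case True
        have "norm (q n x) = norm (h (x + t n *\<^sub>R b) - h x) / t n"
          using t(1)[of n] by (simp add: q_def divide_inverse mult.commute)
        also have "\<dots> \<le> B" using lip[of x "t n"] t(1)[of n] by (simp add: divide_le_eq mult.commute)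
        finally show ?thesis using True by simp
      next
        case False
        have "norm (t n *\<^sub>R b) \<le> norm b" using t[of n] by (simp add: mult_left_le_one_le)
        moreover have "norm x \<le> norm (x + t n *\<^sub>R b) + norm (t n *\<^sub>R b)"
          using norm_triangle_ineq4[of "x + t n *\<^sub>R b" "t n *\<^sub>R b"] by (simp only: add_diff_cancel_right')
        ultimately have "norm (x + t n *\<^sub>R b) > R" using False by linarith
        moreover have "norm x > R" using False norm_ge_zero[of b] by linarith
        ultimately show ?thesis using supp[of x] supp[of "x + t n *\<^sub>R b"] False by (simp add: q_def)
      qed
    qed
  qed
  then have "(\<lambda>n::nat. 0) \<longlonglongrightarrow> integral\<^sup>L lborel E" by (simp only: q0)
  then show ?thesis by (simp add: LIMSEQ_const_iff)
qed

lemma continuous_integral_eq_0_imp: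
  fixes h :: "'a::euclidean_space \<Rightarrow> real"
  assumes cont: "continuous_on UNIV h" and supp: "\<And>x. norm x > R \<Longrightarrow> h x = 0"
    and nonneg: "\<And>x. h x \<ge> 0" and zero: "integral\<^sup>L lborel h = 0"
  shows "h a = 0"
proof (rule ccontr)
  assume "h a \<noteq> 0"
  then have pos: "h a > 0" using nonneg[of a] by simp
  have "isCont h a" using cont continuous_on_eq_continuous_at by blast
  then obtain d where d: "d > 0" "\<And>x. dist x a < d \<Longrightarrow> dist (h x) (h a) < h a / 2"
    unfolding continuous_at_eps_delta using pos by (metis half_gt_zero)
  have ge: "indicator (ball a d) x * (h a / 2) \<le> h x" for x
  proof (cases "x \<in> ball a d")
    case True
    then have "dist (h x) (h a) < h a / 2"
      using d(2)[of x] unfolding mem_ball dist_commute[of a x] by blast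
    then have "h a / 2 \<le> h x" unfolding dist_real_def by linarith
    then show ?thesis using True by simp
  qed (use nonneg in simp)
  have fin: "integrable lborel (\<lambda>x. indicator (ball a d) x * (h a / 2))"
    using emeasure_lborel_ball_finite[of a d] by (intro integrable_mult_left integrable_real_indicator) auto
  have inth: "integrable lborel h" by (rule integrable_continuous_compact_support[OF cont supp])
  have "integral\<^sup>L lborel (\<lambda>x. indicator (ball a d) x * (h a / 2)) \<le> integral\<^sup>L lborel h"
    using fin inth by (rule integral_mono) (rule ge)
  moreover have "integral\<^sup>L lborel (\<lambda>x. indicator (ball a d) x * (h a / 2)) = measure lborel (ball a d) * (h a / 2)"
    by simp
  moreover have "measure lborel (ball a d) > 0" using content_ball_pos[OF d(1), of a] by simp
  ultimately show False using pos zero by (simp add: mult_le_0_iff)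
qed

text \<open>Applied to |x|^2, this bump is supported in the annulus 1 <= |x| <= 2, away from the
  singularity of radial extensions at the origin. Squaring the positive part makes it once
  continuously differentiable, as Green's identity requires.\<close>

definition cutoff :: "real \<Rightarrow> real" where "cutoff y = (max 0 ((y - 1) * (4 - y)))\<^sup>2"

definition cutoff' :: "real \<Rightarrow> real" where "cutoff' y = 2 * max 0 ((y - 1) * (4 - y)) * (5 - 2 * y)"

lemma has_derivative_square_max_0:
  "((\<lambda>t::real. (max 0 t)\<^sup>2) has_real_derivative 2 * max 0 t) (at t)"
proof -
  consider "t > 0" | "t < 0" | "t = 0" by linarith
  then show ?thesis
  proof cases
    case 1
    have "((\<lambda>t::real. t\<^sup>2) has_real_derivative 2 * max 0 t) (at t)"
      using 1 by (auto intro!: derivative_eq_intros)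
    then show ?thesis
      by (rule has_field_derivative_transform_within_open[where S = "{0<..}"]) (use 1 in auto)
  next
    case 2
    have "((\<lambda>t::real. 0) has_real_derivative 2 * max 0 t) (at t)"
      using 2 by (auto intro!: derivative_eq_intros)
    then show ?thesis
      by (rule has_field_derivative_transform_within_open[where S = "{..<0}"]) (use 2 in auto)
  next
    case 3
    have "((\<lambda>y::real. ((max 0 y)\<^sup>2 - (max 0 0)\<^sup>2) / (y - 0)) \<longlongrightarrow> 0) (at 0)"
    proof (rule Lim_null_comparison[of _ "\<lambda>y. \<bar>y\<bar>"])
      show "\<forall>\<^sub>F y in at 0. norm (((max 0 y)\<^sup>2 - (max 0 0)\<^sup>2) / (y - 0)) \<le> \<bar>y::real\<bar>"
        by (rule always_eventually) (auto simp: max_def power2_eq_square)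
      show "((\<lambda>y::real. \<bar>y\<bar>) \<longlongrightarrow> 0) (at 0)" by (auto intro!: tendsto_eq_intros)
    qed
    then show ?thesis using 3 by (simp add: has_field_derivative_iff)
  qed
qed

lemma cutoff_deriv: "(cutoff has_real_derivative cutoff' y) (at y)"
proof -
  have 1: "((\<lambda>y::real. (y - 1) * (4 - y)) has_real_derivative (5 - 2 * y)) (at y)"
    by (auto intro!: derivative_eq_intros)
  show ?thesis
    using DERIV_chain2[OF has_derivative_square_max_0 1] unfolding cutoff_def[abs_def] cutoff'_def .
qed

lemma continuous_cutoff: "continuous_on UNIV cutoff" "continuous_on UNIV cutoff'"
  unfolding cutoff_def[abs_def] cutoff'_def[abs_def] by (intro continuous_intros)+

lemma cutoff_eq_0:
  assumes "y \<le> 1 \<or> y \<ge> 4"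
  shows "cutoff y = 0" "cutoff' y = 0"
proof -
  have "(y - 1) * (4 - y) \<le> 0" using assms by (auto simp: mult_le_0_iff)
  then have "max 0 ((y - 1) * (4 - y)) = 0" by simp
  then show "cutoff y = 0" "cutoff' y = 0" unfolding cutoff_def cutoff'_def by simp_all
qed

lemma cutoff_inner_eq_0:
  fixes x :: "'a::real_inner"
  assumes "norm x \<le> 1 \<or> norm x \<ge> 2"
  shows "cutoff (x \<bullet> x) = 0" "cutoff' (x \<bullet> x) = 0"
proof -
  have "x \<bullet> x \<le> 1 \<or> x \<bullet> x \<ge> 4"
  proof (cases "norm x \<le> 1")
    case True
    then have "(norm x)\<^sup>2 \<le> 1\<^sup>2" by (intro power_mono) auto
    then show ?thesis by (simp add: dot_square_norm)
  next
    case False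
    then have "2\<^sup>2 \<le> (norm x)\<^sup>2" using assms by (intro power_mono) auto
    then show ?thesis by (simp add: dot_square_norm)
  qed
  then show "cutoff (x \<bullet> x) = 0" "cutoff' (x \<bullet> x) = 0" by (rule cutoff_eq_0)+
qed

lemma cutoff_pos: "1 < y \<Longrightarrow> y < 4 \<Longrightarrow> cutoff y > 0"
  by (auto simp: cutoff_def max_def)

lemma cutoff_nonneg: "cutoff y \<ge> 0"
  by (simp add: cutoff_def)

section \<open>Directional derivatives of radial extensions\<close>

definition dir_deriv :: "('a::real_normed_vector \<Rightarrow> 'b::real_normed_vector) \<Rightarrow> 'a \<Rightarrow> 'a \<Rightarrow> 'b" where
  "dir_deriv f v = (\<lambda>x. frechet_derivative f (at x) v)"

lemma dir_deriv_eq: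
  assumes "(f has_derivative f') (at x)"
  shows "dir_deriv f v x = f' v"
  unfolding dir_deriv_def using frechet_derivative_at[OF assms] by simp

lemma has_derivative_dir_deriv:
  assumes "f differentiable (at x)"
  shows "(f has_derivative (\<lambda>v. dir_deriv f v x)) (at x)"
  using assms unfolding dir_deriv_def frechet_derivative_works .

lemma differentiable_times_2D:
  assumes "differentiable_times 2 f S"
  shows "\<And>x. x \<in> S \<Longrightarrow> f differentiable (at x)"
    and "\<And>x v. x \<in> S \<Longrightarrow> dir_deriv f v differentiable (at x)"
    and "\<And>v w. continuous_on S (dir_deriv (dir_deriv f v) w)"
  using assms unfolding numeral_2_eq_2 dir_deriv_def by simp_all

lemma radial_ext_scale:
  assumes "c > 0"
  shows "radial_ext f (c *\<^sub>R x) = radial_ext f x"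
proof -
  have "inverse (c * norm x) * c = inverse (norm x)" using assms by (simp add: field_simps)
  then have "(c *\<^sub>R x) /\<^sub>R norm (c *\<^sub>R x) = x /\<^sub>R norm x"
    by (simp only: norm_scaleR abs_of_pos[OF assms] scaleR_scaleR)
  then show ?thesis by (simp only: radial_ext_def)
qed

lemma radial_ext_sphere: "norm x = 1 \<Longrightarrow> radial_ext f x = f x"
  by (simp add: radial_ext_def)

lemma dir_deriv_radial:
  fixes f :: "'a::euclidean_space \<Rightarrow> complex"
  assumes "radial_ext f differentiable (at x)"
  shows "dir_deriv (radial_ext f) x x = 0"
proof -
  let ?F = "radial_ext f"
  have 1: "((\<lambda>s::real. x + s *\<^sub>R x) has_derivative (\<lambda>d. d *\<^sub>R x)) (at 0)"
    by (auto intro!: derivative_eq_intros)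
  have 2: "(?F has_derivative (\<lambda>v. dir_deriv ?F v x)) (at (x + 0 *\<^sub>R x))"
    using has_derivative_dir_deriv[OF assms] by simp
  have "((\<lambda>s. ?F (x + s *\<^sub>R x)) has_derivative (\<lambda>d. dir_deriv ?F (d *\<^sub>R x) x)) (at 0)"
    by (rule has_derivative_compose[OF 1 2])
  moreover have "((\<lambda>s::real. ?F (x + s *\<^sub>R x)) has_derivative (\<lambda>d. 0)) (at 0)"
  proof (rule has_derivative_transform_within_open[of "\<lambda>_. ?F x" _ _ _ "{-1<..}"])
    fix s :: real assume "s \<in> {-1<..}"
    then have "?F ((1 + s) *\<^sub>R x) = ?F x" by (intro radial_ext_scale) simp
    then show "?F x = ?F (x + s *\<^sub>R x)" by (simp add: scaleR_add_left)
  qed auto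
  ultimately have "(\<lambda>d::real. dir_deriv ?F (d *\<^sub>R x) x) = (\<lambda>d. 0)" by (rule has_derivative_unique)
  from fun_cong[OF this, of 1] show ?thesis by simp
qed

text \<open>Differentiation lowers the degree of homogeneity by one, stated for a single scaling
  factor \<open>c\<close>. Applied twice to a radial extension, it leads from degree 0 to degree -2
  and so relates its Laplacian at radius |x| to the one on the unit sphere.\<close>

lemma dir_deriv_homogeneous:
  fixes H :: "'a::real_normed_vector \<Rightarrow> complex"
  assumes hom: "\<And>y. y \<noteq> 0 \<Longrightarrow> H y = a * H (y /\<^sub>R c)" and x: "x \<noteq> 0"
    and diff: "H differentiable (at (x /\<^sub>R c))"
  shows "dir_deriv H v x = a * (dir_deriv H v (x /\<^sub>R c) /\<^sub>R c)"
proof -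
  have 1: "((\<lambda>y. y /\<^sub>R c) has_derivative (\<lambda>v. v /\<^sub>R c)) (at x)"
    by (auto intro!: derivative_eq_intros)
  have "((\<lambda>y. a * H (y /\<^sub>R c)) has_derivative (\<lambda>v. a * dir_deriv H (v /\<^sub>R c) (x /\<^sub>R c))) (at x)"
    by (intro has_derivative_mult_right has_derivative_compose[OF 1 has_derivative_dir_deriv[OF diff]])
  then have "(H has_derivative (\<lambda>v. a * dir_deriv H (v /\<^sub>R c) (x /\<^sub>R c))) (at x)"
    by (rule has_derivative_transform_within_open[of _ _ _ _ "- {0}"]) (use x hom in auto)
  then have "dir_deriv H v x = a * dir_deriv H (v /\<^sub>R c) (x /\<^sub>R c)" by (rule dir_deriv_eq)
  then show ?thesis
    using linear_cmul[OF has_derivative_linear[OF has_derivative_dir_deriv[OF diff]], of "inverse c" v] by simp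
qed

lemma laplacian_radial_ext:
  fixes f :: "'a::euclidean_space \<Rightarrow> complex"
  assumes f: "differentiable_times 2 (radial_ext f) (- {0})" and x: "x \<noteq> 0"
  shows "(\<Sum>b\<in>Basis. dir_deriv (dir_deriv (radial_ext f) b) b x) =
    sphere_laplacian f (x /\<^sub>R norm x) / of_real (norm x)^2"
proof -
  let ?F = "radial_ext f" and ?c = "norm x"
  have c: "?c > 0" using x by simp
  have 1: "dir_deriv ?F b y = of_real (inverse ?c) * dir_deriv ?F b (y /\<^sub>R ?c)" if "y \<noteq> 0" for b y
  proof -
    have "dir_deriv ?F b y = 1 * (dir_deriv ?F b (y /\<^sub>R ?c) /\<^sub>R ?c)"
    proof (rule dir_deriv_homogeneous[OF _ that])
      show "?F z = 1 * ?F (z /\<^sub>R ?c)" for z using radial_ext_scale[of "inverse ?c" f z] c by simp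
      show "?F differentiable (at (y /\<^sub>R ?c))" using that c by (intro differentiable_times_2D(1)[OF f]) auto
    qed
    then show ?thesis by (simp add: scaleR_conv_of_real)
  qed
  have "dir_deriv (dir_deriv ?F b) b x = dir_deriv (dir_deriv ?F b) b (x /\<^sub>R ?c) / of_real ?c^2" for b
  proof -
    have "dir_deriv (dir_deriv ?F b) b x =
        of_real (inverse ?c) * (dir_deriv (dir_deriv ?F b) b (x /\<^sub>R ?c) /\<^sub>R ?c)"
      by (rule dir_deriv_homogeneous[where H = "dir_deriv ?F b" and a = "of_real (inverse ?c)", OF 1 x]) (use x in \<open>auto intro: differentiable_times_2D(2)[OF f]\<close>)
    then show ?thesis
      by (simp add: scaleR_conv_of_real divide_inverse power2_eq_square)
  qed
  then show ?thesis
    by (simp add: sphere_laplacian_def dir_deriv_def sum_divide_distrib)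
qed

lemma continuous_on_extend_by_0:
  fixes h :: "'a::real_normed_vector \<Rightarrow> 'b::real_normed_vector"
  assumes "continuous_on (- {0}) h" "\<And>x. norm x < 1 \<Longrightarrow> h x = 0"
  shows "continuous_on UNIV h"
proof -
  have "continuous_on (ball 0 1) h"
    by (rule continuous_on_eq[of _ "\<lambda>_. 0"]) (use assms(2) in auto)
  then have "continuous_on (- {0} \<union> ball 0 1) h"
    using assms(1) by (intro continuous_on_open_Un) auto
  moreover have "- {0} \<union> ball (0::'a) 1 = UNIV" by auto
  ultimately show ?thesis by simp
qed

text \<open>Green's identity for the vector field \<open>cutoff |x|\<^sup>2 (F grad G - G grad F)\<close>; the gradient of
  the cutoff factor is radial, so it does not contribute.\<close>

lemma green_identity:
  fixes f g :: "'a::euclidean_space \<Rightarrow> complex"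
  assumes f: "differentiable_times 2 (radial_ext f) (- {0})"
    and g: "differentiable_times 2 (radial_ext g) (- {0})"
  shows "integral\<^sup>L lborel (\<lambda>x. of_real (cutoff (x \<bullet> x)) *
    (radial_ext f x * (\<Sum>b\<in>Basis. dir_deriv (dir_deriv (radial_ext g) b) b x) -
     radial_ext g x * (\<Sum>b\<in>Basis. dir_deriv (dir_deriv (radial_ext f) b) b x))) = 0"
proof -
  let ?F = "radial_ext f" and ?G = "radial_ext g"
  define c c' where "c = (\<lambda>x::'a. complex_of_real (cutoff (x \<bullet> x)))"
    and "c' = (\<lambda>b (x::'a). complex_of_real (cutoff' (x \<bullet> x) * (2 * (x \<bullet> b))))"
  define W where "W = (\<lambda>b x. c x * (?F x * dir_deriv ?G b x - ?G x * dir_deriv ?F b x))"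
  define E where "E = (\<lambda>b x. c' b x * (?F x * dir_deriv ?G b x - ?G x * dir_deriv ?F b x) +
    c x * (?F x * dir_deriv (dir_deriv ?G b) b x - ?G x * dir_deriv (dir_deriv ?F b) b x))"
  have cder: "(c has_derivative (\<lambda>v. c' v x)) (at x)" for x
  proof -
    have "((\<lambda>x. x \<bullet> x) has_derivative (\<lambda>v. 2 * (x \<bullet> v))) (at x)"
      by (auto intro!: derivative_eq_intros simp: inner_commute)
    from has_derivative_compose[OF this cutoff_deriv[unfolded has_field_derivative_def]]
    have "((\<lambda>x. cutoff (x \<bullet> x)) has_derivative (\<lambda>v. cutoff' (x \<bullet> x) * (2 * (x \<bullet> v)))) (at x)" .
    then show ?thesis unfolding c_def c'_def by (rule has_derivative_of_real)
  qed
  have zero: "c x = 0" "c' b x = 0" if "norm x \<le> 1 \<or> norm x \<ge> 2" for x b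
    using that by (simp_all add: c_def c'_def cutoff_inner_eq_0)
  have cont1: "continuous_on (- {0}) (radial_ext h)" "continuous_on (- {0}) (dir_deriv (radial_ext h) b)"
    "continuous_on (- {0}) (dir_deriv (dir_deriv (radial_ext h) b) b)"
    if "differentiable_times 2 (radial_ext h) (- {0})" for h :: "'a \<Rightarrow> complex" and b
    using differentiable_times_2D[OF that]
    by (auto intro!: continuous_at_imp_continuous_on differentiable_imp_continuous_within)
  have contc: "continuous_on S c" "continuous_on S (c' b)" for S b
    unfolding c_def c'_def
    by (intro continuous_intros continuous_on_compose2[OF continuous_cutoff(1)]
        continuous_on_compose2[OF continuous_cutoff(2)] subset_UNIV)+
  have contE: "continuous_on UNIV (E b)" for b
  proof (rule continuous_on_extend_by_0)
    show "continuous_on (- {0}) (E b)"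
      unfolding E_def by (intro continuous_intros contc cont1[OF f] cont1[OF g])
  qed (simp add: E_def zero)
  have suppE: "E b x = 0" if "norm x > 2" for b x using that by (simp add: E_def zero)
  have Wder: "\<exists>W'. (W b has_derivative W') (at x) \<and> W' b = E b x" for b x
  proof (cases "x = 0")
    case True
    have "(W b has_derivative (\<lambda>_. 0)) (at x)"
      by (rule has_derivative_transform_within_open[of "\<lambda>_. 0" _ _ _ "ball 0 1"])
        (use True in \<open>auto simp: W_def zero\<close>)
    moreover have "E b x = 0" using True by (simp add: E_def zero)
    ultimately show ?thesis by auto
  next
    case False
    then have x: "x \<in> - {0}" by simp
    note d = has_derivative_dir_deriv[OF differentiable_times_2D(1)[OF f x]]
      has_derivative_dir_deriv[OF differentiable_times_2D(1)[OF g x]]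
      has_derivative_dir_deriv[OF differentiable_times_2D(2)[OF f x]]
      has_derivative_dir_deriv[OF differentiable_times_2D(2)[OF g x]]
    let ?W = "\<lambda>v. c x * ((?F x * dir_deriv (dir_deriv ?G b) v x + dir_deriv ?F v x * dir_deriv ?G b x)
      - (?G x * dir_deriv (dir_deriv ?F b) v x + dir_deriv ?G v x * dir_deriv ?F b x))
      + c' v x * (?F x * dir_deriv ?G b x - ?G x * dir_deriv ?F b x)"
    have "(W b has_derivative ?W) (at x)"
      unfolding W_def by (intro has_derivative_mult has_derivative_diff cder d)
    moreover have "?W b = E b x" by (simp add: E_def algebra_simps)
    ultimately show ?thesis by blast
  qed
  have intE: "integral\<^sup>L lborel (E b) = 0" for b
  proof -
    obtain W' where W': "\<And>x. (W b has_derivative W' x) (at x)" "\<And>x. W' x b = E b x" using Wder by metis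
    show ?thesis
      by (rule integral_directional_derivative_eq_0[OF W' contE, where R = 2]) (simp add: W_def zero)
  qed
  have "integrable lborel (E b)" for b
    by (rule integrable_continuous_compact_support[OF contE, of 2]) (rule suppE)
  then have "integral\<^sup>L lborel (\<lambda>x. \<Sum>b\<in>Basis. E b x) = 0"
    by (subst Bochner_Integration.integral_sum) (auto simp: intE)
  moreover have "(\<Sum>b\<in>Basis. E b x) = of_real (cutoff (x \<bullet> x)) *
    (?F x * (\<Sum>b\<in>Basis. dir_deriv (dir_deriv ?G b) b x) - ?G x * (\<Sum>b\<in>Basis. dir_deriv (dir_deriv ?F b) b x))" for x
  proof (cases "x = 0")
    case True
    then show ?thesis by (simp add: E_def zero cutoff_eq_0)
  next
    case False
    have rad: "(\<Sum>b\<in>Basis. of_real (x \<bullet> b) * dir_deriv (radial_ext h) b x) = 0"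
      if h: "differentiable_times 2 (radial_ext h) (- {0})" for h :: "'a \<Rightarrow> complex"
    proof -
      have d: "radial_ext h differentiable (at x)" using differentiable_times_2D(1)[OF h] False by simp
      note lin = has_derivative_linear[OF has_derivative_dir_deriv[OF d]]
      have "dir_deriv (radial_ext h) (\<Sum>b\<in>Basis. (x \<bullet> b) *\<^sub>R b) x =
          (\<Sum>b\<in>Basis. (x \<bullet> b) *\<^sub>R dir_deriv (radial_ext h) b x)"
        by (simp add: linear_sum[OF lin] linear_cmul[OF lin])
      then show ?thesis using dir_deriv_radial[OF d] by (simp add: euclidean_representation scaleR_conv_of_real)
    qed
    have "(\<Sum>b\<in>Basis. c' b x * (?F x * dir_deriv ?G b x - ?G x * dir_deriv ?F b x)) =
      of_real (2 * cutoff' (x \<bullet> x)) * (?F x * (\<Sum>b\<in>Basis. of_real (x \<bullet> b) * dir_deriv ?G b x) -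
        ?G x * (\<Sum>b\<in>Basis. of_real (x \<bullet> b) * dir_deriv ?F b x))"
      by (simp add: c'_def sum_distrib_left sum_subtractf[symmetric] algebra_simps)
    also have "\<dots> = 0" by (simp add: rad f g)
    finally have "(\<Sum>b\<in>Basis. E b x) = (\<Sum>b\<in>Basis. c x *
        (?F x * dir_deriv (dir_deriv ?G b) b x - ?G x * dir_deriv (dir_deriv ?F b) b x))"
      by (simp only: E_def sum.distrib add_0)
    then show ?thesis
      by (simp add: c_def sum_distrib_left sum_subtractf[symmetric] algebra_simps)
  qed
  ultimately show ?thesis by simp
qed

text \<open>Dividing by |x|^2 absorbs the factor by which the Laplacian of a radial extension
  changes off the unit sphere, so that Green's identity becomes a statement about functions on the
  sphere.\<close>

definition sphere_weight :: "'a::euclidean_space \<Rightarrow> real" where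
  "sphere_weight x = cutoff (x \<bullet> x) / (x \<bullet> x)"

text \<open>In polar coordinates this is a positive constant times the surface integral;
  orthogonality and positivity do not see the constant.\<close>

definition sphere_integral :: "('a::euclidean_space \<Rightarrow> complex) \<Rightarrow> complex" where
  "sphere_integral h = integral\<^sup>L lborel (\<lambda>x. of_real (sphere_weight x) * radial_ext h x)"

lemma sphere_weight_eq_0: "norm x \<le> 1 \<or> norm x \<ge> 2 \<Longrightarrow> sphere_weight x = 0"
  by (simp add: sphere_weight_def cutoff_inner_eq_0)

lemma sphere_weight_nonneg: "sphere_weight x \<ge> 0"
  by (simp add: sphere_weight_def cutoff_nonneg)

lemma continuous_on_weighted_radial_ext:
  fixes h :: "'a::euclidean_space \<Rightarrow> complex"
  assumes "continuous_on (sphere 0 1) h"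
  shows "continuous_on UNIV (\<lambda>x. of_real (sphere_weight x) * radial_ext h x)"
proof (rule continuous_on_extend_by_0)
  have "continuous_on (- {0}) (radial_ext h)"
    unfolding radial_ext_def[abs_def]
  proof (rule continuous_on_compose2[OF assms])
    show "continuous_on (- {0}) (\<lambda>x::'a. x /\<^sub>R norm x)" by (auto intro!: continuous_intros)
    show "(\<lambda>x::'a. x /\<^sub>R norm x) ` (- {0}) \<subseteq> sphere 0 1" by (rule image_subsetI) simp
  qed
  moreover have "continuous_on (- {0}) (sphere_weight :: 'a \<Rightarrow> real)"
    unfolding sphere_weight_def[abs_def]
    by (intro continuous_intros continuous_on_compose2[OF continuous_cutoff(1)]) auto
  ultimately show "continuous_on (- {0}) (\<lambda>x. of_real (sphere_weight x) * radial_ext h x)"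
    by (intro continuous_intros)
qed (simp add: sphere_weight_eq_0)

lemma integrable_weighted_radial_ext:
  fixes h :: "'a::euclidean_space \<Rightarrow> complex"
  assumes "continuous_on (sphere 0 1) h"
  shows "integrable lborel (\<lambda>x. of_real (sphere_weight x) * radial_ext h x)"
  by (rule integrable_continuous_compact_support[OF continuous_on_weighted_radial_ext[OF assms], of 2])
    (simp add: sphere_weight_eq_0)

lemma sphere_integral_add:
  assumes "continuous_on (sphere 0 1) f" "continuous_on (sphere 0 1) g"
  shows "sphere_integral (\<lambda>z. f z + g z) = sphere_integral f + sphere_integral g"
  using integrable_weighted_radial_ext[OF assms(1)] integrable_weighted_radial_ext[OF assms(2)]
  unfolding sphere_integral_def by (simp add: radial_ext_def distrib_left)

lemma sphere_integral_cmult: "sphere_integral (\<lambda>z. c * f z) = c * sphere_integral f"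
  unfolding sphere_integral_def integral_mult_right_zero[symmetric]
  by (rule Bochner_Integration.integral_cong) (simp_all add: radial_ext_def mult_ac)

lemma sphere_integral_positive:
  fixes f :: "'a::euclidean_space \<Rightarrow> complex"
  assumes f: "continuous_on (sphere 0 1) f" and zero: "sphere_integral (\<lambda>z. f z * cnj (f z)) = 0"
    and z: "norm z = 1"
  shows "f z = 0"
proof -
  let ?h = "\<lambda>x::'a. sphere_weight x * (cmod (radial_ext f x))\<^sup>2"
  have e: "of_real (sphere_weight x) * radial_ext (\<lambda>z. f z * cnj (f z)) x = complex_of_real (?h x)" for x
    by (simp only: radial_ext_def of_real_mult complex_norm_square)
  have "continuous_on UNIV (\<lambda>x. of_real (sphere_weight x) * radial_ext (\<lambda>z. f z * cnj (f z)) x)"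
    by (intro continuous_on_weighted_radial_ext continuous_intros f)
  then have "continuous_on UNIV (\<lambda>x. Re (complex_of_real (?h x)))"
    unfolding e by (rule continuous_on_Re)
  then have cont: "continuous_on UNIV ?h" by simp
  have "complex_of_real (integral\<^sup>L lborel ?h) = 0"
    using zero unfolding sphere_integral_def e by (simp only: integral_complex_of_real)
  then have "integral\<^sup>L lborel ?h = 0" by (simp only: of_real_eq_0_iff)
  \<comment> \<open>Radius sqrt 2 lies in the interior of the annulus, where the weight is
    positive.\<close>
  then have "?h (sqrt 2 *\<^sub>R z) = 0"
    by (rule continuous_integral_eq_0_imp[OF cont, of 2, rotated 2])
      (simp_all add: sphere_weight_eq_0 sphere_weight_nonneg)
  moreover have "(sqrt 2 *\<^sub>R z) \<bullet> (sqrt 2 *\<^sub>R z) = 2" using z by (simp add: dot_square_norm)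
  then have "sphere_weight (sqrt 2 *\<^sub>R z) \<noteq> 0"
    using cutoff_pos[of 2] by (simp add: sphere_weight_def)
  ultimately have "radial_ext f (sqrt 2 *\<^sub>R z) = 0" by simp
  then show ?thesis using radial_ext_scale[of "sqrt 2" f z] z by (simp add: radial_ext_sphere)
qed

lemma sphere_integral_bound:
  fixes f :: "'a::euclidean_space \<Rightarrow> complex"
  assumes f: "continuous_on (sphere 0 1) f"
  obtains C where "C > 0" "\<And>g e. continuous_on (sphere 0 1) g \<Longrightarrow>
    (\<And>z. norm z = 1 \<Longrightarrow> cmod (g z) \<le> e) \<Longrightarrow> cmod (sphere_integral (\<lambda>z. f z * g z)) \<le> C * e"
proof -
  let ?h = "\<lambda>x. of_real (sphere_weight x) * radial_ext f x"
  have int: "integrable lborel (\<lambda>x. norm (?h x))"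
    by (intro integrable_norm integrable_weighted_radial_ext f)
  \<comment> \<open>The summand 1 makes the constant strictly positive, so that it can serve as a
    divisor later.\<close>
  define C where "C = integral\<^sup>L lborel (\<lambda>x. norm (?h x)) + 1"
  have "0 \<le> integral\<^sup>L lborel (\<lambda>x. norm (?h x))" by (rule Bochner_Integration.integral_nonneg) simp
  then have C0: "C > 0" unfolding C_def by linarith
  show thesis
  proof (rule that[OF C0])
    fix g :: "'a \<Rightarrow> complex" and e
    assume g: "continuous_on (sphere 0 1) g" and e: "\<And>z. norm z = 1 \<Longrightarrow> cmod (g z) \<le> e"
    obtain b :: 'a where "b \<in> Basis" using nonempty_Basis by blast
    then have "cmod (g b) \<le> e" by (intro e) simp
    then have e0: "e \<ge> 0" using norm_ge_zero order_trans by blast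
    have fg: "integrable lborel (\<lambda>x. of_real (sphere_weight x) * radial_ext (\<lambda>z. f z * g z) x)"
      by (intro integrable_weighted_radial_ext continuous_intros f g)
    have "cmod (sphere_integral (\<lambda>z. f z * g z)) \<le> integral\<^sup>L lborel (\<lambda>x. norm (?h x) * e)"
      unfolding sphere_integral_def
    proof (rule Bochner_Integration.integral_norm_bound_integral[OF fg])
      show "integrable lborel (\<lambda>x. norm (?h x) * e)" using int by (rule integrable_mult_left)
      fix x :: 'a
      show "norm (of_real (sphere_weight x) * radial_ext (\<lambda>z. f z * g z) x) \<le> norm (?h x) * e"
      proof (cases "x = 0")
        case True then show ?thesis by (simp add: sphere_weight_eq_0)
      next
        case False
        then have "norm (x /\<^sub>R norm x) = 1" by simp
        then have "cmod (g (x /\<^sub>R norm x)) \<le> e" by (rule e)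
        then have "cmod (?h x) * cmod (g (x /\<^sub>R norm x)) \<le> cmod (?h x) * e" by (intro mult_left_mono) auto
        then show ?thesis by (simp add: radial_ext_def norm_mult mult.assoc)
      qed
    qed
    also have "\<dots> = integral\<^sup>L lborel (\<lambda>x. norm (?h x)) * e" by simp
    also have "\<dots> \<le> C * e" using e0 by (intro mult_right_mono) (simp_all add: C_def)
    finally show "cmod (sphere_integral (\<lambda>z. f z * g z)) \<le> C * e" .
  qed
qed

lemma sphere_smooth_continuous:
  fixes f :: "'a::euclidean_space \<Rightarrow> complex"
  assumes "sphere_smooth f"
  shows "continuous_on (sphere 0 1) f"
proof -
  have "differentiable_times 0 (radial_ext f) (- {0})" using assms unfolding sphere_smooth_def by blast
  then have "continuous_on (- {0}) (radial_ext f)" by simp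
  then have "continuous_on (sphere 0 1) (radial_ext f)" by (rule continuous_on_subset) auto
  then show ?thesis by (rule continuous_on_eq) (simp add: radial_ext_sphere)
qed

text \<open>Green's identity reads (\<mu> - \<nu>) times the integral = 0. The pairing is bilinear,
  without conjugation, so this holds for arbitrary complex eigenvalues.\<close>

lemma sphere_laplacian_eigenfunctions_orthogonal:
  fixes f g :: "'a::euclidean_space \<Rightarrow> complex"
  assumes f: "sphere_smooth f" "\<And>z. norm z = 1 \<Longrightarrow> - sphere_laplacian f z = \<mu> * f z"
    and g: "sphere_smooth g" "\<And>z. norm z = 1 \<Longrightarrow> - sphere_laplacian g z = \<nu> * g z"
    and "\<mu> \<noteq> \<nu>"
  shows "sphere_integral (\<lambda>z. f z * g z) = 0"
proof -
  have d: "differentiable_times 2 (radial_ext f) (- {0})" "differentiable_times 2 (radial_ext g) (- {0})"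
    using f(1) g(1) unfolding sphere_smooth_def by blast+
  have lap: "(\<Sum>b\<in>Basis. dir_deriv (dir_deriv (radial_ext h) b) b x) = - (m * radial_ext h x / of_real (x \<bullet> x))"
    if "differentiable_times 2 (radial_ext h) (- {0})" "\<And>z. norm z = 1 \<Longrightarrow> - sphere_laplacian h z = m * h z"
      "x \<noteq> 0" for h :: "'a \<Rightarrow> complex" and m x
  proof -
    have "sphere_laplacian h (x /\<^sub>R norm x) = - (m * h (x /\<^sub>R norm x))"
      using that(2)[of "x /\<^sub>R norm x"] that(3) by (simp add: minus_equation_iff[of "sphere_laplacian _ _"])
    then show ?thesis unfolding laplacian_radial_ext[OF that(1,3)]
      by (simp add: radial_ext_def dot_square_norm)
  qed
  have "of_real (cutoff (x \<bullet> x)) *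
    (radial_ext f x * (\<Sum>b\<in>Basis. dir_deriv (dir_deriv (radial_ext g) b) b x) -
     radial_ext g x * (\<Sum>b\<in>Basis. dir_deriv (dir_deriv (radial_ext f) b) b x)) =
    (\<mu> - \<nu>) * (of_real (sphere_weight x) * radial_ext (\<lambda>z. f z * g z) x)" for x
  proof (cases "x = 0")
    case True then show ?thesis by (simp add: sphere_weight_eq_0 cutoff_eq_0)
  next
    case False
    have 1: "(\<Sum>b\<in>Basis. dir_deriv (dir_deriv (radial_ext f) b) b x) = - (\<mu> * radial_ext f x / of_real (x \<bullet> x))"
      by (rule lap[OF d(1) _ False]) (rule f(2))
    have 2: "(\<Sum>b\<in>Basis. dir_deriv (dir_deriv (radial_ext g) b) b x) = - (\<nu> * radial_ext g x / of_real (x \<bullet> x))"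
      by (rule lap[OF d(2) _ False]) (rule g(2))
    show ?thesis unfolding 1 2
      using False by (simp add: sphere_weight_def radial_ext_def field_simps)
  qed
  then have "integral\<^sup>L lborel (\<lambda>x. (\<mu> - \<nu>) * (of_real (sphere_weight x) * radial_ext (\<lambda>z. f z * g z) x)) = 0"
    using green_identity[OF d] by simp
  then have "(\<mu> - \<nu>) * sphere_integral (\<lambda>z. f z * g z) = 0"
    unfolding sphere_integral_def by simp
  then show ?thesis using \<open>\<mu> \<noteq> \<nu>\<close> by simp
qed

text \<open>Uniform approximation of the conjugate of \<open>f\<close> by polynomials
  (Stone-Weierstrass, for real and imaginary part separately) makes the integral of |f|^2
  arbitrarily small.\<close>

lemma orthogonal_to_polynomials_eq_0:
  fixes f :: "'a::euclidean_space \<Rightarrow> complex"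
  assumes f: "continuous_on (sphere 0 1) f"
    and orth: "\<And>p. real_polynomial_function p \<Longrightarrow> sphere_integral (\<lambda>z. f z * of_real (p z)) = 0"
    and z: "norm z = 1"
  shows "f z = 0"
proof (rule sphere_integral_positive[OF f _ z])
  obtain C where C: "C > 0" "\<And>g e. continuous_on (sphere 0 1) g \<Longrightarrow>
    (\<And>z. norm z = 1 \<Longrightarrow> cmod (g z) \<le> e) \<Longrightarrow> cmod (sphere_integral (\<lambda>z. f z * g z)) \<le> C * e"
    using sphere_integral_bound[OF f] by metis
  have "cmod (sphere_integral (\<lambda>z. f z * cnj (f z))) \<le> 0 + e" if e: "e > 0" for e
  proof -
    \<comment> \<open>Each of the two real approximations errs by less than d, hence the complex one
      by at most 2 d, and C times 2 d is e.\<close>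
    define d where "d = e / (2 * C)"
    have d: "d > 0" using e C(1) by (simp add: d_def)
    have cont: "continuous_on (sphere 0 1) (\<lambda>z. Re (f z))" "continuous_on (sphere 0 1) (\<lambda>z. - Im (f z))"
      by (intro continuous_intros f)+
    obtain p where p: "real_polynomial_function p" "\<And>z. z \<in> sphere 0 1 \<Longrightarrow> \<bar>Re (f z) - p z\<bar> < d"
      using Stone_Weierstrass_real_polynomial_function[OF compact_sphere cont(1) d] by metis
    obtain q where q: "real_polynomial_function q" "\<And>z. z \<in> sphere 0 1 \<Longrightarrow> \<bar>- Im (f z) - q z\<bar> < d"
      using Stone_Weierstrass_real_polynomial_function[OF compact_sphere cont(2) d] by metis
    have cp: "continuous_on S p" "continuous_on S q" for S
      using p(1) q(1) by (auto intro!: continuous_at_imp_continuous_on continuous_real_polymonial_function)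
    define r where "r = (\<lambda>z. complex_of_real (p z) + \<i> * of_real (q z))"
    have cr: "continuous_on S r" for S unfolding r_def by (intro continuous_intros cp)
    have "sphere_integral (\<lambda>z. f z * r z) =
        sphere_integral (\<lambda>z. f z * of_real (p z) + \<i> * (f z * of_real (q z)))"
      by (simp add: r_def algebra_simps)
    also have "\<dots> = sphere_integral (\<lambda>z. f z * of_real (p z)) + \<i> * sphere_integral (\<lambda>z. f z * of_real (q z))"
      by (subst sphere_integral_add) (auto intro!: continuous_intros f cp simp: sphere_integral_cmult)
    also have "\<dots> = 0" using orth p(1) q(1) by simp
    finally have r0: "sphere_integral (\<lambda>z. f z * r z) = 0" .
    have "sphere_integral (\<lambda>z. f z * cnj (f z)) =
        sphere_integral (\<lambda>z. f z * (cnj (f z) - r z) + f z * r z)"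
      by (simp add: algebra_simps)
    also have "\<dots> = sphere_integral (\<lambda>z. f z * (cnj (f z) - r z)) + sphere_integral (\<lambda>z. f z * r z)"
      by (intro sphere_integral_add continuous_intros f cr)
    finally have eq: "sphere_integral (\<lambda>z. f z * cnj (f z)) = sphere_integral (\<lambda>z. f z * (cnj (f z) - r z))"
      by (simp add: r0)
    have "cmod (sphere_integral (\<lambda>z. f z * (cnj (f z) - r z))) \<le> C * (2 * d)"
    proof (rule C(2))
      show "continuous_on (sphere 0 1) (\<lambda>z. cnj (f z) - r z)" by (intro continuous_intros f cr)
      fix z :: 'a assume "norm z = 1"
      then have "\<bar>Re (cnj (f z) - r z)\<bar> < d" "\<bar>Im (cnj (f z) - r z)\<bar> < d"
        using p(2)[of z] q(2)[of z] by (simp_all add: r_def)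
      then show "cmod (cnj (f z) - r z) \<le> 2 * d" using cmod_le[of "cnj (f z) - r z"] by linarith
    qed
    also have "C * (2 * d) = e" using C(1) by (simp add: d_def)
    finally show ?thesis using eq by simp
  qed
  then have "cmod (sphere_integral (\<lambda>z. f z * cnj (f z))) \<le> 0" by (rule field_le_epsilon)
  then show "sphere_integral (\<lambda>z. f z * cnj (f z)) = 0" by simp
qed

section \<open>The Laplacian of homogeneous polynomials\<close>

text \<open>An algebra closed under directional derivatives off the origin, because 1/|x| has
  derivative -(x \<bullet> v)/|x|^3; all its members are therefore smooth there. It contains the
  radial extensions of monomials.\<close>

inductive radial_algebra :: "('a::euclidean_space \<Rightarrow> complex) \<Rightarrow> bool" where
  const: "radial_algebra (\<lambda>_. c)"
| linear: "bounded_linear l \<Longrightarrow> radial_algebra l"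
| inverse_norm: "radial_algebra (\<lambda>x. of_real (inverse (norm x)))"
| add: "radial_algebra f \<Longrightarrow> radial_algebra g \<Longrightarrow> radial_algebra (\<lambda>x. f x + g x)"
| mult: "radial_algebra f \<Longrightarrow> radial_algebra g \<Longrightarrow> radial_algebra (\<lambda>x. f x * g x)"

lemma has_derivative_norm_sgn:
  fixes x :: "'a::euclidean_space"
  assumes "x \<noteq> 0"
  shows "(norm has_derivative (\<lambda>v. sgn x \<bullet> v)) (at x)"
  using has_derivative_norm[OF assms] by (simp add: inner_commute)

lemma has_derivative_inverse_norm:
  fixes x :: "'a::euclidean_space"
  assumes "x \<noteq> 0"
  shows "((\<lambda>x. complex_of_real (inverse (norm x))) has_derivative
    (\<lambda>v. - (of_real (inverse (norm x)) ^ 3 * of_real (x \<bullet> v)))) (at x)"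
proof -
  have "((\<lambda>x. inverse (norm x)) has_derivative (\<lambda>v. - (inverse (norm x) ^ 3 * (x \<bullet> v)))) (at x)"
  proof -
    have "((\<lambda>x. inverse (norm x)) has_derivative (\<lambda>v. - (inverse (norm x) * (sgn x \<bullet> v) * inverse (norm x)))) (at x)"
      using assms by (intro Deriv.has_derivative_inverse) (auto simp: has_derivative_norm_sgn)
    moreover have "inverse (norm x) * (sgn x \<bullet> v) * inverse (norm x) = inverse (norm x) ^ 3 * (x \<bullet> v)" for v
      by (simp add: sgn_div_norm power3_eq_cube)
    ultimately show ?thesis by simp
  qed
  from has_derivative_of_real[OF this, where 'a = complex] show ?thesis by simp
qed

lemma radial_algebra_derivative:
  assumes "radial_algebra g"
  shows "\<exists>g'. (\<forall>v. radial_algebra (g' v)) \<and> (\<forall>x. x \<noteq> 0 \<longrightarrow> (g has_derivative (\<lambda>v. g' v x)) (at x))"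
  using assms
proof induction
  case (const c)
  show ?case by (intro exI[of _ "\<lambda>v x. 0"]) (auto intro: radial_algebra.const)
next
  case (linear l)
  then show ?case
    by (intro exI[of _ "\<lambda>v x. l v"]) (auto intro: radial_algebra.const bounded_linear_imp_has_derivative)
next
  case inverse_norm
  let ?g = "\<lambda>v x::'a. - 1 * (of_real (inverse (norm x)) * (of_real (inverse (norm x)) *
    (of_real (inverse (norm x)) * complex_of_real (x \<bullet> v))))"
  have "radial_algebra (?g v)" for v
    by (intro radial_algebra.mult radial_algebra.const radial_algebra.inverse_norm radial_algebra.linear
        bounded_linear_compose[OF bounded_linear_of_real] bounded_linear_inner_left)
  moreover have "((\<lambda>x. complex_of_real (inverse (norm x))) has_derivative (\<lambda>v. ?g v x)) (at x)" if "x \<noteq> 0" for x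
    using has_derivative_inverse_norm[OF that] by (simp add: power3_eq_cube mult.assoc)
  ultimately show ?case by (intro exI[of _ ?g]) blast
next
  case (add f g)
  then obtain f' g' where "\<And>v. radial_algebra (f' v)" "\<And>v. radial_algebra (g' v)"
    "\<And>x. x \<noteq> 0 \<Longrightarrow> (f has_derivative (\<lambda>v. f' v x)) (at x)"
    "\<And>x. x \<noteq> 0 \<Longrightarrow> (g has_derivative (\<lambda>v. g' v x)) (at x)" by blast
  then show ?case
    by (intro exI[of _ "\<lambda>v x. f' v x + g' v x"]) (auto intro: radial_algebra.add has_derivative_add)
next
  case (mult f g)
  then obtain f' g' where fg: "\<And>v. radial_algebra (f' v)" "\<And>v. radial_algebra (g' v)"
    "\<And>x. x \<noteq> 0 \<Longrightarrow> (f has_derivative (\<lambda>v. f' v x)) (at x)"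
    "\<And>x. x \<noteq> 0 \<Longrightarrow> (g has_derivative (\<lambda>v. g' v x)) (at x)" by blast
  have "radial_algebra (\<lambda>x. f x * g' v x + f' v x * g x)" for v
    by (intro radial_algebra.add radial_algebra.mult fg mult.hyps)
  moreover have "((\<lambda>x. f x * g x) has_derivative (\<lambda>v. f x * g' v x + f' v x * g x)) (at x)" if "x \<noteq> 0" for x
    by (intro has_derivative_mult fg that)
  ultimately show ?case by (intro exI[of _ "\<lambda>v x. f x * g' v x + f' v x * g x"]) blast
qed

lemma differentiable_times_cong:
  assumes "open S" "\<And>x. x \<in> S \<Longrightarrow> f x = g x" "differentiable_times n f S"
  shows "differentiable_times n g S"
  using assms(2,3)
proof (induction n arbitrary: f g)
  case 0
  then show ?case by (auto intro: continuous_on_eq)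
next
  case (Suc n)
  have d: "g differentiable (at x)" if "x \<in> S" for x
  proof -
    have "f differentiable (at x)" using Suc.prems(2) that by simp
    then obtain f' where "(f has_derivative f') (at x)" unfolding differentiable_def by blast
    then have "(g has_derivative f') (at x)"
      by (rule has_derivative_transform_within_open[OF _ assms(1) that]) (rule Suc.prems(1))
    then show ?thesis unfolding differentiable_def by blast
  qed
  have "frechet_derivative f (at x) v = frechet_derivative g (at x) v" if "x \<in> S" for x v
    using frechet_derivative_transform_within_open[of f x S g] Suc.prems that assms(1) by simp
  then have "differentiable_times n (\<lambda>x. frechet_derivative g (at x) v) S" for v
    using Suc.IH[of "\<lambda>x. frechet_derivative f (at x) v" "\<lambda>x. frechet_derivative g (at x) v"] Suc.prems by simp
  then show ?case using d by simp
qed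

lemma radial_algebra_smooth:
  assumes "radial_algebra g"
  shows "differentiable_times n g (- {0})"
  using assms
proof (induction n arbitrary: g)
  case 0
  then obtain g' where "\<And>x. x \<noteq> 0 \<Longrightarrow> (g has_derivative (\<lambda>v. g' v x)) (at x)"
    using radial_algebra_derivative by blast
  then show ?case
    by (auto intro!: continuous_at_imp_continuous_on has_derivative_continuous)
next
  case (Suc n)
  obtain g' where g': "\<And>v. radial_algebra (g' v)" "\<And>x. x \<noteq> 0 \<Longrightarrow> (g has_derivative (\<lambda>v. g' v x)) (at x)"
    using radial_algebra_derivative[OF Suc.prems] by blast
  have "differentiable_times n (\<lambda>x. frechet_derivative g (at x) v) (- {0})" for v
  proof (rule differentiable_times_cong[of _ "g' v"])
    show "g' v x = frechet_derivative g (at x) v" if "x \<in> - {0}" for x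
      using fun_cong[OF frechet_derivative_at[OF g'(2)], of x v] that by simp
  qed (auto intro: Suc.IH g')
  moreover have "g differentiable (at x)" if "x \<noteq> 0" for x using g'(2)[OF that] differentiable_def by blast
  ultimately show ?case by simp
qed

lemma sphere_laplacian_dir_deriv:
  "sphere_laplacian f x = (\<Sum>b\<in>Basis. dir_deriv (dir_deriv (radial_ext f) b) b x)"
  by (simp add: sphere_laplacian_def dir_deriv_def)

lemma dir_deriv_cong_open:
  assumes "open S" "x \<in> S" "\<And>y. y \<in> S \<Longrightarrow> F y = G y" "(G has_derivative G') (at x)"
  shows "(F has_derivative G') (at x)" "dir_deriv F v x = G' v"
proof -
  show F: "(F has_derivative G') (at x)"
    by (rule has_derivative_transform_within_open[OF assms(4,1,2)]) (simp add: assms(3))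
  show "dir_deriv F v x = G' v" by (rule dir_deriv_eq[OF F])
qed

lemma sphere_laplacian_linear:
  fixes f g :: "'a::euclidean_space \<Rightarrow> complex"
  assumes f: "sphere_smooth f" and g: "sphere_smooth g" and x: "norm x = 1"
  shows "sphere_laplacian (\<lambda>z. c * f z + g z) x = c * sphere_laplacian f x + sphere_laplacian g x"
proof -
  have d: "differentiable_times 2 (radial_ext f) (- {0})" "differentiable_times 2 (radial_ext g) (- {0})"
    using f g unfolding sphere_smooth_def by blast+
  have x0: "x \<noteq> 0" using x by auto
  have r: "radial_ext (\<lambda>z. c * f z + g z) = (\<lambda>x. c * radial_ext f x + radial_ext g x)"
    by (simp add: radial_ext_def fun_eq_iff)
  have 1: "dir_deriv (radial_ext (\<lambda>z. c * f z + g z)) b y = c * dir_deriv (radial_ext f) b y + dir_deriv (radial_ext g) b y"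
    if "y \<noteq> 0" for b y
  proof -
    have "(radial_ext (\<lambda>z. c * f z + g z) has_derivative
        (\<lambda>v. c * dir_deriv (radial_ext f) v y + dir_deriv (radial_ext g) v y)) (at y)"
      unfolding r using that
      by (intro has_derivative_add has_derivative_mult_right has_derivative_dir_deriv differentiable_times_2D(1)[OF d(1)]
          differentiable_times_2D(1)[OF d(2)]) auto
    then show ?thesis by (rule dir_deriv_eq)
  qed
  have "dir_deriv (dir_deriv (radial_ext (\<lambda>z. c * f z + g z)) b) b x =
      c * dir_deriv (dir_deriv (radial_ext f) b) b x + dir_deriv (dir_deriv (radial_ext g) b) b x" for b
  proof (rule dir_deriv_cong_open(2)[of "- {0}" _ _
      "\<lambda>y. c * dir_deriv (radial_ext f) b y + dir_deriv (radial_ext g) b y"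
      "\<lambda>v. c * dir_deriv (dir_deriv (radial_ext f) b) v x + dir_deriv (dir_deriv (radial_ext g) b) v x"])
    show "((\<lambda>y. c * dir_deriv (radial_ext f) b y + dir_deriv (radial_ext g) b y) has_derivative
      (\<lambda>v. c * dir_deriv (dir_deriv (radial_ext f) b) v x + dir_deriv (dir_deriv (radial_ext g) b) v x)) (at x)"
      using x0 by (intro has_derivative_add has_derivative_mult_right has_derivative_dir_deriv
          differentiable_times_2D(2)[OF d(1)] differentiable_times_2D(2)[OF d(2)]) auto
  qed (use x0 1 in auto)
  then show ?thesis
    by (simp add: sphere_laplacian_dir_deriv sum.distrib sum_distrib_left)
qed

text \<open>The radial extension is |x|^(-k) p. Its Laplacian at |x| = 1 consists of that of p, of
  mixed terms that are radial derivatives of p and are evaluated by Euler's relation, and of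
  derivatives of |x|^(-k). The last two add up to -k (k + D - 2) p, where D is the real
  dimension.\<close>

lemma sphere_laplacian_homogeneous:
  fixes f p :: "'a::euclidean_space \<Rightarrow> complex"
  assumes p: "\<And>x. (p has_derivative (\<lambda>v. p1 v x)) (at x)"
    and p1: "\<And>v x. (p1 v has_derivative (\<lambda>w. p2 v w x)) (at x)"
    and euler: "\<And>x. p1 x x = of_nat k * p x"
    and f: "\<And>x. x \<noteq> 0 \<Longrightarrow> radial_ext f x = of_real (inverse (norm x)) ^ k * p x"
    and x: "norm x = 1"
  shows "sphere_laplacian f x =
    (\<Sum>b\<in>Basis. p2 b b x) - of_nat k * (of_nat k + of_nat DIM('a) - 2) * p x"
proof -
  let ?r = "\<lambda>x::'a. complex_of_real (inverse (norm x))"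
  have x0: "x \<noteq> 0" using x by auto
  have rk: "((\<lambda>x. ?r x ^ m) has_derivative (\<lambda>v. - (of_nat m * ?r x ^ (m + 2) * of_real (x \<bullet> v)))) (at x)"
    if "x \<noteq> 0" for m x
  proof (induction m)
    case 0
    then show ?case by simp
  next
    case (Suc m)
    have "((\<lambda>x. ?r x * ?r x ^ m) has_derivative (\<lambda>v. ?r x * - (of_nat m * ?r x ^ (m + 2) * of_real (x \<bullet> v)) +
        - (?r x ^ 3 * of_real (x \<bullet> v)) * ?r x ^ m)) (at x)"
      by (intro has_derivative_mult has_derivative_inverse_norm that Suc)
    moreover have "?r x * - (of_nat m * ?r x ^ (m + 2) * of_real (x \<bullet> v)) +
        - (?r x ^ 3 * of_real (x \<bullet> v)) * ?r x ^ m = - (of_nat (Suc m) * ?r x ^ (Suc m + 2) * of_real (x \<bullet> v))" for v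
      by (simp add: algebra_simps power3_eq_cube)
    ultimately show ?case by simp
  qed
  define D where "D = (\<lambda>b x. ?r x ^ k * p1 b x + - (of_nat k * ?r x ^ (k + 2) * of_real (x \<bullet> b)) * p x)"
  have D: "dir_deriv (radial_ext f) b y = D b y" if "y \<noteq> 0" for b y
    unfolding D_def
  proof (rule dir_deriv_cong_open(2)[of "- {0}" y _ "\<lambda>x. ?r x ^ k * p x"
      "\<lambda>b. ?r y ^ k * p1 b y + - (of_nat k * ?r y ^ (k + 2) * of_real (y \<bullet> b)) * p y"])
    show "((\<lambda>x. ?r x ^ k * p x) has_derivative
        (\<lambda>b. ?r y ^ k * p1 b y + - (of_nat k * ?r y ^ (k + 2) * of_real (y \<bullet> b)) * p y)) (at y)"
      by (intro has_derivative_mult rk p that)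
  qed (use that f in auto)
  define D2 where "D2 = (\<lambda>b w. (?r x ^ k * p2 b w x + - (of_nat k * ?r x ^ (k + 2) * of_real (x \<bullet> w)) * p1 b x) +
    (- (of_nat k * ?r x ^ (k + 2) * of_real (x \<bullet> b)) * p1 w x +
     - (of_nat k * ?r x ^ (k + 2) * of_real (w \<bullet> b) +
       of_nat k * - (of_nat (k + 2) * ?r x ^ (k + 2 + 2) * of_real (x \<bullet> w)) * of_real (x \<bullet> b)) * p x))"
  have D2: "dir_deriv (dir_deriv (radial_ext f) b) b x = D2 b b" for b
  proof (rule dir_deriv_cong_open(2)[of "- {0}" x _ "D b" "D2 b"])
    have lin: "((\<lambda>x. complex_of_real (x \<bullet> b)) has_derivative (\<lambda>w. of_real (w \<bullet> b))) (at x)"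
      by (intro has_derivative_of_real has_derivative_inner_left has_derivative_ident)
    show "(D b has_derivative D2 b) (at x)"
      unfolding D_def D2_def
      by (intro has_derivative_add has_derivative_mult has_derivative_minus has_derivative_mult_right rk x0 p p1 lin)
  qed (use x0 D in auto)
  have lin: "linear (\<lambda>v. p1 v x)" using p has_derivative_linear by blast
  have s1: "(\<Sum>b\<in>Basis. of_real (x \<bullet> b) * p1 b x) = of_nat k * p x"
  proof -
    have "p1 (\<Sum>b\<in>Basis. (x \<bullet> b) *\<^sub>R b) x = (\<Sum>b\<in>Basis. (x \<bullet> b) *\<^sub>R p1 b x)"
      by (simp add: linear_sum[OF lin] linear_cmul[OF lin])
    then show ?thesis using euler[of x] by (simp add: euclidean_representation scaleR_conv_of_real)
  qed
  have s2: "(\<Sum>b\<in>Basis. complex_of_real (x \<bullet> b) * of_real (x \<bullet> b)) = 1"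
  proof -
    have "(\<Sum>b\<in>Basis. (x \<bullet> b) * (x \<bullet> b)) = 1"
      using x euclidean_inner[of x x] by (simp add: dot_square_norm)
    then have "complex_of_real (\<Sum>b\<in>Basis. (x \<bullet> b) * (x \<bullet> b)) = 1" by simp
    then show ?thesis by simp
  qed
  have s3: "(\<Sum>b\<in>Basis. complex_of_real ((b::'a) \<bullet> b)) = of_nat DIM('a)" by simp
  have "sphere_laplacian f x = (\<Sum>b\<in>Basis. D2 b b)" by (simp add: sphere_laplacian_dir_deriv D2)
  also have "\<dots> = (\<Sum>b\<in>Basis. p2 b b x - 2 * of_nat k * (of_real (x \<bullet> b) * p1 b x) -
      of_nat k * p x * of_real (b \<bullet> b) + of_nat k * (of_nat k + 2) * p x * (of_real (x \<bullet> b) * of_real (x \<bullet> b)))"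
    by (intro sum.cong refl) (simp add: D2_def x algebra_simps)
  also have "\<dots> = (\<Sum>b\<in>Basis. p2 b b x) - 2 * of_nat k * (\<Sum>b\<in>Basis. of_real (x \<bullet> b) * p1 b x) -
      of_nat k * p x * (\<Sum>b\<in>Basis. of_real ((b::'a) \<bullet> b)) +
      of_nat k * (of_nat k + 2) * p x * (\<Sum>b\<in>Basis. of_real (x \<bullet> b) * of_real (x \<bullet> b))"
    by (simp only: sum.distrib sum_subtractf sum_distrib_left)
  also have "\<dots> = (\<Sum>b\<in>Basis. p2 b b x) - of_nat k * (of_nat k + of_nat DIM('a) - 2) * p x"
    unfolding s1 s2 s3 by (simp add: algebra_simps)
  finally show ?thesis .
qed

section \<open>Monomials in the coordinates and their conjugates\<close>

definition coord :: "complex ^ 'n \<Rightarrow> 'n \<times> bool \<Rightarrow> complex" where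
  "coord z k = (if snd k then z $ fst k else cnj (z $ fst k))"

definition monomial :: "('n::finite \<times> bool \<Rightarrow> nat) \<Rightarrow> complex ^ 'n \<Rightarrow> complex" where
  "monomial u z = (\<Prod>k\<in>UNIV. coord z k ^ u k)"

definition opp :: "'n \<times> bool \<Rightarrow> 'n \<times> bool" where
  "opp k = (fst k, \<not> snd k)"

text \<open>The truncated subtraction at exponent 0 is harmless: in derivatives a lowered monomial
  carries the old exponent as a factor.\<close>

definition decr :: "('k \<Rightarrow> nat) \<Rightarrow> 'k \<Rightarrow> 'k \<Rightarrow> nat" where
  "decr u k = u(k := u k - 1)"

lemma opp_opp [simp]: "opp (opp k) = k" and opp_neq [simp]: "opp k \<noteq> k" "k \<noteq> opp k"
  by (simp_all add: opp_def prod_eq_iff)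

lemma bounded_linear_coord: "bounded_linear (\<lambda>z::complex ^ 'n. coord z k)"
proof (cases "snd k")
  case True
  then show ?thesis by (simp add: coord_def bounded_linear_vec_nth)
next
  case False
  then show ?thesis
    using bounded_linear_compose[OF bounded_linear_cnj bounded_linear_vec_nth, of "fst k"] by (simp add: coord_def)
qed

lemma coord_scaleR: "coord (r *\<^sub>R z) k = of_real r * coord z k"
  by (simp add: coord_def) (simp add: scaleR_conv_of_real)

lemma monomial_upd: "monomial (u(k := m)) z = coord z k ^ m * (\<Prod>j\<in>UNIV - {k}. coord z j ^ u j)"
  unfolding monomial_def by (subst prod.remove[of _ k]) (auto intro!: prod.cong)

lemma coord_times_decr:
  assumes "u k > 0"
  shows "coord z k * monomial (decr u k) z = monomial u z"
proof -
  have "coord z k * monomial (decr u k) z = coord z k ^ Suc (u k - 1) * (\<Prod>j\<in>UNIV - {k}. coord z j ^ u j)"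
    unfolding decr_def monomial_upd by simp
  also have "\<dots> = monomial (u(k := u k)) z" unfolding monomial_upd using assms by simp
  finally show ?thesis by simp
qed

lemma has_derivative_monomial:
  "(monomial u has_derivative (\<lambda>v. \<Sum>k\<in>UNIV. of_nat (u k) * coord v k * monomial (decr u k) z)) (at z)"
proof -
  have c: "((\<lambda>z. coord z k ^ u k) has_derivative (\<lambda>v. of_nat (u k) * coord v k * coord z k ^ (u k - 1))) (at z)" for k
    by (rule has_derivative_power[OF bounded_linear_imp_has_derivative[OF bounded_linear_coord]])
  have "((\<lambda>z. \<Prod>k\<in>UNIV. coord z k ^ u k) has_derivative
    (\<lambda>v. \<Sum>k\<in>UNIV. of_nat (u k) * coord v k * coord z k ^ (u k - 1) * (\<Prod>j\<in>UNIV - {k}. coord z j ^ u j))) (at z)"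
    by (rule has_derivative_prod) (rule c)
  moreover have "monomial u = (\<lambda>z. \<Prod>k\<in>UNIV. coord z k ^ u k)" by (rule ext) (rule monomial_def)
  ultimately show ?thesis by (simp only: decr_def monomial_upd mult.assoc)
qed

lemma monomial_euler:
  "(\<Sum>k\<in>UNIV. of_nat (u k) * coord z k * monomial (decr u k) z) = of_nat (\<Sum>k\<in>UNIV. u k) * monomial u z"
proof -
  have e: "of_nat (u k) * coord z k * monomial (decr u k) z = of_nat (u k) * monomial u z" for k
    using coord_times_decr[of u k z] by (cases "u k > 0") (simp_all add: mult.assoc)
  show ?thesis by (simp only: e sum_distrib_right[symmetric] of_nat_sum)
qed

lemma sum_Basis_vec:
  fixes h :: "complex ^ 'n \<Rightarrow> 'b::comm_monoid_add"
  shows "(\<Sum>b\<in>Basis. h b) = (\<Sum>i\<in>UNIV. h (axis i 1) + h (axis i \<i>))"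
proof -
  have B: "Basis = (\<lambda>(i, c). axis i c :: complex ^ 'n) ` (UNIV \<times> {1, \<i>})"
    by (auto simp: Basis_vec_def Basis_complex_def)
  have "inj_on (\<lambda>(i, c). axis i c :: complex ^ 'n) (UNIV \<times> {1, \<i>})"
    by (auto simp: inj_on_def axis_eq_axis)
  then have "(\<Sum>b\<in>Basis. h b) = (\<Sum>(i, c)\<in>UNIV \<times> {1, \<i>}. h (axis i c))"
    unfolding B by (subst sum.reindex) (simp_all add: case_prod_unfold o_def)
  also have "\<dots> = (\<Sum>i\<in>UNIV. \<Sum>c\<in>{1, \<i>}. h (axis i c))" by (rule sum.cartesian_product[symmetric])
  also have "\<dots> = (\<Sum>i\<in>UNIV. h (axis i 1) + h (axis i \<i>))" by (rule sum.cong) simp_all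
  finally show ?thesis .
qed

text \<open>In each coordinate the directions 1 and \<i> contribute 1 + \<i>^2 = 0 for two equal
  variables and 1 + \<i> cnj \<i> = 2 for conjugate ones. So only mixed derivatives by z_i and its
  conjugate enter the Laplacian.\<close>

lemma sum_Basis_coord:
  "(\<Sum>b\<in>Basis. coord b k * coord b l) = (if l = opp k then 2 else (0::complex))"
proof -
  have c: "coord (axis i c) k = (if i = fst k then (if snd k then c else cnj c) else 0)" for i c and k :: "'a \<times> bool"
    by (auto simp: coord_def axis_def)
  have "(\<Sum>b\<in>Basis. coord b k * coord b l) =
      (\<Sum>i\<in>UNIV. if i = fst k then (if fst l = fst k then (if snd l = snd k then 0 else 2) else 0) else 0)"
    unfolding sum_Basis_vec by (intro sum.cong refl) (auto simp: c)
  also have "\<dots> = (if l = opp k then 2 else 0)" by (cases k; cases l) (auto simp: opp_def)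
  finally show ?thesis .
qed

text \<open>Each mixed derivative is counted from k and from \<open>opp k\<close>, so the
  coefficient 2 amounts to the usual 4 in the complex form of the Laplacian.\<close>

lemma laplacian_monomial:
  fixes z :: "complex ^ 'n::finite"
  shows "(\<Sum>b\<in>Basis. \<Sum>k\<in>UNIV. of_nat (u k) * coord b k *
      (\<Sum>l\<in>UNIV. of_nat (decr u k l) * coord b l * monomial (decr (decr u k) l) z)) =
    (\<Sum>k\<in>UNIV. of_nat (2 * u k * u (opp k)) * monomial (decr (decr u k) (opp k)) z)"
proof -
  let ?m = "\<lambda>k l. of_nat (u k) * of_nat (decr u k l) * monomial (decr (decr u k) l) z"
  have "(\<Sum>b\<in>Basis. \<Sum>k\<in>UNIV. of_nat (u k) * coord b k *
      (\<Sum>l\<in>UNIV. of_nat (decr u k l) * coord b l * monomial (decr (decr u k) l) z)) =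
    (\<Sum>b\<in>Basis. \<Sum>k\<in>UNIV. \<Sum>l\<in>UNIV. ?m k l * (coord b k * coord b l))"
    by (simp add: sum_distrib_left mult_ac)
  also have "\<dots> = (\<Sum>k\<in>UNIV. \<Sum>b\<in>Basis. \<Sum>l\<in>UNIV. ?m k l * (coord b k * coord b l))"
    by (rule sum.swap)
  also have "\<dots> = (\<Sum>k\<in>UNIV. \<Sum>l\<in>UNIV. \<Sum>b\<in>Basis. ?m k l * (coord b k * coord b l))"
    by (intro sum.cong refl sum.swap)
  also have "\<dots> = (\<Sum>k\<in>UNIV. \<Sum>l\<in>UNIV. if l = opp k then 2 * ?m k l else 0)"
    unfolding sum_distrib_left[symmetric] sum_Basis_coord by (intro sum.cong refl) simp
  also have "\<dots> = (\<Sum>k\<in>UNIV. of_nat (2 * u k * u (opp k)) * monomial (decr (decr u k) (opp k)) z)"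
    by (intro sum.cong refl) (simp add: decr_def)
  finally show ?thesis .
qed

text \<open>The value 0 off the sphere follows the convention of \<open>smooth_invariant\<close>, so
  that equality on the sphere is equality of functions.\<close>

definition sphere_monomial :: "('n::finite \<times> bool \<Rightarrow> nat) \<Rightarrow> complex ^ 'n \<Rightarrow> complex" where
  "sphere_monomial u z = (if norm z = 1 then monomial u z else 0)"

lemma monomial_scaleR: "monomial u (r *\<^sub>R z) = of_real r ^ (\<Sum>k\<in>UNIV. u k) * monomial u z"
  by (simp add: monomial_def coord_scaleR power_mult_distrib prod.distrib power_sum)

lemma radial_ext_sphere_monomial:
  assumes "x \<noteq> 0"
  shows "radial_ext (sphere_monomial u) x = of_real (inverse (norm x)) ^ (\<Sum>k\<in>UNIV. u k) * monomial u x"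
  using assms by (simp add: radial_ext_def sphere_monomial_def monomial_scaleR)

text \<open>This is k (k + D - 2) for the real dimension D = 2 d, computed in the complex numbers so
  that the subtraction does not truncate.\<close>

definition eigenvalue :: "nat \<Rightarrow> nat \<Rightarrow> complex" where
  "eigenvalue d k = of_nat k * (of_nat k + 2 * of_nat d - 2)"

text \<open>Triangularity with respect to the degree: the terms subtracted have degree lower by
  2.\<close>

lemma sphere_laplacian_sphere_monomial:
  fixes z :: "complex ^ 'n::finite"
  assumes "norm z = 1"
  shows "- sphere_laplacian (sphere_monomial u) z =
    eigenvalue CARD('n) (\<Sum>k\<in>UNIV. u k) * sphere_monomial u z -
    (\<Sum>k\<in>UNIV. of_nat (2 * u k * u (opp k)) * sphere_monomial (decr (decr u k) (opp k)) z)"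
proof -
  let ?p1 = "\<lambda>v z. \<Sum>k\<in>UNIV. of_nat (u k) * coord v k * monomial (decr u k) z"
  let ?p2 = "\<lambda>v w z. \<Sum>k\<in>UNIV. of_nat (u k) * coord v k *
      (\<Sum>l\<in>UNIV. of_nat (decr u k l) * coord w l * monomial (decr (decr u k) l) z)"
  have "sphere_laplacian (sphere_monomial u) z = (\<Sum>b\<in>Basis. ?p2 b b z) -
    of_nat (\<Sum>k\<in>UNIV. u k) * (of_nat (\<Sum>k\<in>UNIV. u k) + of_nat DIM(complex ^ 'n) - 2) * monomial u z"
  proof (rule sphere_laplacian_homogeneous[where p = "monomial u" and ?p1.0 = ?p1 and ?p2.0 = ?p2])
    show "(monomial u has_derivative (\<lambda>v. ?p1 v x)) (at x)" for x by (rule has_derivative_monomial)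
    show "(?p1 v has_derivative (\<lambda>w. ?p2 v w x)) (at x)" for v x
      by (intro has_derivative_sum has_derivative_mult_right has_derivative_monomial)
    show "?p1 x x = of_nat (\<Sum>k\<in>UNIV. u k) * monomial u x" for x by (rule monomial_euler)
  qed (use assms radial_ext_sphere_monomial in auto)
  then show ?thesis
    unfolding laplacian_monomial using assms
    by (simp add: sphere_monomial_def eigenvalue_def mult.commute[of _ 2] del: of_nat_sum)
qed

text \<open>Agreement is demanded off the origin, which is where \<open>sphere_smooth\<close> looks;
  the value of \<open>radial_ext\<close> at 0 is arbitrary.\<close>

definition radially_algebraic :: "('a::euclidean_space \<Rightarrow> complex) \<Rightarrow> bool" where
  "radially_algebraic f \<longleftrightarrow> (\<exists>g. radial_algebra g \<and> (\<forall>x. x \<noteq> 0 \<longrightarrow> radial_ext f x = g x))"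

lemma radially_algebraic_smooth: "radially_algebraic f \<Longrightarrow> sphere_smooth f"
  unfolding radially_algebraic_def sphere_smooth_def
  by (metis ComplI differentiable_times_cong open_Compl closed_singleton radial_algebra_smooth ComplD singletonI singletonD)

lemma radial_algebra_power: "radial_algebra g \<Longrightarrow> radial_algebra (\<lambda>x. g x ^ n)"
  by (induction n) (auto intro: radial_algebra.const radial_algebra.mult)

lemma radial_algebra_prod:
  "(\<And>k. k \<in> A \<Longrightarrow> radial_algebra (g k)) \<Longrightarrow> radial_algebra (\<lambda>x. \<Prod>k\<in>A. g k x)"
  by (induction A rule: infinite_finite_induct) (auto intro: radial_algebra.const radial_algebra.mult)

lemma radially_algebraic_sphere_monomial: "radially_algebraic (sphere_monomial u)"
  unfolding radially_algebraic_def
proof (intro exI conjI allI impI)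
  show "radial_algebra (\<lambda>x. of_real (inverse (norm x)) ^ (\<Sum>k\<in>UNIV. u k) * monomial u x)"
    unfolding monomial_def
    by (intro radial_algebra.mult radial_algebra_power radial_algebra_prod radial_algebra.inverse_norm
        radial_algebra.linear bounded_linear_coord)
qed (rule radial_ext_sphere_monomial)

lemma radially_algebraic_add:
  assumes "radially_algebraic f" "radially_algebraic g"
  shows "radially_algebraic (\<lambda>z. f z + g z)"
proof -
  obtain f' g' where "radial_algebra f'" "radial_algebra g'"
    "\<And>x. x \<noteq> 0 \<Longrightarrow> radial_ext f x = f' x" "\<And>x. x \<noteq> 0 \<Longrightarrow> radial_ext g x = g' x"
    using assms unfolding radially_algebraic_def by blast
  then show ?thesis unfolding radially_algebraic_def
    by (intro exI[of _ "\<lambda>x. f' x + g' x"]) (auto simp: radial_ext_def intro: radial_algebra.add)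
qed

lemma radially_algebraic_cmult:
  assumes "radially_algebraic f"
  shows "radially_algebraic (\<lambda>z. c * f z)"
proof -
  obtain f' where "radial_algebra f'" "\<And>x. x \<noteq> 0 \<Longrightarrow> radial_ext f x = f' x"
    using assms unfolding radially_algebraic_def by blast
  then show ?thesis unfolding radially_algebraic_def
    by (intro exI[of _ "\<lambda>x. c * f' x"]) (auto simp: radial_ext_def intro: radial_algebra.mult radial_algebra.const)
qed

lemma radially_algebraic_0: "radially_algebraic (\<lambda>z. 0)"
  unfolding radially_algebraic_def
  by (intro exI[of _ "\<lambda>x. 0"]) (auto simp: radial_ext_def intro: radial_algebra.const)

lemma sphere_laplacian_cnj:
  fixes f :: "'a::euclidean_space \<Rightarrow> complex"
  assumes f: "sphere_smooth f" and x: "norm x = 1"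
  shows "sphere_laplacian (\<lambda>z. cnj (f z)) x = cnj (sphere_laplacian f x)"
proof -
  have d: "differentiable_times 2 (radial_ext f) (- {0})" using f unfolding sphere_smooth_def by blast
  have x0: "x \<noteq> 0" using x by auto
  have r: "radial_ext (\<lambda>z. cnj (f z)) = (\<lambda>x. cnj (radial_ext f x))" by (simp add: radial_ext_def fun_eq_iff)
  have 1: "dir_deriv (radial_ext (\<lambda>z. cnj (f z))) b y = cnj (dir_deriv (radial_ext f) b y)" if "y \<noteq> 0" for b y
  proof -
    have "(radial_ext (\<lambda>z. cnj (f z)) has_derivative (\<lambda>v. cnj (dir_deriv (radial_ext f) v y))) (at y)"
      unfolding r using that
      by (intro bounded_linear.has_derivative[OF bounded_linear_cnj] has_derivative_dir_deriv differentiable_times_2D(1)[OF d]) auto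
    then show ?thesis by (rule dir_deriv_eq)
  qed
  have "dir_deriv (dir_deriv (radial_ext (\<lambda>z. cnj (f z))) b) b x = cnj (dir_deriv (dir_deriv (radial_ext f) b) b x)" for b
  proof (rule dir_deriv_cong_open(2)[of "- {0}" _ _ "\<lambda>y. cnj (dir_deriv (radial_ext f) b y)"
      "\<lambda>v. cnj (dir_deriv (dir_deriv (radial_ext f) b) v x)"])
    show "((\<lambda>y. cnj (dir_deriv (radial_ext f) b y)) has_derivative
      (\<lambda>v. cnj (dir_deriv (dir_deriv (radial_ext f) b) v x))) (at x)"
      using x0 by (intro bounded_linear.has_derivative[OF bounded_linear_cnj] has_derivative_dir_deriv
          differentiable_times_2D(2)[OF d]) auto
  qed (use x0 1 in auto)
  then show ?thesis by (simp add: sphere_laplacian_dir_deriv)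
qed

section \<open>Linear independence of monomials\<close>

lemma monomial_nonzero: "(\<And>i. z $ i \<noteq> 0) \<Longrightarrow> monomial u z \<noteq> 0"
  by (simp add: monomial_def coord_def)

text \<open>With all coordinates but one equal to 1, a monomial becomes t^a cnj t^c. Different
  degrees a + c are told apart by a modulus, equal degrees by a phase.\<close>

lemma monomials_distinct:
  fixes u v :: "'n::finite \<times> bool \<Rightarrow> nat"
  assumes "u \<noteq> v"
  obtains w :: "complex ^ 'n" where "\<And>i. w $ i \<noteq> 0" "monomial u w \<noteq> monomial v w"
proof -
  define W :: "'n \<Rightarrow> complex \<Rightarrow> complex ^ 'n" where "W = (\<lambda>i t. \<chi> j. if j = i then t else 1)"
  have W: "monomial u (W i t) = t ^ u (i, True) * cnj t ^ u (i, False)" for u :: "'n \<times> bool \<Rightarrow> nat" and i t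
  proof -
    have "monomial u (W i t) = (\<Prod>k\<in>{(i, True), (i, False)}. coord (W i t) k ^ u k)"
      unfolding monomial_def by (intro prod.mono_neutral_right) (auto simp: W_def coord_def)
    then show ?thesis by (simp add: W_def coord_def)
  qed
  obtain i b where ib: "u (i, b) \<noteq> v (i, b)" using assms by (metis ext surj_pair)
  define a c a' c' where "a = u (i, True)" and "c = u (i, False)" and "a' = v (i, True)" and "c' = v (i, False)"
  show thesis
  proof (cases "a + c = a' + c'")
    case False
    have "(2::real) ^ (a + c) \<noteq> 2 ^ (a' + c')" using False by simp
    then have "complex_of_real (2 ^ (a + c)) \<noteq> complex_of_real (2 ^ (a' + c'))" by (simp only: of_real_eq_iff not_False_eq_True)
    then have "monomial u (W i 2) \<noteq> monomial v (W i 2)"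
      unfolding W by (simp add: a_def c_def a'_def c'_def power_add)
    then show thesis by (intro that[of "W i 2"]) (auto simp: W_def)
  next
    case True
    define n where "n = (real a - real c) - (real a' - real c')"
    have n0: "n \<noteq> 0"
    proof
      assume "n = 0"
      then have "real a + real c' = real a' + real c" by (simp add: n_def)
      then have "a + c' = a' + c" by (metis of_nat_add of_nat_eq_iff)
      then have "a = a'" "c = c'" using True by auto
      then show False using ib by (cases b) (auto simp: a_def c_def a'_def c'_def)
    qed
    \<comment> \<open>\<open>n\<close> is the difference of the winding numbers a - c and a' - c',
      so at this phase the two monomials take opposite values.\<close>
    define t where "t = cis (pi / n)"
    have p: "t ^ m * cnj t ^ m' = cis ((real m - real m') * (pi / n))" for m m'
    proof -
      have "t ^ m * cnj t ^ m' = cis (real m * (pi / n) + real m' * - (pi / n))"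
        by (simp only: t_def cis_cnj Complex.DeMoivre cis_mult)
      then show ?thesis by (simp add: left_diff_distrib diff_divide_distrib)
    qed
    have "monomial u (W i t) = cis ((real a - real c) * (pi / n))"
      "monomial v (W i t) = cis ((real a' - real c') * (pi / n))"
      unfolding W p by (simp_all add: a_def c_def a'_def c'_def)
    moreover have "(real a - real c) * (pi / n) = pi + (real a' - real c') * (pi / n)"
    proof -
      have "(real a - real c) = n + (real a' - real c')" by (simp add: n_def)
      then show ?thesis using n0 by (simp only: distrib_right) simp
    qed
    then have "cis ((real a - real c) * (pi / n)) = - cis ((real a' - real c') * (pi / n))"
      by (simp add: cis_mult[symmetric])
    ultimately have "monomial u (W i t) = - monomial v (W i t)" by simp
    moreover have nz: "W i t $ j \<noteq> 0" for j by (simp add: W_def t_def)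
    ultimately have "monomial u (W i t) \<noteq> monomial v (W i t)"
      using monomial_nonzero[OF nz, of v] by simp
    then show thesis using nz by (intro that[of "W i t"])
  qed
qed

text \<open>Dedekind's independence of characters, for the characters \<open>monomial u\<close> of the torus.\<close>

lemma monomials_independent:
  fixes c :: "('n::finite \<times> bool \<Rightarrow> nat) \<Rightarrow> complex"
  assumes "finite U" "\<And>z. (\<And>i. z $ i \<noteq> 0) \<Longrightarrow> (\<Sum>u\<in>U. c u * monomial u z) = 0" "u \<in> U"
  shows "c u = 0"
  using assms
proof (induction "card U" arbitrary: U c u rule: less_induct)
  case less
  show ?case
  proof (cases "U = {u}")
    case True
    have "c u * monomial u (\<chi> i. 1) = 0" using less.prems(2)[of "\<chi> i. 1"] True by simp
    moreover have "monomial u (\<chi> i. 1) \<noteq> 0" by (intro monomial_nonzero) simp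
    ultimately show ?thesis by simp
  next
    case False
    then obtain v where v: "v \<in> U" "v \<noteq> u" using less.prems(3) by blast
    obtain w :: "complex ^ 'n" where w: "\<And>i. w $ i \<noteq> 0" "monomial u w \<noteq> monomial v w"
      using monomials_distinct[of u v] v(2) by metis
    \<comment> \<open>The relation at the coordinatewise product of w and z, minus
      \<open>monomial v w\<close> times the relation at z, no longer contains v; the coefficient of
      u is only multiplied by a nonzero number.\<close>
    let ?c = "\<lambda>x. c x * (monomial x w - monomial v w)"
    have "?c u = 0"
    proof (rule less.hyps[of "U - {v}" _ u])
      show "card (U - {v}) < card U" using v less.prems(1) by (intro card_Diff1_less)
      show "(\<Sum>x\<in>U - {v}. ?c x * monomial x z) = 0" if z: "\<And>i. z $ i \<noteq> 0" for z :: "complex ^ 'n"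
      proof -
        let ?y = "\<chi> i. w $ i * z $ i"
        have my: "monomial x ?y = monomial x w * monomial x z" for x
          unfolding monomial_def prod.distrib[symmetric]
          by (intro prod.cong refl) (simp add: coord_def power_mult_distrib)
        have "(\<Sum>x\<in>U. ?c x * monomial x z) =
            (\<Sum>x\<in>U. c x * monomial x ?y) - monomial v w * (\<Sum>x\<in>U. c x * monomial x z)"
          by (simp add: my sum_distrib_left sum_subtractf[symmetric] algebra_simps)
        also have "\<dots> = 0" using less.prems(2)[of ?y] less.prems(2)[of z] z w(1) by simp
        finally have "(\<Sum>x\<in>U. ?c x * monomial x z) = 0" .
        moreover have "(\<Sum>x\<in>U. ?c x * monomial x z) = ?c v * monomial v z + (\<Sum>x\<in>U - {v}. ?c x * monomial x z)"
          using v less.prems(1) by (intro sum.remove) auto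
        ultimately show ?thesis by simp
      qed
    qed (use less.prems v in auto)
    then show ?thesis using w(2) by simp
  qed
qed

section \<open>Spherical harmonics\<close>

interpretation fs: vector_space "\<lambda>(c::complex) (f :: 'a \<Rightarrow> complex) z. c * f z"
  by (rule vector_space_complex_fun)

lemma sum_fun_apply: "(\<Sum>k\<in>A. F k) z = (\<Sum>k\<in>A. F k z)"
  for F :: "'k \<Rightarrow> 'a \<Rightarrow> complex"
  by (induction A rule: infinite_finite_induct) auto

definition deg_expts :: "(('n::finite \<times> bool \<Rightarrow> nat) \<Rightarrow> bool) \<Rightarrow> nat \<Rightarrow> ('n \<times> bool \<Rightarrow> nat) set" where
  "deg_expts P k = {u. (\<Sum>l\<in>UNIV. u l) = k \<and> P u}"

definition incr :: "('n \<times> bool \<Rightarrow> nat) \<Rightarrow> 'n \<times> bool \<Rightarrow> 'n \<times> bool \<Rightarrow> nat" where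
  "incr u k = (u(k := Suc (u k)))(opp k := Suc (u (opp k)))"

text \<open>Closure under multiplying by z_i times its conjugate and under cancelling this product:
  exactly what multiplication by |z|^2 and the Laplacian do to exponents.\<close>

definition opp_closed :: "(('n \<times> bool \<Rightarrow> nat) \<Rightarrow> bool) \<Rightarrow> bool" where
  "opp_closed P \<longleftrightarrow> (\<forall>u k. P (incr u k) = P u)"

definition hom_polys :: "(('n::finite \<times> bool \<Rightarrow> nat) \<Rightarrow> bool) \<Rightarrow> nat \<Rightarrow> (complex ^ 'n \<Rightarrow> complex) set" where
  "hom_polys P k = fs.span (sphere_monomial ` deg_expts P k)"

text \<open>Spherical harmonics of degree k, characterized by their eigenvalue equation, which
  depends on the function on the sphere and not on the polynomial that represents it.\<close>

definition harmonics :: "(('n::finite \<times> bool \<Rightarrow> nat) \<Rightarrow> bool) \<Rightarrow> nat \<Rightarrow> (complex ^ 'n \<Rightarrow> complex) set" where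
  "harmonics P k = {h \<in> hom_polys P k. \<forall>z. norm z = 1 \<longrightarrow>
     - sphere_laplacian h z = eigenvalue CARD('n) k * h z}"

text \<open>The degrees are k - 2, k - 4 and so on; \<open>Suc i\<close> excludes k itself.\<close>

definition lower_harmonics :: "(('n::finite \<times> bool \<Rightarrow> nat) \<Rightarrow> bool) \<Rightarrow> nat \<Rightarrow> (complex ^ 'n \<Rightarrow> complex) set" where
  "lower_harmonics P k = fs.span (\<Union>j\<in>{j. \<exists>i. j + 2 * Suc i = k}. harmonics P j)"

lemma finite_deg_expts: "finite (deg_expts P k)"
proof (rule finite_subset)
  show "deg_expts P k \<subseteq> (UNIV \<rightarrow>\<^sub>E {..k})"
    by (auto simp: deg_expts_def PiE_def intro: member_le_sum)
  show "finite ((UNIV :: ('a \<times> bool) set) \<rightarrow>\<^sub>E {..k})"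
    by (intro finite_PiE) auto
qed

lemma incr_eq: "incr u k = (u(k := Suc (u k)))(opp k := Suc ((u(k := Suc (u k))) (opp k)))"
  by (simp add: incr_def)

lemma sum_incr:
  fixes u :: "'n::finite \<times> bool \<Rightarrow> nat"
  shows "(\<Sum>l\<in>UNIV. incr u k l) = (\<Sum>l\<in>UNIV. u l) + 2"
proof -
  have "(\<Sum>l\<in>UNIV. incr u k l) = Suc (\<Sum>l\<in>UNIV. (u(k := Suc (u k))) l)"
    unfolding incr_eq by (rule sum_fun_upd_Suc(1))
  also have "\<dots> = Suc (Suc (\<Sum>l\<in>UNIV. u l))" by (simp only: sum_fun_upd_Suc(1))
  finally show ?thesis by simp
qed

lemma opp_closedD: "opp_closed P \<Longrightarrow> P (incr u k) = P u"
  unfolding opp_closed_def by blast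

lemma decr_decr_incr: "decr (decr (incr u k) k) (opp k) = u"
  by (auto simp: decr_def incr_def fun_eq_iff)

lemma incr_decr_decr:
  assumes "u k > 0" "u (opp k) > 0"
  shows "incr (decr (decr u k) (opp k)) k = u"
  using assms by (auto simp: decr_def incr_def fun_eq_iff)

lemma monomial_incr: "monomial (incr u k) z = coord z k * coord z (opp k) * monomial u z"
proof -
  have "monomial (incr u k) z = coord z k * monomial (decr (incr u k) k) z"
    by (rule coord_times_decr[symmetric]) (simp add: incr_def)
  also have "monomial (decr (incr u k) k) z = coord z (opp k) * monomial (decr (decr (incr u k) k) (opp k)) z"
    by (rule coord_times_decr[symmetric]) (simp add: incr_def decr_def)
  finally show ?thesis by (simp add: decr_decr_incr)
qed

lemma deg_expts_incr: "opp_closed P \<Longrightarrow> u \<in> deg_expts P k \<Longrightarrow> incr u l \<in> deg_expts P (k + 2)"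
  by (simp add: deg_expts_def sum_incr opp_closedD)

lemma deg_expts_decr_decr:
  assumes "opp_closed P" "u \<in> deg_expts P k" "u l > 0" "u (opp l) > 0"
  shows "k \<ge> 2 \<and> decr (decr u l) (opp l) \<in> deg_expts P (k - 2)"
proof -
  have "incr (decr (decr u l) (opp l)) l \<in> deg_expts P k" using incr_decr_decr assms by metis
  then show ?thesis by (auto simp: deg_expts_def sum_incr opp_closedD[OF assms(1)])
qed

text \<open>Multiplication by |z|^2 = 1. On the sphere the polynomials of degree k therefore contain
  those of degree k - 2.\<close>

lemma sphere_monomial_eq_sum_incr:
  "sphere_monomial u = (\<Sum>i\<in>UNIV. sphere_monomial (incr u (i, True)))"
proof
  fix z :: "complex ^ 'a"
  show "sphere_monomial u z = (\<Sum>i\<in>UNIV. sphere_monomial (incr u (i, True))) z"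
  proof (cases "norm z = 1")
    case True
    have c: "coord z (i, True) * coord z (opp (i, True)) = of_real ((cmod (z $ i))\<^sup>2)" for i
      unfolding complex_norm_square by (simp add: coord_def opp_def)
    have "(\<Sum>i\<in>UNIV. (cmod (z $ i))\<^sup>2) = 1"
      using True by (simp add: norm_vec_def L2_set_def)
    then have "of_real (\<Sum>i\<in>UNIV. (cmod (z $ i))\<^sup>2) * monomial u z = monomial u z" by simp
    then show ?thesis
      by (simp only: sum_fun_apply sphere_monomial_def monomial_incr c True simp_thms if_True of_real_sum sum_distrib_right)
  qed (simp add: sum_fun_apply sphere_monomial_def)
qed

lemma hom_polys_subspace: "fs.subspace (hom_polys P k)"
  unfolding hom_polys_def by (rule fs.subspace_span)

lemma sphere_monomial_in_hom_polys: "u \<in> deg_expts P k \<Longrightarrow> sphere_monomial u \<in> hom_polys P k"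
  unfolding hom_polys_def by (rule fs.span_base) (rule imageI)

lemma hom_polys_minimal:
  assumes "f \<in> hom_polys P k" "fs.subspace V" "\<And>u. u \<in> deg_expts P k \<Longrightarrow> sphere_monomial u \<in> V"
  shows "f \<in> V"
  using assms(1) fs.span_minimal[of "sphere_monomial ` deg_expts P k" V] assms(2,3)
  unfolding hom_polys_def by blast

lemma hom_polys_mono2:
  assumes "opp_closed P"
  shows "hom_polys P k \<subseteq> hom_polys P (k + 2)"
proof
  fix f assume "f \<in> hom_polys P k"
  then show "f \<in> hom_polys P (k + 2)"
  proof (rule hom_polys_minimal[OF _ hom_polys_subspace])
    fix u :: "'a \<times> bool \<Rightarrow> nat" assume u: "u \<in> deg_expts P k"
    have "(\<Sum>i\<in>UNIV. sphere_monomial (incr u (i, True))) \<in> hom_polys P (k + 2)"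
      by (intro fs.subspace_sum hom_polys_subspace sphere_monomial_in_hom_polys deg_expts_incr assms u)
    then show "sphere_monomial u \<in> hom_polys P (k + 2)" by (simp only: sphere_monomial_eq_sum_incr[symmetric])
  qed
qed

lemma hom_polys_mono:
  assumes "opp_closed P"
  shows "hom_polys P k \<subseteq> hom_polys P (k + 2 * i)"
proof (induction i)
  case (Suc i)
  then show ?case using hom_polys_mono2[OF assms, of "k + 2 * i"] by (simp add: algebra_simps)
qed simp

definition sphere_functions :: "('a::euclidean_space \<Rightarrow> complex) set" where
  "sphere_functions = {f. radially_algebraic f \<and> (\<forall>z. norm z \<noteq> 1 \<longrightarrow> f z = 0)}"

lemma sphere_functions_subspace: "fs.subspace sphere_functions"
proof (rule fs.subspaceI)
  show "0 \<in> sphere_functions"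
    using radially_algebraic_0 by (simp add: sphere_functions_def zero_fun_def)
  show "x + y \<in> sphere_functions" if "x \<in> sphere_functions" "y \<in> sphere_functions" for x y :: "'a \<Rightarrow> complex"
    using that radially_algebraic_add[of x y] by (simp add: sphere_functions_def plus_fun_def)
  show "(\<lambda>z. c * x z) \<in> sphere_functions" if "x \<in> sphere_functions" for c and x :: "'a \<Rightarrow> complex"
    using that radially_algebraic_cmult[of x c] by (simp add: sphere_functions_def)
qed

lemma hom_polys_sphere_functions: "hom_polys P k \<subseteq> sphere_functions"
proof
  fix f assume "f \<in> hom_polys P k"
  then show "f \<in> sphere_functions"
    by (rule hom_polys_minimal[OF _ sphere_functions_subspace])
      (simp add: sphere_functions_def radially_algebraic_sphere_monomial sphere_monomial_def)
qed

lemma sphere_functions_smooth: "f \<in> sphere_functions \<Longrightarrow> sphere_smooth f"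
  by (simp add: sphere_functions_def radially_algebraic_smooth)

lemma hom_polys_smooth: "f \<in> hom_polys P k \<Longrightarrow> sphere_smooth f"
  by (rule sphere_functions_smooth) (rule subsetD[OF hom_polys_sphere_functions])

lemma sphere_laplacian_0: "norm x = 1 \<Longrightarrow> sphere_laplacian (\<lambda>z. 0) x = 0"
  using sphere_laplacian_linear[of "\<lambda>z. 0" "\<lambda>z. 0" x 0] radially_algebraic_smooth[OF radially_algebraic_0]
    sphere_laplacian_linear[of "\<lambda>z. 0" "\<lambda>z. 0" x 1] by simp

lemma harmonics_subspace: "fs.subspace (harmonics P k)"
proof (rule fs.subspaceI)
  show "0 \<in> harmonics P k"
    using fs.subspace_0[OF hom_polys_subspace, of P k] by (simp add: harmonics_def zero_fun_def sphere_laplacian_0)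
next
  fix x y assume "x \<in> harmonics P k" "y \<in> harmonics P k"
  then have xy: "x \<in> hom_polys P k" "y \<in> hom_polys P k"
    "\<And>z. norm z = 1 \<Longrightarrow> - sphere_laplacian x z = eigenvalue CARD('a) k * x z"
    "\<And>z. norm z = 1 \<Longrightarrow> - sphere_laplacian y z = eigenvalue CARD('a) k * y z"
    by (auto simp: harmonics_def)
  have "- sphere_laplacian (\<lambda>z. 1 * x z + y z) z = eigenvalue CARD('a) k * (1 * x z + y z)" if "norm z = 1" for z
    using sphere_laplacian_linear[OF hom_polys_smooth[OF xy(1)] hom_polys_smooth[OF xy(2)] that, of 1] xy(3,4)[OF that]
    by (simp add: algebra_simps)
  then show "x + y \<in> harmonics P k"
    using fs.subspace_add[OF hom_polys_subspace xy(1,2)] by (simp add: harmonics_def plus_fun_def)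
next
  fix c x assume "x \<in> harmonics P k"
  then have x: "x \<in> hom_polys P k" "\<And>z. norm z = 1 \<Longrightarrow> - sphere_laplacian x z = eigenvalue CARD('a) k * x z"
    by (auto simp: harmonics_def)
  have "- sphere_laplacian (\<lambda>z. c * x z) z = eigenvalue CARD('a) k * (c * x z)" if z: "norm z = 1" for z
  proof -
    have "- sphere_laplacian (\<lambda>z. c * x z) z = c * (- sphere_laplacian x z)"
      using sphere_laplacian_linear[OF hom_polys_smooth[OF x(1)] radially_algebraic_smooth[OF radially_algebraic_0] z, of c]
        sphere_laplacian_0[OF z] by simp
    then show ?thesis unfolding x(2)[OF z] by simp
  qed
  then show "(\<lambda>z. c * x z) \<in> harmonics P k"
    using fs.subspace_scale[OF hom_polys_subspace x(1)] by (simp add: harmonics_def)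
qed

lemma eigenvalue_eq:
  assumes "d > 0"
  shows "eigenvalue d k = of_nat (k * (k + (2 * d - 2)))"
  using assms by (cases d) (simp_all add: eigenvalue_def algebra_simps)

lemma eigenvalue_strict_mono:
  fixes d j k :: nat
  assumes "d > 0" "j < k"
  shows "j * (j + (2 * d - 2)) < k * (k + (2 * d - 2))"
proof -
  have "j * (j + (2 * d - 2)) \<le> j * (k + (2 * d - 2))" using assms(2) by (intro mult_left_mono) auto
  also have "\<dots> < k * (k + (2 * d - 2))" using assms(2) by (intro mult_strict_right_mono) auto
  finally show ?thesis .
qed

lemma eigenvalue_inj:
  assumes "d > 0" "eigenvalue d j = eigenvalue d k"
  shows "j = k"
proof -
  have "j * (j + (2 * d - 2)) = k * (k + (2 * d - 2))"
    using assms(2) unfolding eigenvalue_eq[OF assms(1)] of_nat_eq_iff .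
  then show ?thesis using eigenvalue_strict_mono[OF assms(1)] by (metis less_irrefl linorder_neqE_nat)
qed

lemma lower_harmonics_subset:
  assumes "opp_closed P"
  shows "lower_harmonics P k \<subseteq> hom_polys P (k - 2)"
  unfolding lower_harmonics_def
proof (rule fs.span_minimal[OF _ hom_polys_subspace])
  show "(\<Union>j\<in>{j. \<exists>i. j + 2 * Suc i = k}. harmonics P j) \<subseteq> hom_polys P (k - 2)"
  proof clarify
    fix j i f assume "f \<in> harmonics P j"
    then show "f \<in> hom_polys P (j + 2 * Suc i - 2)"
      using hom_polys_mono[OF assms, of j i] by (auto simp: harmonics_def)
  qed
qed

lemma lower_harmonics_small: "k < 2 \<Longrightarrow> lower_harmonics P k = {0}"
  unfolding lower_harmonics_def by (subst fs.span_empty[symmetric]) (auto intro: arg_cong[of _ _ fs.span])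

lemma lower_harmonics_subspace: "fs.subspace (lower_harmonics P k)"
  unfolding lower_harmonics_def by (rule fs.subspace_span)

lemma lower_harmonics_mono: "k \<ge> 2 \<Longrightarrow> lower_harmonics P (k - 2) \<subseteq> lower_harmonics P k"
  unfolding lower_harmonics_def
proof (rule fs.span_mono)
  assume k: "k \<ge> 2"
  have "\<exists>i'. j + 2 * Suc i' = k" if "j + 2 * Suc i = k - 2" for i j
    using that k by (intro exI[of _ "Suc i"]) simp
  then show "(\<Union>j\<in>{j. \<exists>i. j + 2 * Suc i = k - 2}. harmonics P j) \<subseteq> (\<Union>j\<in>{j. \<exists>i. j + 2 * Suc i = k}. harmonics P j)"
    by blast
qed

lemma harmonics_lower:
  assumes "k \<ge> 2"
  shows "harmonics P (k - 2) \<subseteq> lower_harmonics P k"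
proof -
  have "\<exists>i. k - 2 + 2 * Suc i = k" using assms by (intro exI[of _ 0]) simp
  then have "harmonics P (k - 2) \<subseteq> (\<Union>j\<in>{j. \<exists>i. j + 2 * Suc i = k}. harmonics P j)" by blast
  then show ?thesis unfolding lower_harmonics_def using fs.span_superset by (rule order_trans)
qed

text \<open>On the lower harmonics the operator is diagonal, and its entries are nonzero because
  distinct degrees have distinct eigenvalues.\<close>

lemma lower_harmonics_solve:
  fixes R :: "complex ^ 'n::finite \<Rightarrow> complex"
  assumes P: "opp_closed P" and R: "R \<in> lower_harmonics P k"
  shows "\<exists>q\<in>lower_harmonics P k. \<forall>z. norm z = 1 \<longrightarrow> - sphere_laplacian q z - eigenvalue CARD('n) k * q z = R z"
  using R unfolding lower_harmonics_def
proof (induction R rule: fs.span_induct_alt)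
  case base
  show ?case
    by (intro bexI[of _ 0] fs.span_zero) (simp add: zero_fun_def sphere_laplacian_0)
next
  case (step c x y)
  then obtain j i where j: "j + 2 * Suc i = k" "x \<in> harmonics P j" by blast
  let ?U = "\<Union>j\<in>{j. \<exists>i. j + 2 * Suc i = k}. harmonics P j"
  obtain q where q: "q \<in> fs.span ?U"
    "\<And>z. norm z = 1 \<Longrightarrow> - sphere_laplacian q z - eigenvalue CARD('n) k * q z = y z" using step.IH by blast
  have "eigenvalue CARD('n) j \<noteq> eigenvalue CARD('n) k"
  proof
    assume "eigenvalue CARD('n) j = eigenvalue CARD('n) k"
    then have "j = k" by (rule eigenvalue_inj[rotated]) simp
    then show False using j(1) by simp
  qed
  then have nz: "eigenvalue CARD('n) j - eigenvalue CARD('n) k \<noteq> 0" by simp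
  define a where "a = c / (eigenvalue CARD('n) j - eigenvalue CARD('n) k)"
  have ac: "a * (eigenvalue CARD('n) j - eigenvalue CARD('n) k) = c" using nz by (simp add: a_def)
  have qs: "sphere_smooth q"
    using q(1) lower_harmonics_subset[OF P, of k] hom_polys_smooth unfolding lower_harmonics_def by blast
  have xs: "sphere_smooth x" "\<And>z. norm z = 1 \<Longrightarrow> - sphere_laplacian x z = eigenvalue CARD('n) j * x z"
    using j(2) hom_polys_smooth by (auto simp: harmonics_def)
  have "(\<lambda>z. a * x z) + q \<in> fs.span ?U"
    using j step.hyps by (intro fs.span_add fs.span_scale q(1) fs.span_base) auto
  moreover have "- sphere_laplacian ((\<lambda>z. a * x z) + q) z - eigenvalue CARD('n) k * ((\<lambda>z. a * x z) + q) z =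
      ((\<lambda>z. c * x z) + y) z" if z: "norm z = 1" for z
  proof -
    have "- sphere_laplacian ((\<lambda>z. a * x z) + q) z - eigenvalue CARD('n) k * ((\<lambda>z. a * x z) + q) z =
        a * (- sphere_laplacian x z) - a * eigenvalue CARD('n) k * x z +
        (- sphere_laplacian q z - eigenvalue CARD('n) k * q z)"
      using sphere_laplacian_linear[OF xs(1) qs z, of a] by (simp add: plus_fun_def algebra_simps)
    also have "\<dots> = a * (eigenvalue CARD('n) j - eigenvalue CARD('n) k) * x z + y z"
      unfolding xs(2)[OF z] q(2)[OF z] by (simp add: algebra_simps)
    finally show ?thesis unfolding ac by simp
  qed
  ultimately show ?case by blast
qed

text \<open>The eigenvalue equation for degree k fails on a monomial only by a term R of degree k -
  2, which by induction is a sum of lower harmonics. Adding the lower solution q for R makes the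
  monomial harmonic.\<close>

lemma hom_polys_decomposition:
  fixes f :: "complex ^ 'n::finite \<Rightarrow> complex"
  assumes P: "opp_closed P" and "f \<in> hom_polys P k"
  shows "\<exists>h\<in>harmonics P k. \<exists>q\<in>lower_harmonics P k. f = h + q"
  using assms(2)
proof (induction k arbitrary: f rule: less_induct)
  case (less k)
  have sum_sub: "fs.subspace {h + q | h q. h \<in> harmonics P k \<and> q \<in> lower_harmonics P k}"
    by (rule fs.subspace_sums[OF harmonics_subspace lower_harmonics_subspace])
  have "f \<in> {h + q | h q. h \<in> harmonics P k \<and> q \<in> lower_harmonics P k}"
  proof (rule hom_polys_minimal[OF less.prems sum_sub])
    fix u assume u: "u \<in> deg_expts P k"
    define R where "R = (\<Sum>l\<in>UNIV. (\<lambda>z. of_nat (2 * u l * u (opp l)) * sphere_monomial (decr (decr u l) (opp l)) z))"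
    have "R \<in> lower_harmonics P k"
      unfolding R_def
    proof (rule fs.subspace_sum[OF lower_harmonics_subspace])
      fix l
      show "(\<lambda>z. of_nat (2 * u l * u (opp l)) * sphere_monomial (decr (decr u l) (opp l)) z) \<in> lower_harmonics P k"
      proof (cases "u l > 0 \<and> u (opp l) > 0")
        case True
        then have k: "k \<ge> 2" "decr (decr u l) (opp l) \<in> deg_expts P (k - 2)" using deg_expts_decr_decr[OF P u, of l] by auto
        then obtain h q where hq: "h \<in> harmonics P (k - 2)" "q \<in> lower_harmonics P (k - 2)"
          "sphere_monomial (decr (decr u l) (opp l)) = h + q"
          using less.IH[of "k - 2"] sphere_monomial_in_hom_polys[OF k(2)] by fastforce
        have "h + q \<in> lower_harmonics P k"
          using hq harmonics_lower[OF k(1)] lower_harmonics_mono[OF k(1)] by (intro fs.subspace_add lower_harmonics_subspace) auto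
        then show ?thesis unfolding hq(3)[symmetric] by (rule fs.subspace_scale[OF lower_harmonics_subspace])
      next
        case False
        then have "(\<lambda>z. of_nat (2 * u l * u (opp l)) * sphere_monomial (decr (decr u l) (opp l)) z) = 0" by auto
        then show ?thesis using fs.subspace_0[OF lower_harmonics_subspace] by (simp only:)
      qed
    qed
    then obtain q where q: "q \<in> lower_harmonics P k"
      "\<And>z. norm z = 1 \<Longrightarrow> - sphere_laplacian q z - eigenvalue CARD('n) k * q z = R z"
      using lower_harmonics_solve[OF P] by blast
    have us: "sphere_smooth (sphere_monomial u)" by (rule radially_algebraic_smooth[OF radially_algebraic_sphere_monomial])
    have qs: "sphere_smooth q" using q(1) lower_harmonics_subset[OF P] hom_polys_smooth by blast
    have qk: "q \<in> hom_polys P k"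
    proof (cases "k < 2")
      case True
      have "q = 0" using q(1) unfolding lower_harmonics_small[OF True] by simp
      then show ?thesis using fs.subspace_0[OF hom_polys_subspace] by (simp only:)
    next
      case False
      then have k2: "k - 2 + 2 = k" by simp
      have "q \<in> hom_polys P (k - 2 + 2)"
        using q(1) lower_harmonics_subset[OF P, of k] hom_polys_mono2[OF P, of "k - 2"] by blast
      then show ?thesis unfolding k2 .
    qed
    have "- sphere_laplacian (\<lambda>z. 1 * sphere_monomial u z + q z) z =
        eigenvalue CARD('n) k * (1 * sphere_monomial u z + q z)" if z: "norm z = 1" for z
    proof -
      have "- sphere_laplacian (sphere_monomial u) z = eigenvalue CARD('n) k * sphere_monomial u z - R z"
        using sphere_laplacian_sphere_monomial[OF z, of u] u by (simp add: deg_expts_def R_def sum_fun_apply)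
      then show ?thesis
        using sphere_laplacian_linear[OF us qs z, of 1] q(2)[OF z] by (simp add: algebra_simps)
    qed
    then have "sphere_monomial u + q \<in> harmonics P k"
      using fs.subspace_add[OF hom_polys_subspace sphere_monomial_in_hom_polys[OF u] qk]
      by (simp add: harmonics_def plus_fun_def)
    moreover have "(\<lambda>z. (- 1) * q z) \<in> lower_harmonics P k" by (rule fs.subspace_scale[OF lower_harmonics_subspace q(1)])
    moreover have "sphere_monomial u = (sphere_monomial u + q) + (\<lambda>z. (- 1) * q z)" by (simp add: fun_eq_iff)
    ultimately show "sphere_monomial u \<in> {h + q | h q. h \<in> harmonics P k \<and> q \<in> lower_harmonics P k}" by blast
  qed
  then show ?case by blast
qed

section \<open>Completeness of the harmonics\<close>

abbreviation all_monomials :: "('n \<times> bool \<Rightarrow> nat) \<Rightarrow> bool" where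
  "all_monomials \<equiv> \<lambda>_. True"

lemma opp_closed_all: "opp_closed all_monomials"
  by (simp add: opp_closed_def)

lemma orthogonal_subspace:
  fixes f :: "'a::euclidean_space \<Rightarrow> complex"
  assumes f: "continuous_on (sphere 0 1) f"
  shows "fs.subspace {g. continuous_on (sphere 0 1) g \<and> sphere_integral (\<lambda>z. f z * g z) = 0}"
proof (rule fs.subspaceI)
  show "0 \<in> {g. continuous_on (sphere 0 1) g \<and> sphere_integral (\<lambda>z. f z * g z) = 0}"
    using sphere_integral_cmult[of 0 "\<lambda>_. 0"] by (simp add: zero_fun_def)
next
  fix x y assume "x \<in> {g. continuous_on (sphere 0 1) g \<and> sphere_integral (\<lambda>z. f z * g z) = 0}"
    "y \<in> {g. continuous_on (sphere 0 1) g \<and> sphere_integral (\<lambda>z. f z * g z) = 0}"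
  then have xy: "continuous_on (sphere 0 1) x" "continuous_on (sphere 0 1) y"
    "sphere_integral (\<lambda>z. f z * x z) = 0" "sphere_integral (\<lambda>z. f z * y z) = 0" by auto
  have "sphere_integral (\<lambda>z. f z * x z + f z * y z) = 0"
    using xy by (subst sphere_integral_add) (auto intro!: continuous_intros f)
  then have "sphere_integral (\<lambda>z. f z * (x + y) z) = 0" by (simp add: distrib_left)
  moreover have "continuous_on (sphere 0 1) (x + y)"
    unfolding plus_fun_def by (intro continuous_intros xy)
  ultimately show "x + y \<in> {g. continuous_on (sphere 0 1) g \<and> sphere_integral (\<lambda>z. f z * g z) = 0}" by simp
next
  fix c x assume "x \<in> {g. continuous_on (sphere 0 1) g \<and> sphere_integral (\<lambda>z. f z * g z) = 0}"
  then have x: "continuous_on (sphere 0 1) x" "sphere_integral (\<lambda>z. f z * x z) = 0" by auto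
  have "sphere_integral (\<lambda>z. c * (f z * x z)) = 0" using x(2) by (simp add: sphere_integral_cmult)
  then have "sphere_integral (\<lambda>z. f z * (c * x z)) = 0" by (simp add: mult.left_commute)
  moreover have "continuous_on (sphere 0 1) (\<lambda>z. c * x z)" by (intro continuous_intros x)
  ultimately show "(\<lambda>z. c * x z) \<in> {g. continuous_on (sphere 0 1) g \<and> sphere_integral (\<lambda>z. f z * g z) = 0}" by simp
qed

text \<open>Real and imaginary parts of the coordinates are combinations of z_i and its conjugate,
  constants are multiples of the empty monomial, and products of monomials add exponents.\<close>

lemma real_polynomial_on_sphere:
  fixes p :: "complex ^ 'n::finite \<Rightarrow> real"
  assumes "real_polynomial_function p"
  shows "\<exists>g\<in>fs.span (range sphere_monomial). \<forall>z. norm z = 1 \<longrightarrow> complex_of_real (p z) = g z"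
  using assms
proof induction
  case (linear l)
  define e where "e = (\<lambda>k l :: 'n \<times> bool. if l = k then 1 else 0 :: nat)"
  have me: "monomial (e k) z = coord z k" for k and z :: "complex ^ 'n"
  proof -
    have "monomial (e k) z = (\<Prod>l\<in>{k}. coord z l ^ e k l)"
      unfolding monomial_def by (rule prod.mono_neutral_right) (auto simp: e_def)
    then show ?thesis by (simp add: e_def)
  qed
  define a b where "a = (\<lambda>i. complex_of_real (l (axis i 1)))" and "b = (\<lambda>i. complex_of_real (l (axis i \<i>)))"
  define g where "g = (\<Sum>i\<in>UNIV. (\<lambda>z. ((a i - \<i> * b i) / 2) * sphere_monomial (e (i, True)) z) +
    (\<lambda>z. ((a i + \<i> * b i) / 2) * sphere_monomial (e (i, False)) z))"
  have "g \<in> fs.span (range sphere_monomial)"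
    unfolding g_def by (intro fs.span_sum fs.span_add fs.span_scale fs.span_base rangeI)
  moreover have "complex_of_real (l z) = g z" if z: "norm z = 1" for z
  proof -
    have lin: "linear l" using linear by (rule bounded_linear.linear)
    have "l z = l (\<Sum>b\<in>Basis. (z \<bullet> b) *\<^sub>R b)" by (simp add: euclidean_representation)
    also have "\<dots> = (\<Sum>b\<in>Basis. (z \<bullet> b) * l b)" by (simp add: linear_sum[OF lin] linear_cmul[OF lin])
    also have "\<dots> = (\<Sum>i\<in>UNIV. Re (z $ i) * l (axis i 1) + Im (z $ i) * l (axis i \<i>))"
      unfolding sum_Basis_vec by (simp add: inner_axis inner_complex_def)
    finally have lz: "complex_of_real (l z) = (\<Sum>i\<in>UNIV. of_real (Re (z $ i)) * a i + of_real (Im (z $ i)) * b i)"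
      by (simp add: a_def b_def)
    have gz: "g z = (\<Sum>i\<in>UNIV. ((a i - \<i> * b i) / 2) * z $ i + ((a i + \<i> * b i) / 2) * cnj (z $ i))"
      using z by (simp add: g_def sum_fun_apply sphere_monomial_def me coord_def)
    have split: "of_real (Re w) * x + of_real (Im w) * y = ((x - \<i> * y) / 2) * w + ((x + \<i> * y) / 2) * cnj w" for w x y
      by (simp add: complex_eq_iff field_simps)
    show ?thesis unfolding lz gz by (intro sum.cong refl split)
  qed
  ultimately show ?case by blast
next
  case (const c)
  have "(\<lambda>z. of_real c * sphere_monomial (\<lambda>_. 0) z) \<in> fs.span (range sphere_monomial)"
    by (intro fs.span_scale fs.span_base rangeI)
  moreover have "of_real c = of_real c * sphere_monomial (\<lambda>_. 0) z" if "norm z = 1" for z :: "complex ^ 'n"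
    using that by (simp add: sphere_monomial_def monomial_def)
  ultimately show ?case by (intro bexI) auto
next
  case (add p q)
  then obtain f g where fg: "f \<in> fs.span (range sphere_monomial)" "g \<in> fs.span (range sphere_monomial)"
    "\<And>z. norm z = 1 \<Longrightarrow> complex_of_real (p z) = f z" "\<And>z. norm z = 1 \<Longrightarrow> complex_of_real (q z) = g z" by metis
  have "f + g \<in> fs.span (range sphere_monomial)" by (intro fs.span_add fg)
  then show ?case using fg(3,4) by (intro bexI[of _ "f + g"]) auto
next
  case (mult p q)
  then obtain f g where fg: "f \<in> fs.span (range sphere_monomial)" "g \<in> fs.span (range sphere_monomial)"
    "\<And>z. norm z = 1 \<Longrightarrow> complex_of_real (p z) = f z" "\<And>z. norm z = 1 \<Longrightarrow> complex_of_real (q z) = g z" by metis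
  have mm: "sphere_monomial u z * sphere_monomial v z = sphere_monomial (\<lambda>k. u k + v k) z" for u v and z :: "complex ^ 'n"
    by (simp add: sphere_monomial_def monomial_def power_add prod.distrib)
  have 1: "(\<lambda>z. sphere_monomial u z * g z) \<in> fs.span (range sphere_monomial)" for u
    using fg(2)
  proof (induction g rule: fs.span_induct_alt)
    case base
    then show ?case using fs.span_zero by (simp add: zero_fun_def)
  next
    case (step c x y)
    then obtain v where v: "x = sphere_monomial v" by blast
    have "(\<lambda>z. c * sphere_monomial (\<lambda>k. u k + v k) z) + (\<lambda>z. sphere_monomial u z * y z) \<in> fs.span (range sphere_monomial)"
      by (intro fs.span_add fs.span_scale fs.span_base rangeI step.IH)
    moreover have "(\<lambda>z. c * sphere_monomial (\<lambda>k. u k + v k) z) + (\<lambda>z. sphere_monomial u z * y z) =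
        (\<lambda>z. sphere_monomial u z * ((\<lambda>z. c * x z) + y) z)"
      by (simp add: fun_eq_iff v mm[symmetric] algebra_simps)
    ultimately show ?case by simp
  qed
  have "(\<lambda>z. f z * g z) \<in> fs.span (range sphere_monomial)"
    using fg(1)
  proof (induction f rule: fs.span_induct_alt)
    case base
    then show ?case using fs.span_zero by (simp add: zero_fun_def)
  next
    case (step c x y)
    then obtain u where u: "x = sphere_monomial u" by blast
    have "(\<lambda>z. c * (sphere_monomial u z * g z)) + (\<lambda>z. y z * g z) \<in> fs.span (range sphere_monomial)"
      by (intro fs.span_add fs.span_scale 1 step.IH)
    moreover have "(\<lambda>z. c * (sphere_monomial u z * g z)) + (\<lambda>z. y z * g z) = (\<lambda>z. ((\<lambda>z. c * x z) + y) z * g z)"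
      by (simp add: fun_eq_iff u algebra_simps)
    ultimately show ?case by simp
  qed
  then show ?case using fg(3,4) by (intro bexI[of _ "\<lambda>z. f z * g z"]) auto
qed

text \<open>Harmonics with another eigenvalue are orthogonal to \<open>f\<close> automatically, so
  \<open>orth\<close> is demanded only for the eigenvalue \<mu>. Together they make \<open>f\<close>
  orthogonal to every polynomial.\<close>

lemma eigenfunction_orthogonal_to_harmonics_eq_0:
  fixes f :: "complex ^ 'n::finite \<Rightarrow> complex"
  assumes f: "sphere_smooth f" and eig: "\<And>z. norm z = 1 \<Longrightarrow> - sphere_laplacian f z = \<mu> * f z"
    and orth: "\<And>k h. eigenvalue CARD('n) k = \<mu> \<Longrightarrow> h \<in> harmonics all_monomials k \<Longrightarrow>
      sphere_integral (\<lambda>z. f z * h z) = 0"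
    and z: "norm z = 1"
  shows "f z = 0"
proof -
  let ?V = "{g. continuous_on (sphere 0 1) g \<and> sphere_integral (\<lambda>z. f z * g z) = 0}"
  have cf: "continuous_on (sphere 0 1) f" by (rule sphere_smooth_continuous[OF f])
  have V: "fs.subspace ?V" by (rule orthogonal_subspace[OF cf])
  have harm: "harmonics all_monomials k \<subseteq> ?V" for k
  proof
    fix h :: "complex ^ 'n \<Rightarrow> complex" assume h: "h \<in> harmonics all_monomials k"
    have hs: "sphere_smooth h" "\<And>z. norm z = 1 \<Longrightarrow> - sphere_laplacian h z = eigenvalue CARD('n) k * h z"
      using h hom_polys_smooth by (auto simp: harmonics_def)
    have "sphere_integral (\<lambda>z. f z * h z) = 0"
    proof (cases "\<mu> = eigenvalue CARD('n) k")
      case True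
      then show ?thesis using orth[of k h] h by simp
    next
      case False
      show ?thesis
        by (rule sphere_laplacian_eigenfunctions_orthogonal[where f = f and g = h and \<mu> = \<mu>
            and \<nu> = "eigenvalue CARD('n) k"]) (fact f eig hs False)+
    qed
    then show "h \<in> ?V" using sphere_smooth_continuous[OF hs(1)] by simp
  qed
  have low: "lower_harmonics all_monomials k \<subseteq> ?V" for k
    unfolding lower_harmonics_def by (rule fs.span_minimal[OF _ V]) (use harm in blast)
  have mon: "sphere_monomial u \<in> ?V" for u :: "'n \<times> bool \<Rightarrow> nat"
  proof -
    have "u \<in> deg_expts all_monomials (\<Sum>k\<in>UNIV. u k)" by (simp add: deg_expts_def)
    from hom_polys_decomposition[OF opp_closed_all sphere_monomial_in_hom_polys[OF this]]
    obtain h q where hq: "h \<in> ?V" "q \<in> ?V" "sphere_monomial u = h + q" using harm low by blast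
    show ?thesis unfolding hq(3) by (rule fs.subspace_add[OF V hq(1,2)])
  qed
  have span: "fs.span (range sphere_monomial) \<subseteq> ?V"
    by (rule fs.span_minimal[OF _ V]) (use mon in blast)
  show ?thesis
  proof (rule orthogonal_to_polynomials_eq_0[OF cf _ z])
    fix p :: "complex ^ 'n \<Rightarrow> real" assume "real_polynomial_function p"
    then obtain g where g: "g \<in> fs.span (range sphere_monomial)" "\<And>z. norm z = 1 \<Longrightarrow> complex_of_real (p z) = g z"
      using real_polynomial_on_sphere by blast
    have "sphere_integral (\<lambda>z. f z * of_real (p z)) = sphere_integral (\<lambda>z. f z * g z)"
      unfolding sphere_integral_def
    proof (rule Bochner_Integration.integral_cong[OF refl])
      fix x :: "complex ^ 'n"
      show "of_real (sphere_weight x) * radial_ext (\<lambda>z. f z * of_real (p z)) x =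
          of_real (sphere_weight x) * radial_ext (\<lambda>z. f z * g z) x"
      proof (cases "x = 0")
        case True then show ?thesis by (simp add: sphere_weight_eq_0)
      next
        case False
        then have "norm (x /\<^sub>R norm x) = 1" by simp
        then show ?thesis using g(2) by (simp only: radial_ext_def)
      qed
    qed
    also have "\<dots> = 0" using g(1) span by blast
    finally show "sphere_integral (\<lambda>z. f z * of_real (p z)) = 0" .
  qed
qed

section \<open>Orthogonal projection and conjugation\<close>

lemma differentiable_times_linear:
  fixes f g :: "'a::real_normed_vector \<Rightarrow> complex"
  assumes "open S" "differentiable_times n f S" "differentiable_times n g S"
  shows "differentiable_times n (\<lambda>x. c * f x + g x) S"
  using assms(2,3)
proof (induction n arbitrary: f g)
  case 0
  then show ?case by (auto intro!: continuous_intros)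
next
  case (Suc n)
  have d: "((\<lambda>x. c * f x + g x) has_derivative
      (\<lambda>v. c * frechet_derivative f (at x) v + frechet_derivative g (at x) v)) (at x)" if "x \<in> S" for x
    using Suc.prems that
    by (intro has_derivative_add has_derivative_mult_right frechet_derivative_works[THEN iffD1]) auto
  have e: "c * frechet_derivative f (at x) v + frechet_derivative g (at x) v =
      frechet_derivative (\<lambda>x. c * f x + g x) (at x) v" if "x \<in> S" for x v
    using fun_cong[OF frechet_derivative_at[OF d[OF that]], of v] .
  have "differentiable_times n (\<lambda>x. frechet_derivative (\<lambda>x. c * f x + g x) (at x) v) S" for v
    by (rule differentiable_times_cong[OF assms(1) e]) (use Suc in auto)
  moreover have "(\<lambda>x. c * f x + g x) differentiable (at x)" if "x \<in> S" for x
    using d[OF that] unfolding differentiable_def by blast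
  ultimately show ?case by simp
qed

lemma sphere_smooth_linear:
  fixes f g :: "'a::euclidean_space \<Rightarrow> complex"
  assumes "sphere_smooth f" "sphere_smooth g"
  shows "sphere_smooth (\<lambda>z. c * f z + g z)"
proof -
  have r: "radial_ext (\<lambda>z. c * f z + g z) = (\<lambda>x. c * radial_ext f x + radial_ext g x)"
    by (simp add: radial_ext_def fun_eq_iff)
  show ?thesis using assms unfolding sphere_smooth_def r
    by (intro allI differentiable_times_linear) auto
qed

definition sphere_inner :: "('a::euclidean_space \<Rightarrow> complex) \<Rightarrow> ('a \<Rightarrow> complex) \<Rightarrow> complex" where
  "sphere_inner f g = sphere_integral (\<lambda>z. f z * cnj (g z))"

lemma sphere_inner_linear_left:
  assumes "continuous_on (sphere 0 1) f" "continuous_on (sphere 0 1) g" "continuous_on (sphere 0 1) h"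
  shows "sphere_inner (\<lambda>z. c * f z + g z) h = c * sphere_inner f h + sphere_inner g h"
proof -
  have "sphere_inner (\<lambda>z. c * f z + g z) h = sphere_integral (\<lambda>z. c * (f z * cnj (h z)) + g z * cnj (h z))"
    by (simp add: sphere_inner_def algebra_simps)
  also have "\<dots> = sphere_integral (\<lambda>z. c * (f z * cnj (h z))) + sphere_integral (\<lambda>z. g z * cnj (h z))"
    by (intro sphere_integral_add continuous_intros assms)
  finally show ?thesis by (simp add: sphere_inner_def sphere_integral_cmult)
qed

lemma sphere_inner_linear_right:
  assumes "continuous_on (sphere 0 1) f" "continuous_on (sphere 0 1) g" "continuous_on (sphere 0 1) h"
  shows "sphere_inner h (\<lambda>z. c * f z + g z) = cnj c * sphere_inner h f + sphere_inner h g"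
proof -
  have "sphere_inner h (\<lambda>z. c * f z + g z) = sphere_integral (\<lambda>z. cnj c * (h z * cnj (f z)) + h z * cnj (g z))"
    by (simp add: sphere_inner_def algebra_simps)
  also have "\<dots> = sphere_integral (\<lambda>z. cnj c * (h z * cnj (f z))) + sphere_integral (\<lambda>z. h z * cnj (g z))"
    by (intro sphere_integral_add continuous_intros assms)
  finally show ?thesis by (simp add: sphere_inner_def sphere_integral_cmult)
qed

lemma sphere_integral_eq_0:
  fixes f :: "'a::euclidean_space \<Rightarrow> complex"
  assumes "\<And>z. norm z = 1 \<Longrightarrow> f z = 0"
  shows "sphere_integral f = 0"
proof -
  have e: "of_real (sphere_weight x) * radial_ext f x = 0" for x
  proof (cases "x = 0")
    case True then show ?thesis by (simp add: sphere_weight_eq_0)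
  next
    case False
    then have "norm (x /\<^sub>R norm x) = 1" by simp
    then show ?thesis using assms by (simp only: radial_ext_def) simp
  qed
  show ?thesis unfolding sphere_integral_def e by simp
qed

lemma continuous_functions_subspace: "fs.subspace {f :: 'a::euclidean_space \<Rightarrow> complex. continuous_on (sphere 0 1) f}"
  by (rule fs.subspaceI) (auto simp: zero_fun_def plus_fun_def intro!: continuous_intros)

lemma span_continuous:
  fixes B :: "('a::euclidean_space \<Rightarrow> complex) set"
  assumes "\<And>g. g \<in> B \<Longrightarrow> continuous_on (sphere 0 1) g" "f \<in> fs.span B"
  shows "continuous_on (sphere 0 1) f"
proof -
  have "fs.span B \<subseteq> {f. continuous_on (sphere 0 1) f}"
    by (rule fs.span_minimal[OF _ continuous_functions_subspace]) (use assms(1) in auto)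
  then show ?thesis using assms(2) by blast
qed

text \<open>Gram-Schmidt, one vector at a time. The remainder is written with the factor -1 in front
  so that it matches the shape c f + g of the linearity lemmas.\<close>

lemma orthogonal_projection_exists:
  fixes B :: "('a::euclidean_space \<Rightarrow> complex) set"
  assumes "finite B" "\<And>g. g \<in> B \<Longrightarrow> continuous_on (sphere 0 1) g" "continuous_on (sphere 0 1) f"
  shows "\<exists>h\<in>fs.span B. \<forall>g\<in>fs.span B. sphere_inner (\<lambda>z. (- 1) * h z + f z) g = 0"
  using assms
proof (induction B arbitrary: f rule: finite_induct)
  case empty
  then show ?case by (auto simp: sphere_inner_def intro!: sphere_integral_eq_0)
next
  case (insert b B)
  have cB: "continuous_on (sphere 0 1) g" if "g \<in> fs.span B" for g
    by (rule span_continuous[OF _ that]) (use insert.prems in auto)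
  have cb: "continuous_on (sphere 0 1) b" using insert.prems by auto
  obtain hb where hb: "hb \<in> fs.span B" "\<And>g. g \<in> fs.span B \<Longrightarrow> sphere_inner (\<lambda>z. (- 1) * hb z + b z) g = 0"
    using insert.IH[OF _ cb] insert.prems by blast
  obtain hf where hf: "hf \<in> fs.span B" "\<And>g. g \<in> fs.span B \<Longrightarrow> sphere_inner (\<lambda>z. (- 1) * hf z + f z) g = 0"
    using insert.IH[OF _ insert.prems(2)] insert.prems(1) by blast
  define b' f' where "b' = (\<lambda>z. (- 1) * hb z + b z)" and "f' = (\<lambda>z. (- 1) * hf z + f z)"
  have cont: "continuous_on (sphere 0 1) b'" "continuous_on (sphere 0 1) f'"
    unfolding b'_def f'_def by (intro continuous_intros cB hb(1) hf(1) cb insert.prems(2))+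
  define c where "c = sphere_inner f' b' / sphere_inner b' b'"
  define h where "h = (\<lambda>z. c * b' z) + hf"
  have mono: "fs.span B \<subseteq> fs.span (insert b B)" by (rule fs.span_mono) auto
  have b'_eq: "b' = (\<lambda>z. (- 1) * hb z) + b" by (simp add: b'_def fun_eq_iff)
  have "b' \<in> fs.span (insert b B)"
    unfolding b'_eq using hb(1) mono by (intro fs.span_add fs.span_scale fs.span_base[of b]) auto
  then have h_in: "h \<in> fs.span (insert b B)"
    unfolding h_def using hf(1) mono by (intro fs.span_add fs.span_scale) auto
  define w where "w = (\<lambda>z. (- c) * b' z + f' z)"
  have cw: "continuous_on (sphere 0 1) w" unfolding w_def by (intro continuous_intros cont)
  have w_eq: "(\<lambda>z. (- 1) * h z + f z) = w" by (simp add: w_def h_def f'_def fun_eq_iff algebra_simps)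
  have wB: "sphere_inner w g = 0" if "g \<in> fs.span B" for g
    unfolding w_def sphere_inner_linear_left[OF cont cB[OF that]] using hb(2)[OF that] hf(2)[OF that]
    by (simp add: b'_def f'_def)
  have wb: "sphere_inner w b' = 0"
  \<comment> \<open>Independence is not assumed, and \<open>sphere_inner\<close> only sees values on
    the sphere. If \<open>b'\<close> vanishes there, its pairing with anything is 0.\<close>
  proof (cases "sphere_inner b' b' = 0")
    case True
    then have "b' z = 0" if "norm z = 1" for z
      using sphere_integral_positive[OF cont(1) _ that] by (simp add: sphere_inner_def)
    then show ?thesis unfolding sphere_inner_def by (intro sphere_integral_eq_0) simp
  next
    case False
    then show ?thesis unfolding w_def sphere_inner_linear_left[OF cont cont(1)] by (simp add: c_def)
  qed
  have "sphere_inner w g = 0" if g: "g \<in> fs.span (insert b B)" for g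
  proof -
    obtain k where k: "g - (\<lambda>z. k * b z) \<in> fs.span B"
      using g unfolding fs.span_insert by (elim CollectE exE)
    define g1 where "g1 = (g - (\<lambda>z. k * b z)) + (\<lambda>z. k * hb z)"
    have g1: "g1 \<in> fs.span B" unfolding g1_def by (intro fs.span_add fs.span_scale k hb(1))
    have g_eq: "g = (\<lambda>z. k * b' z + g1 z)" by (simp add: g1_def b'_def fun_eq_iff algebra_simps)
    show ?thesis
      unfolding g_eq sphere_inner_linear_right[OF cont(1) cB[OF g1] cw] using wb wB[OF g1] by simp
  qed
  then show ?case unfolding w_eq[symmetric] using h_in by blast
qed

lemma coord_opp: "coord z (opp k) = cnj (coord z k)"
  by (simp add: coord_def opp_def)

lemma cnj_sphere_monomial: "cnj (sphere_monomial u z) = sphere_monomial (u \<circ> opp) z"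
proof -
  have b: "bij opp" by (rule o_bij[of opp]) (simp_all add: fun_eq_iff)
  have "cnj (monomial u z) = (\<Prod>k\<in>UNIV. coord z (opp k) ^ u k)" by (simp add: monomial_def coord_opp)
  also have "\<dots> = (\<Prod>k\<in>UNIV. coord z (opp (opp k)) ^ u (opp k))"
    using prod.reindex_bij_betw[OF b, of "\<lambda>k. coord z (opp k) ^ u k"] by simp
  finally have "cnj (monomial u z) = monomial (u \<circ> opp) z" by (simp add: monomial_def)
  then show ?thesis by (simp add: sphere_monomial_def)
qed

lemma cnj_hom_polys:
  fixes f :: "complex ^ 'n::finite \<Rightarrow> complex"
  assumes "f \<in> hom_polys all_monomials k"
  shows "(\<lambda>z. cnj (f z)) \<in> hom_polys all_monomials k"
  using assms unfolding hom_polys_def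
proof (induction f rule: fs.span_induct_alt)
  case base
  then show ?case using fs.span_zero by (simp add: zero_fun_def)
next
  case (step c x y)
  then obtain u where u: "x = sphere_monomial u" "u \<in> deg_expts all_monomials k" by blast
  have b: "bij opp" by (rule o_bij[of opp]) (simp_all add: fun_eq_iff)
  have "u \<circ> opp \<in> deg_expts all_monomials k"
    using u(2) sum.reindex_bij_betw[OF b, of u] by (simp add: deg_expts_def)
  then have "(\<lambda>z. cnj c * sphere_monomial (u \<circ> opp) z) + (\<lambda>z. cnj (y z)) \<in> fs.span (sphere_monomial ` deg_expts all_monomials k)"
    by (intro fs.span_add fs.span_scale fs.span_base imageI step.IH)
  moreover have "(\<lambda>z. cnj c * sphere_monomial (u \<circ> opp) z) + (\<lambda>z. cnj (y z)) = (\<lambda>z. cnj (((\<lambda>z. c * x z) + y) z))"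
    by (simp add: fun_eq_iff u(1) cnj_sphere_monomial)
  ultimately show ?case by simp
qed

lemma cnj_eigenvalue: "cnj (eigenvalue d k) = eigenvalue d k"
  by (simp add: eigenvalue_def)

text \<open>Mediates between the bilinear pairing of Green's identity and the Hermitian one used for
  projections.\<close>

lemma cnj_harmonics:
  fixes f :: "complex ^ 'n::finite \<Rightarrow> complex"
  assumes "f \<in> harmonics all_monomials k"
  shows "(\<lambda>z. cnj (f z)) \<in> harmonics all_monomials k"
proof -
  have f: "f \<in> hom_polys all_monomials k" "\<And>z. norm z = 1 \<Longrightarrow> - sphere_laplacian f z = eigenvalue CARD('n) k * f z"
    using assms by (auto simp: harmonics_def)
  have "- sphere_laplacian (\<lambda>z. cnj (f z)) z = eigenvalue CARD('n) k * cnj (f z)" if z: "norm z = 1" for z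
  proof -
    have "- sphere_laplacian (\<lambda>z. cnj (f z)) z = cnj (- sphere_laplacian f z)"
      using sphere_laplacian_cnj[OF hom_polys_smooth[OF f(1)] z] by simp
    then show ?thesis unfolding f(2)[OF z] by (simp add: cnj_eigenvalue)
  qed
  then show ?thesis using cnj_hom_polys[OF f(1)] by (simp add: harmonics_def)
qed

lemma hom_polys_continuous: "f \<in> hom_polys P k \<Longrightarrow> continuous_on (sphere 0 1) f"
  by (rule sphere_smooth_continuous) (rule hom_polys_smooth)

lemma finite_basis_in_hom_polys:
  assumes "V \<subseteq> hom_polys P k"
  obtains B where "B \<subseteq> V" "fs.independent B" "V \<subseteq> fs.span B" "card B = fs.dim V" "finite B"
proof -
  obtain B where B: "B \<subseteq> V" "fs.independent B" "V \<subseteq> fs.span B" "card B = fs.dim V"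
    by (rule fs.basis_exists)
  have "B \<subseteq> fs.span (sphere_monomial ` deg_expts P k)" using B(1) assms unfolding hom_polys_def by blast
  then have "finite B"
    using fs.independent_span_bound[OF finite_imageI[OF finite_deg_expts] B(2)] by blast
  then show thesis using that B by blast
qed

text \<open>Subtracting the projection onto the finite-dimensional space of harmonics leaves an
  eigenfunction orthogonal to all of them, hence 0. So every smooth eigenfunction with this
  eigenvalue is a polynomial on the sphere.\<close>

lemma eigenfunction_in_harmonics:
  fixes f :: "complex ^ 'n::finite \<Rightarrow> complex"
  assumes f: "sphere_smooth f" and off: "\<And>z. norm z \<noteq> 1 \<Longrightarrow> f z = 0"
    and eig: "\<And>z. norm z = 1 \<Longrightarrow> - sphere_laplacian f z = eigenvalue CARD('n) k * f z"
  shows "f \<in> harmonics all_monomials k"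
proof -
  let ?H = "harmonics all_monomials k :: (complex ^ 'n \<Rightarrow> complex) set"
  have sub: "?H \<subseteq> hom_polys all_monomials k" by (auto simp: harmonics_def)
  obtain B where B: "B \<subseteq> ?H" "fs.independent B" "?H \<subseteq> fs.span B" "card B = fs.dim ?H" "finite B"
    by (rule finite_basis_in_hom_polys[OF sub])
  have BH: "fs.span B \<subseteq> ?H" by (rule fs.span_minimal[OF B(1) harmonics_subspace])
  have cont: "continuous_on (sphere 0 1) g" if "g \<in> B" for g
    using that B(1) sub hom_polys_continuous by blast
  obtain h where h: "h \<in> fs.span B" "\<And>g. g \<in> fs.span B \<Longrightarrow> sphere_inner (\<lambda>z. (- 1) * h z + f z) g = 0"
    using orthogonal_projection_exists[OF B(5) cont sphere_smooth_continuous[OF f]] by blast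
  have hH: "h \<in> ?H" using h(1) BH by blast
  then have hs: "h \<in> hom_polys all_monomials k"
    "\<And>z. norm z = 1 \<Longrightarrow> - sphere_laplacian h z = eigenvalue CARD('n) k * h z"
    by (auto simp: harmonics_def)
  let ?w = "\<lambda>z. (- 1) * h z + f z"
  have ws: "sphere_smooth ?w" by (rule sphere_smooth_linear[OF hom_polys_smooth[OF hs(1)] f])
  have "?w z = 0" if "norm z = 1" for z
  proof (rule eigenfunction_orthogonal_to_harmonics_eq_0[OF ws _ _ that])
    fix y :: "complex ^ 'n" assume y: "norm y = 1"
    show "- sphere_laplacian ?w y = eigenvalue CARD('n) k * ?w y"
      unfolding sphere_laplacian_linear[OF hom_polys_smooth[OF hs(1)] f y]
      using hs(2)[OF y] eig[OF y] by (simp add: algebra_simps)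
  next
    fix j and g :: "complex ^ 'n \<Rightarrow> complex"
    assume "eigenvalue CARD('n) j = eigenvalue CARD('n) k" and g: "g \<in> harmonics all_monomials j"
    then have "j = k" by (intro eigenvalue_inj[of "CARD('n)"]) auto
    then have "(\<lambda>z. cnj (g z)) \<in> fs.span B" using cnj_harmonics[OF g] B(3) by blast
    from h(2)[OF this] show "sphere_integral (\<lambda>z. ?w z * g z) = 0" by (simp add: sphere_inner_def)
  qed
  then have "f z = h z" for z
  proof (cases "norm z = 1")
    case True
    then have "(- 1) * h z + f z = 0" by fact
    then show ?thesis by (simp add: eq_neg_iff_add_eq_0 add_eq_0_iff)
  next
    case False
    then show ?thesis using off hs(1) hom_polys_sphere_functions[of all_monomials k] by (auto simp: sphere_functions_def)
  qed
  then have "f = h" by (rule ext)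
  then show ?thesis using hH by simp
qed

lemma hom_polys_representation:
  assumes "f \<in> hom_polys P k"
  shows "\<exists>c. f = (\<lambda>z. \<Sum>u\<in>deg_expts P k. c u * sphere_monomial u z)"
  using assms unfolding hom_polys_def
proof (induction f rule: fs.span_induct_alt)
  case base
  then show ?case by (intro exI[of _ "\<lambda>_. 0"]) (simp add: zero_fun_def)
next
  case (step a x y)
  then obtain u c where u: "x = sphere_monomial u" "u \<in> deg_expts P k"
    and c: "y = (\<lambda>z. \<Sum>u\<in>deg_expts P k. c u * sphere_monomial u z)" by blast
  have "(\<Sum>v\<in>deg_expts P k. (c v + (if v = u then a else 0)) * sphere_monomial v z) = a * x z + y z" for z
  proof -
    have "(\<Sum>v\<in>deg_expts P k. (if v = u then a else 0) * sphere_monomial v z) =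
        (\<Sum>v\<in>{u}. (if v = u then a else 0) * sphere_monomial v z)"
      using u(2) by (intro sum.mono_neutral_right finite_deg_expts) auto
    then show ?thesis by (simp add: distrib_right sum.distrib u(1) c)
  qed
  then show ?case
    by (intro exI[of _ "\<lambda>v. c v + (if v = u then a else 0)"]) (simp add: plus_fun_def)
qed

text \<open>Within one degree a relation on the sphere rescales to all nonzero points. Across
  degrees differing by 2 this would fail, because |z|^2 = 1 on the sphere.\<close>

lemma sphere_monomials_independent:
  assumes "\<And>z. norm z = 1 \<Longrightarrow> (\<Sum>u\<in>deg_expts P k. c u * sphere_monomial u z) = 0" "u \<in> deg_expts P k"
  shows "c u = 0"
proof (rule monomials_independent[OF finite_deg_expts _ assms(2)])
  fix z :: "complex ^ 'a" assume "\<And>i. z $ i \<noteq> 0"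
  then have z: "z \<noteq> 0" by auto
  then have n: "norm (z /\<^sub>R norm z) = 1" by simp
  have "of_real (inverse (norm z)) ^ k * (\<Sum>u\<in>deg_expts P k. c u * monomial u z) =
      (\<Sum>u\<in>deg_expts P k. c u * sphere_monomial u (z /\<^sub>R norm z))"
    unfolding sum_distrib_left
    by (intro sum.cong refl) (use n in \<open>simp add: sphere_monomial_def monomial_scaleR deg_expts_def\<close>)
  also have "\<dots> = 0" by (rule assms(1)[OF n])
  finally show "(\<Sum>u\<in>deg_expts P k. c u * monomial u z) = 0" using z by simp
qed

section \<open>Multiplicities of the Laplace spectrum\<close>

definition zero_weight :: "('n::finite \<Rightarrow> nat) \<Rightarrow> ('n \<times> bool \<Rightarrow> nat) \<Rightarrow> bool" where
  "zero_weight N u \<longleftrightarrow> (\<Sum>k\<in>UNIV. coordinate_weight N k * int (u k)) = 0"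

lemma deg_expts_zero_weight: "deg_expts (zero_weight N) k = expts (coordinate_weight N) UNIV 0 k"
  by (auto simp: deg_expts_def zero_weight_def expts_def)

lemma opp_closed_zero_weight: "opp_closed (zero_weight N)"
proof -
  have "(\<Sum>l\<in>UNIV. coordinate_weight N l * int (incr u k l)) = (\<Sum>l\<in>UNIV. coordinate_weight N l * int (u l))" for u k
  proof -
    have "(\<Sum>l\<in>UNIV. coordinate_weight N l * int (incr u k l)) =
        coordinate_weight N (opp k) + (\<Sum>l\<in>UNIV. coordinate_weight N l * int ((u(k := Suc (u k))) l))"
      unfolding incr_eq by (rule sum_fun_upd_Suc(2))
    also have "\<dots> = coordinate_weight N (opp k) + (coordinate_weight N k + (\<Sum>l\<in>UNIV. coordinate_weight N l * int (u l)))"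
      by (simp only: sum_fun_upd_Suc(2))
    finally show ?thesis by (simp add: coordinate_weight_def opp_def)
  qed
  then show ?thesis by (simp add: opp_closed_def zero_weight_def)
qed

lemma prod_cis: "(\<Prod>k\<in>A. cis (f k)) = cis (\<Sum>k\<in>A. f k)"
  by (induction A rule: infinite_finite_induct) (auto simp: cis_mult)

lemma sphere_monomial_circle_act:
  "sphere_monomial u (circle_act N (cis t) z) =
     cis (t * of_int (\<Sum>k\<in>UNIV. coordinate_weight N k * int (u k))) * sphere_monomial u z"
proof -
  have c: "coord (circle_act N (cis t) z) k = cis (t * of_int (coordinate_weight N k)) * coord z k" for k
    by (simp add: coord_def circle_act_def coordinate_weight_def Complex.DeMoivre cis_cnj mult.commute)
  have "monomial u (circle_act N (cis t) z) =
      (\<Prod>k\<in>UNIV. cis (t * of_int (coordinate_weight N k * int (u k)))) * monomial u z"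
    unfolding monomial_def prod.distrib[symmetric] c
    by (intro prod.cong refl) (simp add: power_mult_distrib Complex.DeMoivre mult_ac)
  also have "(\<Prod>k\<in>UNIV. cis (t * of_int (coordinate_weight N k * int (u k)))) =
      cis (t * of_int (\<Sum>k\<in>UNIV. coordinate_weight N k * int (u k)))"
    unfolding prod_cis by (simp add: sum_distrib_left)
  finally show ?thesis
    by (simp add: sphere_monomial_def norm_circle_act)
qed

text \<open>Monomials are independent eigenvectors of the circle action, so in an invariant
  combination the coefficients of nonzero weight vanish.\<close>

lemma invariant_hom_poly:
  fixes f :: "complex ^ 'n::finite \<Rightarrow> complex"
  assumes f: "f \<in> hom_polys all_monomials k"
    and inv: "\<And>u z. u \<in> sphere 0 1 \<Longrightarrow> z \<in> sphere 0 1 \<Longrightarrow> f (circle_act N u z) = f z"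
  shows "f \<in> hom_polys (zero_weight N) k"
proof -
  obtain c where c: "f = (\<lambda>z. \<Sum>u\<in>deg_expts all_monomials k. c u * sphere_monomial u z)"
    using hom_polys_representation[OF f] by blast
  let ?wt = "\<lambda>u. \<Sum>k\<in>UNIV. coordinate_weight N k * int (u k)"
  have c0: "c u = 0" if u: "u \<in> deg_expts all_monomials k" "\<not> zero_weight N u" for u
  proof -
    \<comment> \<open>At this angle the circle multiplies the monomial \<open>u\<close> by
      -1.\<close>
    define t where "t = pi / of_int (?wt u)"
    have "c u * (cis (t * of_int (?wt u)) - 1) = 0"
    proof (rule sphere_monomials_independent[where c = "\<lambda>u. c u * (cis (t * of_int (?wt u)) - 1)", OF _ u(1)])
      fix z :: "complex ^ 'n" assume z: "norm z = 1"
      have "(\<Sum>u\<in>deg_expts all_monomials k. c u * (cis (t * of_int (?wt u)) - 1) * sphere_monomial u z) =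
          f (circle_act N (cis t) z) - f z"
        unfolding c sphere_monomial_circle_act sum_subtractf[symmetric]
        by (intro sum.cong refl) (simp add: algebra_simps)
      also have "\<dots> = 0" using inv[of "cis t" z] z by simp
      finally show "(\<Sum>u\<in>deg_expts all_monomials k. c u * (cis (t * of_int (?wt u)) - 1) * sphere_monomial u z) = 0" .
    qed
    moreover have "of_int (?wt u) \<noteq> (0::real)" using u(2) unfolding zero_weight_def of_int_eq_0_iff .
    then have "t * of_int (?wt u) = pi" by (simp only: t_def nonzero_divide_eq_eq[symmetric] times_divide_eq_left) simp
    then have "cis (t * of_int (?wt u)) = - 1" by simp
    ultimately show ?thesis by simp
  qed
  have f_eq: "f = (\<Sum>u\<in>deg_expts all_monomials k. (\<lambda>z. c u * sphere_monomial u z))"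
    by (simp add: c sum_fun_apply fun_eq_iff)
  show ?thesis
    unfolding f_eq
  proof (rule fs.subspace_sum[OF hom_polys_subspace])
    fix u :: "'n \<times> bool \<Rightarrow> nat" assume u: "u \<in> deg_expts all_monomials k"
    show "(\<lambda>z. c u * sphere_monomial u z) \<in> hom_polys (zero_weight N) k"
    proof (cases "zero_weight N u")
      case True
      then have "u \<in> deg_expts (zero_weight N) k" using u by (simp add: deg_expts_def)
      then show ?thesis by (intro fs.subspace_scale hom_polys_subspace sphere_monomial_in_hom_polys)
    next
      case False
      then have "(\<lambda>z. c u * sphere_monomial u z) = 0" using c0[OF u] by auto
      then show ?thesis using fs.subspace_0[OF hom_polys_subspace] by (simp only:)
    qed
  qed
qed

lemma hom_polys_invariant:
  assumes "f \<in> hom_polys (zero_weight N) k" "cmod u = 1"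
  shows "f (circle_act N u z) = f z"
proof -
  obtain c where c: "f = (\<lambda>z. \<Sum>u\<in>deg_expts (zero_weight N) k. c u * sphere_monomial u z)"
    using hom_polys_representation[OF assms(1)] by blast
  obtain t where t: "u = cis t" using assms(2) by (metis cis_Arg_unique rcis_cmod_Arg rcis_def mult_1 of_real_1)
  show ?thesis unfolding c t sphere_monomial_circle_act
    by (intro sum.cong refl) (simp add: deg_expts_def zero_weight_def)
qed

lemma harmonics_mono: "harmonics P k \<subseteq> harmonics all_monomials k"
proof -
  have "hom_polys P k \<subseteq> hom_polys all_monomials k"
    unfolding hom_polys_def by (intro fs.span_mono image_mono) (auto simp: deg_expts_def)
  then show ?thesis by (auto simp: harmonics_def)
qed

lemma laplace_eigenspace_eq_harmonics:
  fixes N :: "'n::finite \<Rightarrow> nat"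
  shows "laplace_eigenspace N (eigenvalue CARD('n) k) = harmonics (zero_weight N) k"
proof (intro equalityI subsetI)
  fix f assume "f \<in> laplace_eigenspace N (eigenvalue CARD('n) k)"
  then have f: "sphere_smooth f" "\<And>z. norm z \<noteq> 1 \<Longrightarrow> f z = 0"
    "\<And>z. norm z = 1 \<Longrightarrow> - sphere_laplacian f z = eigenvalue CARD('n) k * f z"
    "\<And>u z. u \<in> sphere 0 1 \<Longrightarrow> z \<in> sphere 0 1 \<Longrightarrow> f (circle_act N u z) = f z"
    by (auto simp: laplace_eigenspace_def smooth_invariant_def)
  have "f \<in> harmonics all_monomials k" by (rule eigenfunction_in_harmonics) (fact f)+
  then have "f \<in> hom_polys (zero_weight N) k" by (intro invariant_hom_poly f(4)) (auto simp: harmonics_def)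
  then show "f \<in> harmonics (zero_weight N) k" using f(3) by (simp add: harmonics_def)
next
  fix f assume "f \<in> harmonics (zero_weight N) k"
  then have f: "f \<in> hom_polys (zero_weight N) k"
    "\<And>z. norm z = 1 \<Longrightarrow> - sphere_laplacian f z = eigenvalue CARD('n) k * f z" by (auto simp: harmonics_def)
  have "\<And>z. norm z \<noteq> 1 \<Longrightarrow> f z = 0"
    using f(1) hom_polys_sphere_functions[of "zero_weight N" k] by (auto simp: sphere_functions_def)
  then show "f \<in> laplace_eigenspace N (eigenvalue CARD('n) k)"
    using f(2) hom_polys_smooth[OF f(1)] hom_polys_invariant[OF f(1)]
    by (simp add: laplace_eigenspace_def smooth_invariant_def)
qed

lemma laplace_spectrum_eq_0:
  fixes N :: "'n::finite \<Rightarrow> nat"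
  assumes "\<And>k. \<mu> \<noteq> eigenvalue CARD('n) k"
  shows "laplace_spectrum N \<mu> = 0"
proof -
  have "f = 0" if "f \<in> laplace_eigenspace N \<mu>" for f
  proof -
    have f: "sphere_smooth f" "\<And>z. norm z \<noteq> 1 \<Longrightarrow> f z = 0"
      "\<And>z. norm z = 1 \<Longrightarrow> - sphere_laplacian f z = \<mu> * f z"
      using that by (auto simp: laplace_eigenspace_def smooth_invariant_def)
    have "f z = 0" if "norm z = 1" for z
      by (rule eigenfunction_orthogonal_to_harmonics_eq_0[OF f(1) f(3) _ that]) (use assms in auto)
    then show ?thesis using f(2) by (auto simp: fun_eq_iff)
  qed
  then have "laplace_eigenspace N \<mu> \<subseteq> fs.span {}" by auto
  then show ?thesis using fs.dim_le_card[of "laplace_eigenspace N \<mu>" "{}"] by (simp add: laplace_spectrum_def)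
qed

lemma independent_Un:
  assumes "finite B" "fs.independent A" "fs.independent B" "fs.span A \<inter> fs.span B = {0}"
  shows "fs.independent (A \<union> B)"
  using assms
proof (induction B rule: finite_induct)
  case (insert b B)
  have B: "fs.independent B" "b \<notin> fs.span B"
    using insert.prems(2) insert.hyps(2) by (auto simp: fs.independent_insert)
  have sub: "fs.span B \<subseteq> fs.span (insert b B)" by (rule fs.span_mono) auto
  have "fs.span A \<inter> fs.span B = {0}"
    using insert.prems(3) sub fs.span_zero[of A] fs.span_zero[of B] by blast
  then have AB: "fs.independent (A \<union> B)" by (rule insert.IH[OF insert.prems(1) B(1)])
  have "b \<notin> fs.span (A \<union> B)"
  proof
    assume "b \<in> fs.span (A \<union> B)"
    then obtain x y where xy: "b = x + y" "x \<in> fs.span A" "y \<in> fs.span B" unfolding fs.span_Un by blast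
    have "b - y \<in> fs.span (insert b B)"
      by (rule fs.span_diff[OF fs.span_base subsetD[OF sub xy(3)]]) simp
    moreover have "b - y = x" using xy(1) by simp
    ultimately have "x = 0" using xy(2) insert.prems(3) by blast
    then show False using xy B(2) by simp
  qed
  then have "fs.independent (insert b (A \<union> B))" by (intro fs.independent_insertI AB)
  then show ?case by simp
qed simp

lemma dim_direct_sum:
  assumes "fs.subspace U" "fs.subspace V" "U \<inter> V = {0}" "W = {u + v | u v. u \<in> U \<and> v \<in> V}"
    and "U \<subseteq> fs.span F" "V \<subseteq> fs.span F" "finite F"
  shows "fs.dim W = fs.dim U + fs.dim V"
proof -
  obtain A where A: "A \<subseteq> U" "fs.independent A" "U \<subseteq> fs.span A" "card A = fs.dim U" by (rule fs.basis_exists)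
  obtain B where B: "B \<subseteq> V" "fs.independent B" "V \<subseteq> fs.span B" "card B = fs.dim V" by (rule fs.basis_exists)
  have fin: "finite A" "finite B"
    using fs.independent_span_bound[OF assms(7) A(2)] fs.independent_span_bound[OF assms(7) B(2)] A(1) B(1) assms(5,6)
    by blast+
  have sp: "fs.span A = U" "fs.span B = V"
    using fs.span_minimal[OF A(1) assms(1)] fs.span_minimal[OF B(1) assms(2)] A(3) B(3) by auto
  have ind: "fs.independent (A \<union> B)"
    by (rule independent_Un[OF fin(2) A(2) B(2)]) (simp only: sp assms(3))
  have "A \<inter> B = {}"
  proof (rule ccontr)
    assume "A \<inter> B \<noteq> {}"
    then obtain x where x: "x \<in> A" "x \<in> B" by blast
    then have "x = 0" using A(1) B(1) assms(3) by blast
    then show False using x(1) A(2) fs.dependent_zero by blast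
  qed
  then have "card (A \<union> B) = fs.dim U + fs.dim V" using fin A(4) B(4) by (simp add: card_Un_disjoint)
  moreover have "fs.dim W = card (A \<union> B)"
  proof -
    have "fs.span (A \<union> B) = W" unfolding fs.span_Un sp assms(4) by blast
    then show ?thesis using fs.dim_span_eq_card_independent[OF ind] by simp
  qed
  ultimately show ?thesis by simp
qed

lemma dim_hom_polys: "fs.dim (hom_polys P k) = card (deg_expts P k)"
proof -
  have inj: "inj_on sphere_monomial (deg_expts P k)"
  proof (rule inj_onI, rule ccontr)
    fix u v assume uv: "u \<in> deg_expts P k" "v \<in> deg_expts P k" "sphere_monomial u = sphere_monomial v" "u \<noteq> v"
    let ?c = "\<lambda>x. if x = u then 1 else if x = v then -1 else (0::complex)"
    have "?c u = 0"
    proof (rule sphere_monomials_independent[where c = ?c, OF _ uv(1)])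
      fix z :: "complex ^ 'a"
      have "(\<Sum>x\<in>deg_expts P k. ?c x * sphere_monomial x z) = (\<Sum>x\<in>{u, v}. ?c x * sphere_monomial x z)"
        using uv by (intro sum.mono_neutral_right finite_deg_expts) auto
      also have "\<dots> = 0" using uv by simp
      finally show "(\<Sum>x\<in>deg_expts P k. ?c x * sphere_monomial x z) = 0" .
    qed
    then show False by simp
  qed
  have "fs.independent (sphere_monomial ` deg_expts P k)"
    unfolding fs.dependent_finite[OF finite_imageI[OF finite_deg_expts]]
  proof
    assume "\<exists>u. (\<exists>v\<in>sphere_monomial ` deg_expts P k. u v \<noteq> 0) \<and>
      (\<Sum>v\<in>sphere_monomial ` deg_expts P k. (\<lambda>z. u v * v z)) = 0"
    then obtain c w where c: "w \<in> deg_expts P k" "c (sphere_monomial w) \<noteq> 0"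
      "(\<Sum>v\<in>sphere_monomial ` deg_expts P k. (\<lambda>z. c v * v z)) = 0" by blast
    have "(\<Sum>u\<in>deg_expts P k. c (sphere_monomial u) * sphere_monomial u z) = 0" for z
      using fun_cong[OF c(3), of z] by (simp add: sum.reindex[OF inj] sum_fun_apply)
    then have "c (sphere_monomial w) = 0"
      using sphere_monomials_independent[where P = P and k = k and c = "\<lambda>u. c (sphere_monomial u)" and u = w] c(1)
      by blast
    then show False using c(2) by simp
  qed
  then show ?thesis
    unfolding hom_polys_def by (simp add: fs.dim_span_eq_card_independent card_image[OF inj] del: fs.dim_span)
qed

text \<open>\<open>h\<close> is orthogonal to the harmonics of lower degree. The conjugate of
  \<open>h\<close> is a sum of such harmonics, so the integral of |h|^2 is 0.\<close>

lemma harmonics_hom_polys_disjoint: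
  fixes h :: "complex ^ 'n::finite \<Rightarrow> complex"
  assumes k: "k \<ge> 2" and h: "h \<in> harmonics all_monomials k" "h \<in> hom_polys all_monomials (k - 2)"
  shows "h = 0"
proof -
  let ?V = "{g. continuous_on (sphere 0 1) g \<and> sphere_integral (\<lambda>z. h z * g z) = 0}"
  have ch: "continuous_on (sphere 0 1) h" by (rule hom_polys_continuous[OF h(2)])
  have V: "fs.subspace ?V" by (rule orthogonal_subspace[OF ch])
  have hs: "sphere_smooth h" "\<And>z. norm z = 1 \<Longrightarrow> - sphere_laplacian h z = eigenvalue CARD('n) k * h z"
    using h hom_polys_smooth[OF h(2)] by (auto simp: harmonics_def)
  have harm: "harmonics all_monomials j \<subseteq> ?V" if "j < k" for j
  proof
    fix g :: "complex ^ 'n \<Rightarrow> complex" assume g: "g \<in> harmonics all_monomials j"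
    then have gh: "g \<in> hom_polys all_monomials j" by (simp add: harmonics_def)
    have gs: "\<And>z. norm z = 1 \<Longrightarrow> - sphere_laplacian g z = eigenvalue CARD('n) j * g z"
      using g by (auto simp: harmonics_def)
    have ne: "eigenvalue CARD('n) k \<noteq> eigenvalue CARD('n) j"
      using that eigenvalue_inj[of "CARD('n)" k j] by auto
    have "sphere_integral (\<lambda>z. h z * g z) = 0"
      by (rule sphere_laplacian_eigenfunctions_orthogonal[where f = h and g = g and \<mu> = "eigenvalue CARD('n) k"
          and \<nu> = "eigenvalue CARD('n) j"]) (fact hs hom_polys_smooth[OF gh] gs ne)+
    then show "g \<in> ?V" using hom_polys_continuous[OF gh] by simp
  qed
  have low: "lower_harmonics all_monomials k \<subseteq> ?V"
    unfolding lower_harmonics_def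
  proof (rule fs.span_minimal[OF _ V])
    show "(\<Union>j\<in>{j. \<exists>i. j + 2 * Suc i = k}. harmonics all_monomials j) \<subseteq> ?V"
    proof (rule UN_least)
      fix j assume "j \<in> {j. \<exists>i. j + 2 * Suc i = k}"
      then have "j < k" by auto
      then show "harmonics all_monomials j \<subseteq> ?V" by (rule harm)
    qed
  qed
  have "(\<lambda>z. cnj (h z)) \<in> hom_polys all_monomials (k - 2)" by (rule cnj_hom_polys[OF h(2)])
  from hom_polys_decomposition[OF opp_closed_all this]
  obtain a b where ab: "a \<in> harmonics all_monomials (k - 2)" "b \<in> lower_harmonics all_monomials (k - 2)"
    "(\<lambda>z. cnj (h z)) = a + b" by blast
  have "a \<in> ?V" using ab(1) harm[of "k - 2"] k by auto
  moreover have "b \<in> ?V" using ab(2) lower_harmonics_mono[OF k] low by blast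
  ultimately have "a + b \<in> ?V" by (rule fs.subspace_add[OF V])
  then have "(\<lambda>z. cnj (h z)) \<in> ?V" unfolding ab(3) .
  then have "sphere_integral (\<lambda>z. h z * cnj (h z)) = 0" by simp
  then have "h z = 0" if "norm z = 1" for z using sphere_integral_positive[OF ch _ that] by blast
  moreover have "h z = 0" if "norm z \<noteq> 1" for z
    using that h(2) hom_polys_sphere_functions[of all_monomials "k - 2"] by (auto simp: sphere_functions_def)
  ultimately show ?thesis by (auto simp: fun_eq_iff)
qed

text \<open>On the sphere the polynomials of degree k are the direct sum of the harmonics of degree
  k and the polynomials of degree k - 2.\<close>

lemma dim_harmonics:
  assumes P: "opp_closed P"
  shows "card (deg_expts P k) = fs.dim (harmonics P k) + (if k < 2 then 0 else card (deg_expts P (k - 2)))"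
proof (cases "k < 2")
  case True
  have "hom_polys P k \<subseteq> harmonics P k"
  proof
    fix f assume "f \<in> hom_polys P k"
    from hom_polys_decomposition[OF P this] obtain h q where
      hq: "h \<in> harmonics P k" "q \<in> lower_harmonics P k" "f = h + q" by blast
    have "q = 0" using hq(2) unfolding lower_harmonics_small[OF True] by simp
    then show "f \<in> harmonics P k" using hq by simp
  qed
  then have "hom_polys P k = harmonics P k" by (auto simp: harmonics_def)
  then show ?thesis using dim_hom_polys[of P k] True by simp
next
  case False
  then have k: "k \<ge> 2" "k - 2 + 2 = k" by simp_all
  have up: "hom_polys P (k - 2) \<subseteq> hom_polys P k" using hom_polys_mono2[OF P, of "k - 2"] unfolding k(2) .
  have hom: "harmonics P k \<subseteq> hom_polys P k" by (auto simp: harmonics_def)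
  have all: "hom_polys P (k - 2) \<subseteq> hom_polys all_monomials (k - 2)"
    unfolding hom_polys_def by (intro fs.span_mono image_mono) (auto simp: deg_expts_def)
  have dec: "hom_polys P k = {u + v | u v. u \<in> harmonics P k \<and> v \<in> hom_polys P (k - 2)}"
  proof (intro equalityI subsetI)
    fix f assume "f \<in> hom_polys P k"
    from hom_polys_decomposition[OF P this] lower_harmonics_subset[OF P, of k]
    show "f \<in> {u + v | u v. u \<in> harmonics P k \<and> v \<in> hom_polys P (k - 2)}" by blast
  next
    fix f assume "f \<in> {u + v | u v. u \<in> harmonics P k \<and> v \<in> hom_polys P (k - 2)}"
    then obtain u v where uv: "f = u + v" "u \<in> hom_polys P k" "v \<in> hom_polys P k" using up hom by blast
    show "f \<in> hom_polys P k" unfolding uv(1) by (rule fs.subspace_add[OF hom_polys_subspace uv(2,3)])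
  qed
  have int: "harmonics P k \<inter> hom_polys P (k - 2) = {0}"
  proof (intro equalityI subsetI)
    fix f assume "f \<in> harmonics P k \<inter> hom_polys P (k - 2)"
    then have "f \<in> harmonics all_monomials k" "f \<in> hom_polys all_monomials (k - 2)"
      using harmonics_mono[of P k] all by auto
    then show "f \<in> {0}" using harmonics_hom_polys_disjoint[OF k(1)] by simp
  next
    fix f :: "complex ^ 'a \<Rightarrow> complex" assume "f \<in> {0}"
    then show "f \<in> harmonics P k \<inter> hom_polys P (k - 2)"
      by (simp add: fs.subspace_0[OF harmonics_subspace] fs.subspace_0[OF hom_polys_subspace])
  qed
  have "fs.dim (hom_polys P k) = fs.dim (harmonics P k) + fs.dim (hom_polys P (k - 2))"
    by (rule dim_direct_sum[OF harmonics_subspace hom_polys_subspace int dec, of "sphere_monomial ` deg_expts P k"])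
      (use hom up in \<open>auto simp: hom_polys_def intro!: finite_imageI finite_deg_expts\<close>)
  then show ?thesis using k by (simp add: dim_hom_polys)
qed

theorem laplace_spectrum_eigenvalue:
  fixes N :: "'n::finite \<Rightarrow> nat"
  shows "card (expts (coordinate_weight N) UNIV 0 k) = laplace_spectrum N (eigenvalue CARD('n) k) +
    (if k < 2 then 0 else card (expts (coordinate_weight N) UNIV 0 (k - 2)))"
  using dim_harmonics[OF opp_closed_zero_weight, of N k]
  unfolding laplace_spectrum_def laplace_eigenspace_eq_harmonics deg_expts_zero_weight .

section \<open>Recovering the number of weights from the spectrum\<close>

lemma sum_zero_weight_coordinates:
  fixes N :: "'n::finite \<Rightarrow> nat"
  assumes "u \<in> expts (coordinate_weight N) UNIV 0 n"
  shows "(\<Sum>i\<in>UNIV. int (N i) * (int (u (i, True)) - int (u (i, False)))) = 0"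
    and "(\<Sum>i\<in>UNIV. u (i, True) + u (i, False)) = n"
proof -
  have split: "(\<Sum>k\<in>UNIV. h k) = (\<Sum>i\<in>UNIV. h (i, True) + h (i, False))" for h :: "'n \<times> bool \<Rightarrow> 'b::comm_monoid_add"
  proof -
    have "(\<Sum>i\<in>UNIV. \<Sum>b\<in>UNIV. h (i, b)) = (\<Sum>(i, b)\<in>UNIV \<times> UNIV. h (i, b))"
      by (rule sum.cartesian_product)
    also have "\<dots> = (\<Sum>k\<in>UNIV. h k)" by (simp only: UNIV_Times_UNIV case_prod_eta)
    finally show ?thesis by (simp add: UNIV_bool add.commute)
  qed
  have "(\<Sum>k\<in>UNIV. u k) = n" "(\<Sum>k\<in>UNIV. coordinate_weight N k * int (u k)) = 0"
    using assms by (simp_all add: expts_def)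
  then show "(\<Sum>i\<in>UNIV. int (N i) * (int (u (i, True)) - int (u (i, False)))) = 0"
    and "(\<Sum>i\<in>UNIV. u (i, True) + u (i, False)) = n"
    unfolding split by (simp_all add: coordinate_weight_def right_diff_distrib)
qed

lemma card_expts_0: "card (expts w UNIV 0 0) = 1"
proof -
  have "expts w UNIV 0 0 = {\<lambda>_. 0}" by (auto simp: expts_def)
  then show ?thesis by simp
qed

lemma card_expts_1:
  assumes "weights N"
  shows "card (expts (coordinate_weight N) UNIV 0 1) = 0"
proof -
  have "False" if u: "u \<in> expts (coordinate_weight N) UNIV 0 1" for u
  proof -
    have s: "(\<Sum>k\<in>UNIV. u k) = 1" "(\<Sum>k\<in>UNIV. coordinate_weight N k * int (u k)) = 0"
      using u by (simp_all add: expts_def)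
    obtain k where k: "u k = 1" "\<forall>l\<in>UNIV. k \<noteq> l \<longrightarrow> u l = 0"
      using s(1) unfolding sum_eq_1_iff[OF finite] by (elim bexE conjE)
    have "(\<Sum>l\<in>UNIV. coordinate_weight N l * int (u l)) = (\<Sum>l\<in>{k}. coordinate_weight N l * int (u l))"
      using k(2) by (intro sum.mono_neutral_right) auto
    then have "coordinate_weight N k = 0" using s(2) k(1) by simp
    moreover have "N (fst k) > 1" using assms by (simp add: weights_def)
    ultimately show False by (auto simp: coordinate_weight_def split: if_splits)
  qed
  then have "expts (coordinate_weight N) UNIV 0 1 = {}" by blast
  then show ?thesis by simp
qed

text \<open>The squares |z_i|^2 are as many invariants of degree 2 as there are weights. This
  exceeds the single invariant of degree 0, so 4 d really occurs as an eigenvalue.\<close>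

lemma card_expts_2:
  assumes "CARD('n::finite) \<ge> 2"
  shows "card (expts (coordinate_weight (N :: 'n \<Rightarrow> nat)) UNIV 0 2) \<ge> 2"
proof -
  let ?z = "\<lambda>_ :: 'n \<times> bool. 0 :: nat"
  have mem: "incr ?z (i, True) \<in> expts (coordinate_weight N) UNIV 0 2" for i
  proof -
    have "?z \<in> deg_expts (zero_weight N) 0" by (simp add: deg_expts_def zero_weight_def)
    then have "incr ?z (i, True) \<in> deg_expts (zero_weight N) (0 + 2)" by (rule deg_expts_incr[OF opp_closed_zero_weight])
    then show ?thesis unfolding deg_expts_zero_weight by (simp only: add_0)
  qed
  have inj: "inj (\<lambda>i. incr ?z (i, True))"
  proof (rule injI)
    fix i j assume h: "incr ?z (i, True) = incr ?z (j, True)"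
    have "incr ?z (i, True) (i, True) = 1" by (simp add: incr_def opp_def)
    then have "incr ?z (j, True) (i, True) = 1" unfolding h .
    then show "i = j" by (auto simp: incr_def opp_def split: if_splits)
  qed
  have "CARD('n) = card (range (\<lambda>i. incr ?z (i, True)))" using inj by (simp add: card_image)
  also have "\<dots> \<le> card (expts (coordinate_weight N) UNIV 0 2)"
    using mem by (intro card_mono finite_expts) auto
  finally show ?thesis using assms by simp
qed

text \<open>With a single weight the quotient is a point: the invariants are the powers of |z|^2,
  and no degree k >= 2 contributes an eigenvalue.\<close>

lemma card_expts_one_weight:
  assumes "CARD('n::finite) = 1" "N (i :: 'n) > 0" "k \<ge> 2"
  shows "card (expts (coordinate_weight N) UNIV 0 k) = card (expts (coordinate_weight N) UNIV 0 (k - 2))"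
proof -
  have univ: "UNIV = {i}" using assms(1) by (metis UNIV_I card_1_singletonE singletonD)
  have eq: "j = i" for j :: 'n using univ by (metis UNIV_I singletonD)
  let ?E = "\<lambda>k. expts (coordinate_weight N) UNIV 0 k"
  have ev: "u (i, True) = u (i, False) \<and> 2 * u (i, True) = n" if "u \<in> ?E n" for u n
    using sum_zero_weight_coordinates[OF that] assms(2) by (simp add: univ)
  have "bij_betw (\<lambda>u. incr u (i, True)) (?E (k - 2)) (?E k)"
  proof (rule bij_betw_byWitness[where f' = "\<lambda>u. decr (decr u (i, True)) (opp (i, True))"])
    show "\<forall>u\<in>?E (k - 2). decr (decr (incr u (i, True)) (i, True)) (opp (i, True)) = u"
      by (simp add: decr_decr_incr)
    have pos: "u (i, True) > 0 \<and> u (opp (i, True)) > 0" if "u \<in> ?E k" for u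
      using ev[OF that] assms(3) by (auto simp: opp_def)
    then show "\<forall>u\<in>?E k. incr (decr (decr u (i, True)) (opp (i, True))) (i, True) = u"
      by (auto intro!: incr_decr_decr)
    show "(\<lambda>u. incr u (i, True)) ` ?E (k - 2) \<subseteq> ?E k"
    proof -
      have "k - 2 + 2 = k" using assms(3) by simp
      then show ?thesis
        using deg_expts_incr[OF opp_closed_zero_weight, of _ N "k - 2" "(i, True)"] unfolding deg_expts_zero_weight
        by (auto simp only:)
    qed
    show "(\<lambda>u. decr (decr u (i, True)) (opp (i, True))) ` ?E k \<subseteq> ?E (k - 2)"
      using deg_expts_decr_decr[OF opp_closed_zero_weight, of _ N k "(i, True)"] pos by (auto simp: deg_expts_zero_weight)
  qed
  then show ?thesis by (metis bij_betw_same_card)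
qed

lemma eigenvalue_2: "d > 0 \<Longrightarrow> eigenvalue d 2 = of_nat (4 * d)"
  by (cases d) (simp_all add: eigenvalue_def)

text \<open>The smallest positive eigenvalue is \<open>4 d\<close>, because there are no invariant polynomials of degree 1.\<close>

lemma spectrum_determines_dimension_le:
  fixes N :: "'n::finite \<Rightarrow> nat" and M :: "'m::finite \<Rightarrow> nat"
  assumes M: "weights M" and "laplace_spectrum M = laplace_spectrum N" and d: "CARD('n) \<ge> 2"
  shows "CARD('m) \<le> CARD('n) \<and> CARD('m) \<noteq> 1"
proof -
  let ?c = "\<lambda>k. card (expts (coordinate_weight M) UNIV 0 k)"
  have M0: "CARD('m) > 0" and N0: "CARD('n) > 0" by simp_all
  have "laplace_spectrum N (eigenvalue CARD('n) 2) \<noteq> 0"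
    using laplace_spectrum_eigenvalue[of N 2] card_expts_2[OF d, of N] card_expts_0[of "coordinate_weight N"] by simp
  then have nz: "laplace_spectrum M (eigenvalue CARD('n) 2) \<noteq> 0" using assms(2) by simp
  have "\<exists>k. eigenvalue CARD('n) 2 = eigenvalue CARD('m) k"
  proof (rule ccontr)
    assume "\<not> ?thesis"
    then have "laplace_spectrum M (eigenvalue CARD('n) 2) = 0" by (intro laplace_spectrum_eq_0) blast
    with nz show False by simp
  qed
  then obtain k where k: "eigenvalue CARD('n) 2 = eigenvalue CARD('m) k" by blast
  \<comment> \<open>The first eigenvalue of \<open>N\<close> must also belong to \<open>M\<close>,
    where it comes from some degree k, which is then shown to be at least 2.\<close>
  have e: "4 * CARD('n) = k * (k + (2 * CARD('m) - 2))"
    using k d unfolding eigenvalue_2[OF N0]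
      eigenvalue_eq[OF M0] of_nat_eq_iff by simp
  have nzk: "laplace_spectrum M (eigenvalue CARD('m) k) \<noteq> 0" using nz k by simp
  have k0: "k \<noteq> 0"
  proof
    assume "k = 0"
    then have "4 * CARD('n) = 0" using e by simp
    then show False by simp
  qed
  have k1: "k \<noteq> 1"
  proof
    assume "k = 1"
    then show False using laplace_spectrum_eigenvalue[of M 1] card_expts_1[OF M] nzk by simp
  qed
  have k2: "k \<ge> 2" using k0 k1 by simp
  have "CARD('m) \<noteq> 1"
  proof
    assume m1: "CARD('m) = 1"
    obtain i :: 'm where True by simp
    have "M i > 0" by (rule weights_pos[OF M])
    then show False
      using card_expts_one_weight[OF m1 _ k2, of M i] laplace_spectrum_eigenvalue[of M k] nzk k2 by simp
  qed
  \<comment> \<open>The left side is 4 times the number of weights of \<open>M\<close>, the right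
    side is 4 times that of \<open>N\<close>.\<close>
  moreover have "2 * (2 + (2 * CARD('m) - 2)) \<le> k * (k + (2 * CARD('m) - 2))"
    by (rule mult_le_mono[OF k2 add_right_mono[OF k2]])
  then have "CARD('m) \<le> CARD('n)" using e M0 by simp
  ultimately show ?thesis by simp
qed

lemma spectrum_determines_dimension:
  fixes N :: "'n::finite \<Rightarrow> nat" and M :: "'m::finite \<Rightarrow> nat"
  assumes "weights M" "weights N" "laplace_spectrum M = laplace_spectrum N" "CARD('n) \<ge> 2"
  shows "CARD('m) = CARD('n)"
proof -
  have 1: "CARD('m) \<le> CARD('n)" "CARD('m) \<noteq> 1"
    using spectrum_determines_dimension_le[OF assms(1,3,4)] by simp_all
  moreover have "CARD('m) \<noteq> 0" by simp
  ultimately have "CARD('m) \<ge> 2" by linarith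
  then have "CARD('n) \<le> CARD('m)"
    using spectrum_determines_dimension_le[OF assms(2) assms(3)[symmetric]] by simp
  then show ?thesis using 1 by simp
qed

text \<open>The eigenvalue attached to degree k depends on the weights only through their number, so
  both counts satisfy the same recursion in steps of two.\<close>

lemma spectrum_determines_gf:
  fixes N :: "'n::finite \<Rightarrow> nat" and M :: "'m::finite \<Rightarrow> nat"
  assumes "laplace_spectrum M = laplace_spectrum N" "CARD('m) = CARD('n)"
  shows "expts_gf (coordinate_weight M) UNIV 0 = expts_gf (coordinate_weight N) UNIV 0"
proof -
  have "card (expts (coordinate_weight M) UNIV 0 k) = card (expts (coordinate_weight N) UNIV 0 k)" for k
  proof (induction k rule: less_induct)
    case (less k)
    then show ?case
      using laplace_spectrum_eigenvalue[of M k] laplace_spectrum_eigenvalue[of N k] less[of "k - 2"] assms by simp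
  qed
  then show ?thesis by (simp add: expts_gf_def)
qed

theorem theorem5p3:
  fixes N :: "'n::{finite,linorder} \<Rightarrow> nat"
  assumes "weights N"
    and "strict_mono N"
    and "N (Max UNIV) \<le> 2 * N (Min UNIV)"
    and "inj_on (\<lambda>(i, j). N i + N j) {(i, j). i < j}"
  shows "card {gamma N i j | i j. i < j} = CARD('n) choose 2 \<and>
    are_shortest_geodesics N {gamma N i j | i j. i < j} \<and>
    ((\<nexists>k. CARD('n) = 2 ^ k) \<longrightarrow>
      (\<forall>M :: 'm::finite \<Rightarrow> nat. weights M \<and> laplace_spectrum M = laplace_spectrum N \<longrightarrow>
        range M = range N))"
proof -
  have mono: "N i \<le> N j" if "i \<le> j" for i j
    using strict_mono_less_eq[OF assms(2)] that by blast
  have bound: "N j \<le> 2 * N i" for i j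
  proof -
    have "N j \<le> N (Max UNIV)" by (intro mono Max_ge) auto
    also have "\<dots> \<le> 2 * N (Min UNIV)" by (rule assms(3))
    also have "\<dots> \<le> 2 * N i" by (intro mult_left_mono mono Min_le) auto
    finally show ?thesis .
  qed
  have inj: "inj_on (sum N) {A. card A = 2}"
  proof (rule inj_onI)
    fix A B :: "'n set" assume AB: "A \<in> {A. card A = 2}" "B \<in> {A. card A = 2}" "sum N A = sum N B"
    have ord: "\<exists>i j. i < j \<and> A = {i, j}" if A: "card A = 2" for A :: "'n set"
    proof -
      obtain x y where "A = {x, y}" "x \<noteq> y" using A unfolding card_2_iff by (elim exE conjE)
      then show ?thesis by (cases "x < y") (auto simp: insert_commute not_less_iff_gr_or_eq)
    qed
    obtain i j where ij: "i < j" "A = {i, j}" using ord[of A] AB(1) by blast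
    obtain k l where kl: "k < l" "B = {k, l}" using ord[of B] AB(2) by blast
    have "N i + N j = N k + N l" using AB(3) ij kl by simp
    then have "(i, j) = (k, l)" using inj_onD[OF assms(4), of "(i, j)" "(k, l)"] ij kl by simp
    then show "A = B" using ij kl by simp
  qed
  have "range M = range N"
    if np: "\<nexists>k. CARD('n) = 2 ^ k" and M: "weights M" "laplace_spectrum M = laplace_spectrum N"
    for M :: "'m \<Rightarrow> nat"
  proof -
    have "CARD('n) \<noteq> 0" by simp
    \<comment> \<open>A single weight is excluded because 1 = 2^0 is a power of two.\<close>
    moreover have "CARD('n) \<noteq> 1" using np by (metis power_0)
    ultimately have "CARD('n) \<ge> 2" by linarith
    then have card: "CARD('m) = CARD('n)" by (rule spectrum_determines_dimension[OF M(1) assms(1) M(2)])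
    show ?thesis
      by (rule invariant_gf_determines_range[OF M(1) assms(1) card np bound inj spectrum_determines_gf[OF M(2) card]])
  qed
  then show ?thesis
    using card_gamma[OF assms(1)] gamma_are_shortest_geodesics[OF assms(1) bound] by blast
qed

end
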